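(* Let $\mathcal{T}$ be a bimonad on a monoidal category $(\mathsf{C},\cdot,I)$, let $\mathsf{M}$ be a (left) $\mathsf{C}$-module-category, and let $\mathcal{S}$ be a $\mathcal{T}$-comodule-monad on $\mathsf{M}$. Let $C$ be a comonoid in $\mathsf{C}$ and let $Z=\mathcal{T}(C)$ be the free $\mathcal{T}$-algebra-comonoid on $C$. Assume: (a) the category $\mathsf{M}$ has equalizers of all coreflexive pairs; (b) the functors $\hat{C}$ and $\mathcal{S}$ preserve such equalizers; (c) the functor $\mathcal{S}$ is conservative. Then the functors $\mathcal{A}:\mathsf{M}_{\hat{C}}\to\mathsf{Hopf}(\mathcal{T};\mathcal{S},Z)$ and $\mathcal{B}:\mathsf{Hopf}(\mathcal{T};\mathcal{S},Z)\to\mathsf{M}_{\hat{C}}$ form an adjoint equivalence $$\mathsf{M}_{\hat{C}}\cong\mathsf{Hopf}(\mathcal{T};\mathcal{S},Z)$$ if and only if the Galois map $$\mathbb{G}_{C,M}:\mathcal{S}(C\cdot\mathcal{S}(M))\to\mathcal{T}(C)\cdot\mathcal{S}(M)=Z\cdot\mathcal{S}(M)$$ is invertible for all objects $M$ in $\mathsf{M}$.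
   Context: Both the tensor product of $\mathsf{C}$ and its action on $\mathsf{M}$ are written $\cdot$; associativity and unit constraints are suppressed. A functor is conservative if it reflects isomorphisms. A parallel pair $f,g:X\rightrightarrows Y$ is coreflexive if there is $r:Y\to X$ with $rf=\mathrm{id}=rg$. Bimonad: a monad $(\mathcal{T},\mu,\iota)$ on $\mathsf{C}$ whose functor is comonoidal (= colax monoidal), with structure $\psi_{X,Y}:\mathcal{T}(X\cdot Y)\to\mathcal{T}(X)\cdot\mathcal{T}(Y)$, $\psi_0:\mathcal{T}(I)\to I$, and such that $\mu,\iota$ are morphisms of comonoidal functors. $\mathcal{T}$-comodule-monad: a monad $(\mathcal{S},\mu,\iota)$ on $\mathsf{M}$ with a natural transformation $\chi_{X,M}:\mathcal{S}(X\cdot M)\to\mathcal{T}(X)\cdot\mathcal{S}(M)$ such that $(\mathrm{id}\cdot\chi_{Y,M})\chi_{X,Y\cdot M}=(\psi_{X,Y}\cdot\mathrm{id})\chi_{X\cdot Y,M}$; $(\psi_0\cdot\mathrm{id})\chi_{I,M}=\mathrm{id}$; $\chi_{X,M}\,\mu_{X\cdot M}=(\mu_X\cdot\mu_M)\,\chi_{\mathcal{T}(X),\mathcal{S}(M)}\,\mathcal{S}(\chi_{X,M})$; $\chi_{X,M}\,\iota_{X\cdot M}=\iota_X\cdot\iota_M$. For a comonoid $(C,\Delta,\epsilon)$ in $\mathsf{C}$, $\hat{C}$ is the comonad $\hat C(M)=C\cdot M$ on $\mathsf{M}$, and $\mathsf{M}_{\hat{C}}$ is the category of left $C$-comodules in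 $\mathsf{M}$. The object $Z=\mathcal{T}(C)$ is a comonoid in $\mathsf{C}$ with comultiplication $\psi_{C,C}\mathcal{T}(\Delta)$ and counit $\psi_0\mathcal{T}(\epsilon)$, and a $\mathcal{T}$-algebra with action $\alpha=\mu_C:\mathcal{T}(Z)\to Z$. A Hopf $(\mathcal{T};\mathcal{S},Z)$-module $(M,\sigma,\zeta)$ is an object $M$ of $\mathsf{M}$ with an $\mathcal{S}$-algebra structure $\sigma:\mathcal{S}(M)\to M$ and a left $Z$-comodule structure $\zeta:M\to Z\cdot M$ such that $\zeta\sigma=(\alpha\cdot\sigma)\,\chi_{Z,M}\,\mathcal{S}(\zeta)$. Morphisms are arrows in $\mathsf{M}$ which are morphisms of $\mathcal{S}$-algebras and of $Z$-comodules; the category is $\mathsf{Hopf}(\mathcal{T};\mathcal{S},Z)$. Functor $\mathcal{A}$: $\mathcal{A}(M,c)=(\mathcal{S}(M),\mu_M,d)$ with $d=\chi_{C,M}\circ\mathcal{S}(c):\mathcal{S}(M)\to\mathcal{S}(C\cdot M)\to\mathcal{T}(C)\cdot\mathcal{S}(M)$. Functor $\mathcal{B}$: $\mathcal{B}(M,\sigma,\zeta)$ is the equalizer in $\mathsf{M}_{\hat{C}}$ (it exists under the present hypotheses) of the pair $$C\cdot M\xrightarrow{\Delta\cdot\mathrm{id}}C\cdot C\cdot M\xrightarrow{\mathrm{id}\cdot\iota_C\cdot\mathrm{id}}C\cdot\mathcal{T}(C)\cdot M=C\cdot Z\cdot M\quad\text{and}\quad C\cdot M\xrightarrow{\mathrm{id}\cdot\zeta}C\cdot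 Z\cdot M$$ (of cofree $C$-comodules). The adjunction $\mathcal{A}\dashv\mathcal{B}$ has unit at $(M,c)$ the map $M\to\mathcal{B}\mathcal{A}(M,c)$ induced by $(\mathrm{id}\cdot\iota_M)c:M\to C\cdot\mathcal{S}(M)$, and counit at $(M,\sigma,\zeta)$ the composite $\mathcal{S}(\mathcal{B}(M,\sigma,\zeta))\to\mathcal{S}(C\cdot M)\xrightarrow{\mathcal{S}(\epsilon\cdot\mathrm{id})}\mathcal{S}(M)\xrightarrow{\sigma}M$. The Galois map is $\mathbb{G}_{X,M}=(\mathrm{id}_{\mathcal{T}(X)}\cdot\mu_M)\circ\chi_{X,\mathcal{S}(M)}:\mathcal{S}(X\cdot\mathcal{S}(M))\to\mathcal{T}(X)\cdot\mathcal{S}(M)$. *)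

theory Defs
  imports Main
begin

section \<open>Categories, functors, equalizers\<close>

text \<open>
  Every arrow carries its own domain and codomain. Operations are total functions of the logic; only
  their values on objects, on arrows and on composable pairs are constrained.
\<close>

record ('o, 'a) category =
  Ob :: "'o set"
  Arr :: "'a set"
  Dom :: "'a \<Rightarrow> 'o"
  Cod :: "'a \<Rightarrow> 'o"
  Ident :: "'o \<Rightarrow> 'a"
  Comp :: "'a \<Rightarrow> 'a \<Rightarrow> 'a" (infixl "\<bullet>\<index>" 65)

definition hom :: "('o, 'a, 'x) category_scheme \<Rightarrow> 'o \<Rightarrow> 'o \<Rightarrow> 'a set" where
  "hom \<C> X Y = {f \<in> Arr \<C>. Dom \<C> f = X \<and> Cod \<C> f = Y}"

locale category =
  fixes \<C> :: "('o, 'a, 'x) category_scheme" (structure)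
  assumes Dom_Ob: "f \<in> Arr \<C> \<Longrightarrow> Dom \<C> f \<in> Ob \<C>"
    and Cod_Ob: "f \<in> Arr \<C> \<Longrightarrow> Cod \<C> f \<in> Ob \<C>"
    and Ident_hom: "X \<in> Ob \<C> \<Longrightarrow> Ident \<C> X \<in> hom \<C> X X"
    and Comp_hom: "\<lbrakk>f \<in> hom \<C> X Y; g \<in> hom \<C> Y Z\<rbrakk> \<Longrightarrow> g \<bullet> f \<in> hom \<C> X Z"
    and Comp_Ident: "f \<in> hom \<C> X Y \<Longrightarrow> f \<bullet> Ident \<C> X = f"
    and Ident_Comp: "f \<in> hom \<C> X Y \<Longrightarrow> Ident \<C> Y \<bullet> f = f"
    and Comp_assoc: "\<lbrakk>f \<in> hom \<C> W X; g \<in> hom \<C> X Y; h \<in> hom \<C> Y Z\<rbrakk>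
      \<Longrightarrow> (h \<bullet> g) \<bullet> f = h \<bullet> (g \<bullet> f)"

definition is_iso :: "('o, 'a, 'x) category_scheme \<Rightarrow> 'a \<Rightarrow> bool" where
  "is_iso \<C> f \<longleftrightarrow> f \<in> Arr \<C> \<and>
    (\<exists>g \<in> hom \<C> (Cod \<C> f) (Dom \<C> f).
      g \<bullet>\<^bsub>\<C>\<^esub> f = Ident \<C> (Dom \<C> f) \<and> f \<bullet>\<^bsub>\<C>\<^esub> g = Ident \<C> (Cod \<C> f))"

record ('o, 'a, 'p, 'b) functor_data =
  ob :: "'o \<Rightarrow> 'p"
  ar :: "'a \<Rightarrow> 'b"

locale cat_functor = source: category \<C> + target: category \<D>
  for \<C> :: "('o, 'a, 'x) category_scheme"
    and \<D> :: "('p, 'b, 'y) category_scheme" +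
  fixes F :: "('o, 'a, 'p, 'b, 'z) functor_data_scheme"
  assumes ob_Ob: "X \<in> Ob \<C> \<Longrightarrow> ob F X \<in> Ob \<D>"
    and ar_hom: "f \<in> hom \<C> X Y \<Longrightarrow> ar F f \<in> hom \<D> (ob F X) (ob F Y)"
    and ar_Ident: "X \<in> Ob \<C> \<Longrightarrow> ar F (Ident \<C> X) = Ident \<D> (ob F X)"
    and ar_Comp: "\<lbrakk>f \<in> hom \<C> X Y; g \<in> hom \<C> Y Z\<rbrakk>
      \<Longrightarrow> ar F (g \<bullet>\<^bsub>\<C>\<^esub> f) = ar F g \<bullet>\<^bsub>\<D>\<^esub> ar F f"

definition id_functor :: "('o, 'a, 'o, 'a) functor_data" where
  "id_functor = \<lparr>ob = (\<lambda>X. X), ar = (\<lambda>f. f)\<rparr>"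

definition comp_functor ::
  "('p, 'b, 'q, 'c, 'y) functor_data_scheme \<Rightarrow> ('o, 'a, 'p, 'b, 'x) functor_data_scheme
    \<Rightarrow> ('o, 'a, 'q, 'c) functor_data" where
  "comp_functor G F = \<lparr>ob = (\<lambda>X. ob G (ob F X)), ar = (\<lambda>f. ar G (ar F f))\<rparr>"

locale natural_transformation = F: cat_functor \<C> \<D> F + G: cat_functor \<C> \<D> G
  for \<C> :: "('o, 'a, 'x) category_scheme"
    and \<D> :: "('p, 'b, 'y) category_scheme"
    and F :: "('o, 'a, 'p, 'b, 'z) functor_data_scheme"
    and G :: "('o, 'a, 'p, 'b, 'w) functor_data_scheme" +
  fixes \<tau> :: "'o \<Rightarrow> 'b"
  assumes component_hom: "X \<in> Ob \<C> \<Longrightarrow> \<tau> X \<in> hom \<D> (ob F X) (ob G X)"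
    and naturality: "f \<in> hom \<C> X Y \<Longrightarrow> \<tau> Y \<bullet>\<^bsub>\<D>\<^esub> ar F f = ar G f \<bullet>\<^bsub>\<D>\<^esub> \<tau> X"

locale adjunction =
  unit: natural_transformation \<C> \<C> id_functor "comp_functor G F" \<eta> +
  counit: natural_transformation \<D> \<D> "comp_functor F G" id_functor \<epsilon> +
  left: cat_functor \<C> \<D> F + right: cat_functor \<D> \<C> G
  for \<C> :: "('o, 'a, 'x) category_scheme"
    and \<D> :: "('p, 'b, 'y) category_scheme"
    and F :: "('o, 'a, 'p, 'b, 'z) functor_data_scheme"
    and G :: "('p, 'b, 'o, 'a, 'w) functor_data_scheme"
    and \<eta> :: "'o \<Rightarrow> 'a" and \<epsilon> :: "'p \<Rightarrow> 'b" +
  assumes left_triangle: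
      "X \<in> Ob \<C> \<Longrightarrow> \<epsilon> (ob F X) \<bullet>\<^bsub>\<D>\<^esub> ar F (\<eta> X) = Ident \<D> (ob F X)"
    and right_triangle:
      "Y \<in> Ob \<D> \<Longrightarrow> ar G (\<epsilon> Y) \<bullet>\<^bsub>\<C>\<^esub> \<eta> (ob G Y) = Ident \<C> (ob G Y)"

locale adjoint_equivalence = adjunction +
  assumes unit_iso: "X \<in> Ob \<C> \<Longrightarrow> is_iso \<C> (\<eta> X)"
    and counit_iso: "Y \<in> Ob \<D> \<Longrightarrow> is_iso \<D> (\<epsilon> Y)"

definition conservative ::
  "('o, 'a, 'x) category_scheme \<Rightarrow> ('p, 'b, 'y) category_scheme
    \<Rightarrow> ('o, 'a, 'p, 'b, 'z) functor_data_scheme \<Rightarrow> bool" where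
  "conservative \<C> \<D> F \<longleftrightarrow> (\<forall>f \<in> Arr \<C>. is_iso \<D> (ar F f) \<longrightarrow> is_iso \<C> f)"

definition parallel :: "('o, 'a, 'x) category_scheme \<Rightarrow> 'a \<Rightarrow> 'a \<Rightarrow> bool" where
  "parallel \<C> f g \<longleftrightarrow>
    f \<in> Arr \<C> \<and> g \<in> Arr \<C> \<and> Dom \<C> f = Dom \<C> g \<and> Cod \<C> f = Cod \<C> g"

definition coreflexive :: "('o, 'a, 'x) category_scheme \<Rightarrow> 'a \<Rightarrow> 'a \<Rightarrow> bool" where
  "coreflexive \<C> f g \<longleftrightarrow> parallel \<C> f g \<and>
    (\<exists>r \<in> hom \<C> (Cod \<C> f) (Dom \<C> f).
      r \<bullet>\<^bsub>\<C>\<^esub> f = Ident \<C> (Dom \<C> f) \<and> r \<bullet>\<^bsub>\<C>\<^esub> g = Ident \<C> (Dom \<C> f))"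

definition is_equalizer :: "('o, 'a, 'x) category_scheme \<Rightarrow> 'a \<Rightarrow> 'a \<Rightarrow> 'a \<Rightarrow> bool" where
  "is_equalizer \<C> f g e \<longleftrightarrow> parallel \<C> f g \<and>
    e \<in> Arr \<C> \<and> Cod \<C> e = Dom \<C> f \<and> f \<bullet>\<^bsub>\<C>\<^esub> e = g \<bullet>\<^bsub>\<C>\<^esub> e \<and>
    (\<forall>h \<in> Arr \<C>. Cod \<C> h = Dom \<C> f \<and> f \<bullet>\<^bsub>\<C>\<^esub> h = g \<bullet>\<^bsub>\<C>\<^esub> h \<longrightarrow>
      (\<exists>!k. k \<in> hom \<C> (Dom \<C> h) (Dom \<C> e) \<and> e \<bullet>\<^bsub>\<C>\<^esub> k = h))"

definition has_coreflexive_equalizers :: "('o, 'a, 'x) category_scheme \<Rightarrow> bool" where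
  "has_coreflexive_equalizers \<C> \<longleftrightarrow>
    (\<forall>f g. coreflexive \<C> f g \<longrightarrow> (\<exists>e. is_equalizer \<C> f g e))"

definition preserves_coreflexive_equalizers ::
  "('o, 'a, 'x) category_scheme \<Rightarrow> ('p, 'b, 'y) category_scheme
    \<Rightarrow> ('o, 'a, 'p, 'b, 'z) functor_data_scheme \<Rightarrow> bool" where
  "preserves_coreflexive_equalizers \<C> \<D> F \<longleftrightarrow>
    (\<forall>f g e. coreflexive \<C> f g \<and> is_equalizer \<C> f g e
      \<longrightarrow> is_equalizer \<D> (ar F f) (ar F g) (ar F e))"


section \<open>Monoidal categories and module categories\<close>

text \<open>
  Neither monoidal categories nor module categories are assumed strict: the associativity and unit
  constraints are explicit data, and appear in every formula below in which they are
  usually suppressed. The constraints of a module category \<open>\<M>\<close> are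
  \<open>massoc \<M> X Y P : (X \<otimes> Y) \<odot> P \<rightarrow> X \<odot> (Y \<odot> P)\<close> and \<open>mlunit \<M> P : I \<odot> P \<rightarrow> P\<close>.
\<close>

record ('o, 'a) monoidal_category = "('o, 'a) category" +
  tensor_ob :: "'o \<Rightarrow> 'o \<Rightarrow> 'o" (infixr "\<otimes>\<index>" 70)
  tensor_ar :: "'a \<Rightarrow> 'a \<Rightarrow> 'a" (infixr "\<otimes>\<^sub>a\<index>" 70)
  unit_ob :: "'o"
  assoc :: "'o \<Rightarrow> 'o \<Rightarrow> 'o \<Rightarrow> 'a"
  lunit :: "'o \<Rightarrow> 'a"
  runit :: "'o \<Rightarrow> 'a"

locale monoidal_category = category \<C>
  for \<C> :: "('o, 'a, 'x) monoidal_category_scheme" (structure) +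
  assumes unit_Ob: "unit_ob \<C> \<in> Ob \<C>"
    and tensor_Ob: "\<lbrakk>X \<in> Ob \<C>; Y \<in> Ob \<C>\<rbrakk> \<Longrightarrow> X \<otimes> Y \<in> Ob \<C>"
    and tensor_hom: "\<lbrakk>f \<in> hom \<C> X X'; g \<in> hom \<C> Y Y'\<rbrakk>
      \<Longrightarrow> f \<otimes>\<^sub>a g \<in> hom \<C> (X \<otimes> Y) (X' \<otimes> Y')"
    and tensor_Ident: "\<lbrakk>X \<in> Ob \<C>; Y \<in> Ob \<C>\<rbrakk>
      \<Longrightarrow> Ident \<C> X \<otimes>\<^sub>a Ident \<C> Y = Ident \<C> (X \<otimes> Y)"
    and tensor_Comp: "\<lbrakk>f \<in> hom \<C> X X'; f' \<in> hom \<C> X' X''; g \<in> hom \<C> Y Y'; g' \<in> hom \<C> Y' Y''\<rbrakk>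
      \<Longrightarrow> (f' \<bullet> f) \<otimes>\<^sub>a (g' \<bullet> g) = (f' \<otimes>\<^sub>a g') \<bullet> (f \<otimes>\<^sub>a g)"
    and assoc_hom: "\<lbrakk>X \<in> Ob \<C>; Y \<in> Ob \<C>; Z \<in> Ob \<C>\<rbrakk>
      \<Longrightarrow> assoc \<C> X Y Z \<in> hom \<C> ((X \<otimes> Y) \<otimes> Z) (X \<otimes> (Y \<otimes> Z))"
    and assoc_iso: "\<lbrakk>X \<in> Ob \<C>; Y \<in> Ob \<C>; Z \<in> Ob \<C>\<rbrakk> \<Longrightarrow> is_iso \<C> (assoc \<C> X Y Z)"
    and assoc_natural: "\<lbrakk>f \<in> hom \<C> X X'; g \<in> hom \<C> Y Y'; h \<in> hom \<C> Z Z'\<rbrakk>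
      \<Longrightarrow> assoc \<C> X' Y' Z' \<bullet> ((f \<otimes>\<^sub>a g) \<otimes>\<^sub>a h) = (f \<otimes>\<^sub>a (g \<otimes>\<^sub>a h)) \<bullet> assoc \<C> X Y Z"
    and lunit_hom: "X \<in> Ob \<C> \<Longrightarrow> lunit \<C> X \<in> hom \<C> (unit_ob \<C> \<otimes> X) X"
    and lunit_iso: "X \<in> Ob \<C> \<Longrightarrow> is_iso \<C> (lunit \<C> X)"
    and lunit_natural: "f \<in> hom \<C> X Y
      \<Longrightarrow> lunit \<C> Y \<bullet> (Ident \<C> (unit_ob \<C>) \<otimes>\<^sub>a f) = f \<bullet> lunit \<C> X"
    and runit_hom: "X \<in> Ob \<C> \<Longrightarrow> runit \<C> X \<in> hom \<C> (X \<otimes> unit_ob \<C>) X"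
    and runit_iso: "X \<in> Ob \<C> \<Longrightarrow> is_iso \<C> (runit \<C> X)"
    and runit_natural: "f \<in> hom \<C> X Y
      \<Longrightarrow> runit \<C> Y \<bullet> (f \<otimes>\<^sub>a Ident \<C> (unit_ob \<C>)) = f \<bullet> runit \<C> X"
    and pentagon: "\<lbrakk>W \<in> Ob \<C>; X \<in> Ob \<C>; Y \<in> Ob \<C>; Z \<in> Ob \<C>\<rbrakk>
      \<Longrightarrow> assoc \<C> W X (Y \<otimes> Z) \<bullet> assoc \<C> (W \<otimes> X) Y Z
        = (Ident \<C> W \<otimes>\<^sub>a assoc \<C> X Y Z) \<bullet> assoc \<C> W (X \<otimes> Y) Z \<bullet> (assoc \<C> W X Y \<otimes>\<^sub>a Ident \<C> Z)"
    and triangle: "\<lbrakk>X \<in> Ob \<C>; Y \<in> Ob \<C>\<rbrakk>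
      \<Longrightarrow> (Ident \<C> X \<otimes>\<^sub>a lunit \<C> Y) \<bullet> assoc \<C> X (unit_ob \<C>) Y = runit \<C> X \<otimes>\<^sub>a Ident \<C> Y"

record ('o, 'a, 'p, 'b) module_category = "('p, 'b) category" +
  act_ob :: "'o \<Rightarrow> 'p \<Rightarrow> 'p" (infixr "\<odot>\<index>" 70)
  act_ar :: "'a \<Rightarrow> 'b \<Rightarrow> 'b" (infixr "\<odot>\<^sub>a\<index>" 70)
  massoc :: "'o \<Rightarrow> 'o \<Rightarrow> 'p \<Rightarrow> 'b"
  mlunit :: "'p \<Rightarrow> 'b"

locale module_category = base: monoidal_category \<C> + category \<M>
  for \<C> :: "('o, 'a, 'x) monoidal_category_scheme"
    and \<M> :: "('o, 'a, 'p, 'b, 'y) module_category_scheme" (structure) +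
  assumes act_Ob: "\<lbrakk>X \<in> Ob \<C>; P \<in> Ob \<M>\<rbrakk> \<Longrightarrow> X \<odot> P \<in> Ob \<M>"
    and act_hom: "\<lbrakk>f \<in> hom \<C> X X'; p \<in> hom \<M> P P'\<rbrakk> \<Longrightarrow> f \<odot>\<^sub>a p \<in> hom \<M> (X \<odot> P) (X' \<odot> P')"
    and act_Ident: "\<lbrakk>X \<in> Ob \<C>; P \<in> Ob \<M>\<rbrakk>
      \<Longrightarrow> Ident \<C> X \<odot>\<^sub>a Ident \<M> P = Ident \<M> (X \<odot> P)"
    and act_Comp: "\<lbrakk>f \<in> hom \<C> X X'; f' \<in> hom \<C> X' X''; p \<in> hom \<M> P P'; p' \<in> hom \<M> P' P''\<rbrakk>
      \<Longrightarrow> (f' \<bullet>\<^bsub>\<C>\<^esub> f) \<odot>\<^sub>a (p' \<bullet> p) = (f' \<odot>\<^sub>a p') \<bullet> (f \<odot>\<^sub>a p)"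
    and massoc_hom: "\<lbrakk>X \<in> Ob \<C>; Y \<in> Ob \<C>; P \<in> Ob \<M>\<rbrakk>
      \<Longrightarrow> massoc \<M> X Y P \<in> hom \<M> ((X \<otimes>\<^bsub>\<C>\<^esub> Y) \<odot> P) (X \<odot> (Y \<odot> P))"
    and massoc_iso: "\<lbrakk>X \<in> Ob \<C>; Y \<in> Ob \<C>; P \<in> Ob \<M>\<rbrakk> \<Longrightarrow> is_iso \<M> (massoc \<M> X Y P)"
    and massoc_natural: "\<lbrakk>f \<in> hom \<C> X X'; g \<in> hom \<C> Y Y'; p \<in> hom \<M> P P'\<rbrakk>
      \<Longrightarrow> massoc \<M> X' Y' P' \<bullet> ((f \<otimes>\<^sub>a\<^bsub>\<C>\<^esub> g) \<odot>\<^sub>a p) = (f \<odot>\<^sub>a (g \<odot>\<^sub>a p)) \<bullet> massoc \<M> X Y P"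
    and mlunit_hom: "P \<in> Ob \<M> \<Longrightarrow> mlunit \<M> P \<in> hom \<M> (unit_ob \<C> \<odot> P) P"
    and mlunit_iso: "P \<in> Ob \<M> \<Longrightarrow> is_iso \<M> (mlunit \<M> P)"
    and mlunit_natural: "p \<in> hom \<M> P Q
      \<Longrightarrow> mlunit \<M> Q \<bullet> (Ident \<C> (unit_ob \<C>) \<odot>\<^sub>a p) = p \<bullet> mlunit \<M> P"
    and mpentagon: "\<lbrakk>W \<in> Ob \<C>; X \<in> Ob \<C>; Y \<in> Ob \<C>; P \<in> Ob \<M>\<rbrakk>
      \<Longrightarrow> massoc \<M> W X (Y \<odot> P) \<bullet> massoc \<M> (W \<otimes>\<^bsub>\<C>\<^esub> X) Y P
        = (Ident \<C> W \<odot>\<^sub>a massoc \<M> X Y P) \<bullet> massoc \<M> W (X \<otimes>\<^bsub>\<C>\<^esub> Y) P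
          \<bullet> (assoc \<C> W X Y \<odot>\<^sub>a Ident \<M> P)"
    and mtriangle: "\<lbrakk>X \<in> Ob \<C>; P \<in> Ob \<M>\<rbrakk>
      \<Longrightarrow> (Ident \<C> X \<odot>\<^sub>a mlunit \<M> P) \<bullet> massoc \<M> X (unit_ob \<C>) P = runit \<C> X \<odot>\<^sub>a Ident \<M> P"


section \<open>Bimonads and comodule-monads\<close>

record ('o, 'a) monad = "('o, 'a, 'o, 'a) functor_data" +
  mu :: "'o \<Rightarrow> 'a"
  iota :: "'o \<Rightarrow> 'a"

locale cat_monad = category \<C> + endo: cat_functor \<C> \<C> T +
  mu: natural_transformation \<C> \<C> "comp_functor T T" T "mu T" +
  iota: natural_transformation \<C> \<C> id_functor T "iota T"
  for \<C> :: "('o, 'a, 'x) category_scheme" (structure)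
    and T :: "('o, 'a, 'z) monad_scheme" +
  assumes mu_assoc: "X \<in> Ob \<C> \<Longrightarrow> mu T X \<bullet> ar T (mu T X) = mu T X \<bullet> mu T (ob T X)"
    and mu_iota: "X \<in> Ob \<C> \<Longrightarrow> mu T X \<bullet> iota T (ob T X) = Ident \<C> (ob T X)"
    and mu_ar_iota: "X \<in> Ob \<C> \<Longrightarrow> mu T X \<bullet> ar T (iota T X) = Ident \<C> (ob T X)"

record ('o, 'a) bimonad = "('o, 'a) monad" +
  psi :: "'o \<Rightarrow> 'o \<Rightarrow> 'a"
  psi0 :: "'a"

locale bimonad = monoidal_category \<C> + cat_monad \<C> T
  for \<C> :: "('o, 'a, 'x) monoidal_category_scheme" (structure)
    and T :: "('o, 'a, 'z) bimonad_scheme" +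
  assumes psi_hom: "\<lbrakk>X \<in> Ob \<C>; Y \<in> Ob \<C>\<rbrakk>
      \<Longrightarrow> psi T X Y \<in> hom \<C> (ob T (X \<otimes> Y)) (ob T X \<otimes> ob T Y)"
    and psi_natural: "\<lbrakk>f \<in> hom \<C> X X'; g \<in> hom \<C> Y Y'\<rbrakk>
      \<Longrightarrow> psi T X' Y' \<bullet> ar T (f \<otimes>\<^sub>a g) = (ar T f \<otimes>\<^sub>a ar T g) \<bullet> psi T X Y"
    and psi0_hom: "psi0 T \<in> hom \<C> (ob T (unit_ob \<C>)) (unit_ob \<C>)"
    and psi_coassoc: "\<lbrakk>X \<in> Ob \<C>; Y \<in> Ob \<C>; Z \<in> Ob \<C>\<rbrakk>
      \<Longrightarrow> assoc \<C> (ob T X) (ob T Y) (ob T Z) \<bullet> (psi T X Y \<otimes>\<^sub>a Ident \<C> (ob T Z)) \<bullet> psi T (X \<otimes> Y) Z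
        = (Ident \<C> (ob T X) \<otimes>\<^sub>a psi T Y Z) \<bullet> psi T X (Y \<otimes> Z) \<bullet> ar T (assoc \<C> X Y Z)"
    and psi_left_counit: "X \<in> Ob \<C>
      \<Longrightarrow> lunit \<C> (ob T X) \<bullet> (psi0 T \<otimes>\<^sub>a Ident \<C> (ob T X)) \<bullet> psi T (unit_ob \<C>) X
        = ar T (lunit \<C> X)"
    and psi_right_counit: "X \<in> Ob \<C>
      \<Longrightarrow> runit \<C> (ob T X) \<bullet> (Ident \<C> (ob T X) \<otimes>\<^sub>a psi0 T) \<bullet> psi T X (unit_ob \<C>)
        = ar T (runit \<C> X)"
    and mu_comonoidal: "\<lbrakk>X \<in> Ob \<C>; Y \<in> Ob \<C>\<rbrakk>
      \<Longrightarrow> psi T X Y \<bullet> mu T (X \<otimes> Y)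
        = (mu T X \<otimes>\<^sub>a mu T Y) \<bullet> psi T (ob T X) (ob T Y) \<bullet> ar T (psi T X Y)"
    and mu_comonoidal0: "psi0 T \<bullet> mu T (unit_ob \<C>) = psi0 T \<bullet> ar T (psi0 T)"
    and iota_comonoidal: "\<lbrakk>X \<in> Ob \<C>; Y \<in> Ob \<C>\<rbrakk>
      \<Longrightarrow> psi T X Y \<bullet> iota T (X \<otimes> Y) = iota T X \<otimes>\<^sub>a iota T Y"
    and iota_comonoidal0: "psi0 T \<bullet> iota T (unit_ob \<C>) = Ident \<C> (unit_ob \<C>)"

record ('o, 'p, 'b) comodule_monad = "('p, 'b) monad" +
  chi :: "'o \<Rightarrow> 'p \<Rightarrow> 'b"

locale comodule_monad = module_category \<C> \<M> + base: bimonad \<C> T + cat_monad \<M> S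
  for \<C> :: "('o, 'a, 'x) monoidal_category_scheme"
    and \<M> :: "('o, 'a, 'p, 'b, 'y) module_category_scheme" (structure)
    and T :: "('o, 'a, 'z) bimonad_scheme"
    and S :: "('o, 'p, 'b, 'w) comodule_monad_scheme" +
  assumes chi_hom: "\<lbrakk>X \<in> Ob \<C>; P \<in> Ob \<M>\<rbrakk>
      \<Longrightarrow> chi S X P \<in> hom \<M> (ob S (X \<odot> P)) (ob T X \<odot> ob S P)"
    and chi_natural: "\<lbrakk>f \<in> hom \<C> X X'; p \<in> hom \<M> P P'\<rbrakk>
      \<Longrightarrow> chi S X' P' \<bullet> ar S (f \<odot>\<^sub>a p) = (ar T f \<odot>\<^sub>a ar S p) \<bullet> chi S X P"
    and chi_coassoc: "\<lbrakk>X \<in> Ob \<C>; Y \<in> Ob \<C>; P \<in> Ob \<M>\<rbrakk>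
      \<Longrightarrow> (Ident \<C> (ob T X) \<odot>\<^sub>a chi S Y P) \<bullet> chi S X (Y \<odot> P) \<bullet> ar S (massoc \<M> X Y P)
        = massoc \<M> (ob T X) (ob T Y) (ob S P) \<bullet> (psi T X Y \<odot>\<^sub>a Ident \<M> (ob S P))
          \<bullet> chi S (X \<otimes>\<^bsub>\<C>\<^esub> Y) P"
    and chi_counit: "P \<in> Ob \<M>
      \<Longrightarrow> mlunit \<M> (ob S P) \<bullet> (psi0 T \<odot>\<^sub>a Ident \<M> (ob S P)) \<bullet> chi S (unit_ob \<C>) P
        = ar S (mlunit \<M> P)"
    and chi_mu: "\<lbrakk>X \<in> Ob \<C>; P \<in> Ob \<M>\<rbrakk>
      \<Longrightarrow> chi S X P \<bullet> mu S (X \<odot> P)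
        = (mu T X \<odot>\<^sub>a mu S P) \<bullet> chi S (ob T X) (ob S P) \<bullet> ar S (chi S X P)"
    and chi_iota: "\<lbrakk>X \<in> Ob \<C>; P \<in> Ob \<M>\<rbrakk>
      \<Longrightarrow> chi S X P \<bullet> iota S (X \<odot> P) = iota T X \<odot>\<^sub>a iota S P"

definition galois_map ::
  "('o, 'a, 'x) monoidal_category_scheme \<Rightarrow> ('o, 'a, 'p, 'b, 'y) module_category_scheme
    \<Rightarrow> ('o, 'a, 'z) bimonad_scheme \<Rightarrow> ('o, 'p, 'b, 'w) comodule_monad_scheme
    \<Rightarrow> 'o \<Rightarrow> 'p \<Rightarrow> 'b" where
  "galois_map \<C> \<M> T S X P = (Ident \<C> (ob T X) \<odot>\<^sub>a\<^bsub>\<M>\<^esub> mu S P) \<bullet>\<^bsub>\<M>\<^esub> chi S X (ob S P)"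


section \<open>Comonoids and comodules\<close>

record ('o, 'a) comonoid =
  carr :: "'o"
  comult :: "'a"
  counit :: "'a"

locale comonoid = monoidal_category \<C>
  for \<C> :: "('o, 'a, 'x) monoidal_category_scheme" (structure)
    and C :: "('o, 'a, 'z) comonoid_scheme" +
  assumes carr_Ob: "carr C \<in> Ob \<C>"
    and comult_hom: "comult C \<in> hom \<C> (carr C) (carr C \<otimes> carr C)"
    and counit_hom: "counit C \<in> hom \<C> (carr C) (unit_ob \<C>)"
    and coassoc: "assoc \<C> (carr C) (carr C) (carr C) \<bullet> (comult C \<otimes>\<^sub>a Ident \<C> (carr C)) \<bullet> comult C
      = (Ident \<C> (carr C) \<otimes>\<^sub>a comult C) \<bullet> comult C"
    and left_counit:
      "lunit \<C> (carr C) \<bullet> (counit C \<otimes>\<^sub>a Ident \<C> (carr C)) \<bullet> comult C = Ident \<C> (carr C)"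
    and right_counit:
      "runit \<C> (carr C) \<bullet> (Ident \<C> (carr C) \<otimes>\<^sub>a counit C) \<bullet> comult C = Ident \<C> (carr C)"

definition free_comonoid ::
  "('o, 'a, 'x) monoidal_category_scheme \<Rightarrow> ('o, 'a, 'z) bimonad_scheme
    \<Rightarrow> ('o, 'a, 'w) comonoid_scheme \<Rightarrow> ('o, 'a) comonoid" where
  "free_comonoid \<C> T C = \<lparr>
    carr = ob T (carr C),
    comult = psi T (carr C) (carr C) \<bullet>\<^bsub>\<C>\<^esub> ar T (comult C),
    counit = psi0 T \<bullet>\<^bsub>\<C>\<^esub> ar T (counit C)\<rparr>"

text \<open>The endofunctor underlying the comonad \<open>P \<mapsto> C \<odot> P\<close> on \<open>\<M>\<close>.\<close>

definition hat ::
  "('o, 'a, 'x) monoidal_category_scheme \<Rightarrow> ('o, 'a, 'p, 'b, 'y) module_category_scheme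
    \<Rightarrow> ('o, 'a, 'z) comonoid_scheme \<Rightarrow> ('p, 'b, 'p, 'b) functor_data" where
  "hat \<C> \<M> C = \<lparr>
    ob = (\<lambda>P. carr C \<odot>\<^bsub>\<M>\<^esub> P),
    ar = (\<lambda>p. Ident \<C> (carr C) \<odot>\<^sub>a\<^bsub>\<M>\<^esub> p)\<rparr>"

definition hat_comult ::
  "('o, 'a, 'p, 'b, 'y) module_category_scheme \<Rightarrow> ('o, 'a, 'z) comonoid_scheme \<Rightarrow> 'p \<Rightarrow> 'b" where
  "hat_comult \<M> C P =
    massoc \<M> (carr C) (carr C) P \<bullet>\<^bsub>\<M>\<^esub> (comult C \<odot>\<^sub>a\<^bsub>\<M>\<^esub> Ident \<M> P)"

definition hat_counit ::
  "('o, 'a, 'p, 'b, 'y) module_category_scheme \<Rightarrow> ('o, 'a, 'z) comonoid_scheme \<Rightarrow> 'p \<Rightarrow> 'b" where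
  "hat_counit \<M> C P = mlunit \<M> P \<bullet>\<^bsub>\<M>\<^esub> (counit C \<odot>\<^sub>a\<^bsub>\<M>\<^esub> Ident \<M> P)"

definition is_comodule ::
  "('o, 'a, 'x) monoidal_category_scheme \<Rightarrow> ('o, 'a, 'p, 'b, 'y) module_category_scheme
    \<Rightarrow> ('o, 'a, 'z) comonoid_scheme \<Rightarrow> 'p \<Rightarrow> 'b \<Rightarrow> bool" where
  "is_comodule \<C> \<M> C P c \<longleftrightarrow>
    P \<in> Ob \<M> \<and> c \<in> hom \<M> P (carr C \<odot>\<^bsub>\<M>\<^esub> P) \<and>
    hat_comult \<M> C P \<bullet>\<^bsub>\<M>\<^esub> c = (Ident \<C> (carr C) \<odot>\<^sub>a\<^bsub>\<M>\<^esub> c) \<bullet>\<^bsub>\<M>\<^esub> c \<and>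
    hat_counit \<M> C P \<bullet>\<^bsub>\<M>\<^esub> c = Ident \<M> P"

text \<open>
  Arrows of the categories of structured objects below are triples consisting of the domain, the
  underlying arrow of \<open>\<M>\<close>, and the codomain.
\<close>

definition comodule_category ::
  "('o, 'a, 'x) monoidal_category_scheme \<Rightarrow> ('o, 'a, 'p, 'b, 'y) module_category_scheme
    \<Rightarrow> ('o, 'a, 'z) comonoid_scheme
    \<Rightarrow> ('p \<times> 'b, ('p \<times> 'b) \<times> 'b \<times> ('p \<times> 'b)) category" where
  "comodule_category \<C> \<M> C = \<lparr>
    Ob = {(P, c). is_comodule \<C> \<M> C P c},
    Arr = {((P, c), f, (Q, d)).
      is_comodule \<C> \<M> C P c \<and> is_comodule \<C> \<M> C Q d \<and> f \<in> hom \<M> P Q \<and>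
      d \<bullet>\<^bsub>\<M>\<^esub> f = (Ident \<C> (carr C) \<odot>\<^sub>a\<^bsub>\<M>\<^esub> f) \<bullet>\<^bsub>\<M>\<^esub> c},
    Dom = (\<lambda>(x, f, y). x),
    Cod = (\<lambda>(x, f, y). y),
    Ident = (\<lambda>(P, c). ((P, c), Ident \<M> P, (P, c))),
    Comp = (\<lambda>(y', g, z) (x, f, y). (x, g \<bullet>\<^bsub>\<M>\<^esub> f, z))\<rparr>"

definition cofree ::
  "('o, 'a, 'p, 'b, 'y) module_category_scheme \<Rightarrow> ('o, 'a, 'z) comonoid_scheme \<Rightarrow> 'p \<Rightarrow> 'p \<times> 'b"
  where
  "cofree \<M> C P = (carr C \<odot>\<^bsub>\<M>\<^esub> P, hat_comult \<M> C P)"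


section \<open>Hopf modules\<close>

definition is_algebra ::
  "('p, 'b, 'y) category_scheme \<Rightarrow> ('p, 'b, 'w) monad_scheme \<Rightarrow> 'p \<Rightarrow> 'b \<Rightarrow> bool" where
  "is_algebra \<M> S P \<sigma> \<longleftrightarrow>
    P \<in> Ob \<M> \<and> \<sigma> \<in> hom \<M> (ob S P) P \<and>
    \<sigma> \<bullet>\<^bsub>\<M>\<^esub> ar S \<sigma> = \<sigma> \<bullet>\<^bsub>\<M>\<^esub> mu S P \<and>
    \<sigma> \<bullet>\<^bsub>\<M>\<^esub> iota S P = Ident \<M> P"

text \<open>
  Hopf modules over a comonoid \<open>Z\<close> of \<open>\<C>\<close> equipped with an action \<open>\<alpha>\<close> of the bimonad on its
  underlying object.
\<close>

definition is_hopf_module ::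
  "('o, 'a, 'x) monoidal_category_scheme \<Rightarrow> ('o, 'a, 'p, 'b, 'y) module_category_scheme
    \<Rightarrow> ('o, 'p, 'b, 'w) comodule_monad_scheme \<Rightarrow> ('o, 'a, 'z) comonoid_scheme \<Rightarrow> 'a
    \<Rightarrow> 'p \<Rightarrow> 'b \<Rightarrow> 'b \<Rightarrow> bool" where
  "is_hopf_module \<C> \<M> S Z \<alpha> P \<sigma> \<zeta> \<longleftrightarrow>
    is_algebra \<M> S P \<sigma> \<and> is_comodule \<C> \<M> Z P \<zeta> \<and>
    \<zeta> \<bullet>\<^bsub>\<M>\<^esub> \<sigma> = (\<alpha> \<odot>\<^sub>a\<^bsub>\<M>\<^esub> \<sigma>) \<bullet>\<^bsub>\<M>\<^esub> chi S (carr Z) P \<bullet>\<^bsub>\<M>\<^esub> ar S \<zeta>"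

definition hopf_category ::
  "('o, 'a, 'x) monoidal_category_scheme \<Rightarrow> ('o, 'a, 'p, 'b, 'y) module_category_scheme
    \<Rightarrow> ('o, 'p, 'b, 'w) comodule_monad_scheme \<Rightarrow> ('o, 'a, 'z) comonoid_scheme \<Rightarrow> 'a
    \<Rightarrow> ('p \<times> 'b \<times> 'b, ('p \<times> 'b \<times> 'b) \<times> 'b \<times> ('p \<times> 'b \<times> 'b)) category" where
  "hopf_category \<C> \<M> S Z \<alpha> = \<lparr>
    Ob = {(P, \<sigma>, \<zeta>). is_hopf_module \<C> \<M> S Z \<alpha> P \<sigma> \<zeta>},
    Arr = {((P, \<sigma>, \<zeta>), f, (Q, \<tau>, \<xi>)).
      is_hopf_module \<C> \<M> S Z \<alpha> P \<sigma> \<zeta> \<and> is_hopf_module \<C> \<M> S Z \<alpha> Q \<tau> \<xi> \<and> f \<in> hom \<M> P Q \<and>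
      \<tau> \<bullet>\<^bsub>\<M>\<^esub> ar S f = f \<bullet>\<^bsub>\<M>\<^esub> \<sigma> \<and>
      \<xi> \<bullet>\<^bsub>\<M>\<^esub> f = (Ident \<C> (carr Z) \<odot>\<^sub>a\<^bsub>\<M>\<^esub> f) \<bullet>\<^bsub>\<M>\<^esub> \<zeta>},
    Dom = (\<lambda>(x, f, y). x),
    Cod = (\<lambda>(x, f, y). y),
    Ident = (\<lambda>(P, \<sigma>, \<zeta>). ((P, \<sigma>, \<zeta>), Ident \<M> P, (P, \<sigma>, \<zeta>))),
    Comp = (\<lambda>(y', g, z) (x, f, y). (x, g \<bullet>\<^bsub>\<M>\<^esub> f, z))\<rparr>"

text \<open>The category \<open>Hopf(T;S,Z)\<close> for the free \<open>T\<close>-algebra-comonoid \<open>Z = T(C)\<close>, with \<open>\<alpha> = \<mu>\<^sub>C\<close>.\<close>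

definition free_hopf_category ::
  "('o, 'a, 'x) monoidal_category_scheme \<Rightarrow> ('o, 'a, 'p, 'b, 'y) module_category_scheme
    \<Rightarrow> ('o, 'a, 'z) bimonad_scheme \<Rightarrow> ('o, 'p, 'b, 'w) comodule_monad_scheme
    \<Rightarrow> ('o, 'a, 'v) comonoid_scheme
    \<Rightarrow> ('p \<times> 'b \<times> 'b, ('p \<times> 'b \<times> 'b) \<times> 'b \<times> ('p \<times> 'b \<times> 'b)) category" where
  "free_hopf_category \<C> \<M> T S C =
    hopf_category \<C> \<M> S (free_comonoid \<C> T C) (mu T (carr C))"


section \<open>The functors \<open>\<A>\<close> and \<open>\<B>\<close>, and the unit and counit\<close>

definition \<A>_ob ::
  "('o, 'a, 'p, 'b, 'y) module_category_scheme \<Rightarrow> ('o, 'p, 'b, 'w) comodule_monad_scheme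
    \<Rightarrow> ('o, 'a, 'v) comonoid_scheme \<Rightarrow> 'p \<times> 'b \<Rightarrow> 'p \<times> 'b \<times> 'b" where
  "\<A>_ob \<M> S C = (\<lambda>(P, c). (ob S P, mu S P, chi S (carr C) P \<bullet>\<^bsub>\<M>\<^esub> ar S c))"

definition \<A>_functor ::
  "('o, 'a, 'p, 'b, 'y) module_category_scheme \<Rightarrow> ('o, 'p, 'b, 'w) comodule_monad_scheme
    \<Rightarrow> ('o, 'a, 'v) comonoid_scheme
    \<Rightarrow> ('p \<times> 'b, ('p \<times> 'b) \<times> 'b \<times> ('p \<times> 'b),
        'p \<times> 'b \<times> 'b, ('p \<times> 'b \<times> 'b) \<times> 'b \<times> ('p \<times> 'b \<times> 'b)) functor_data" where
  "\<A>_functor \<M> S C = \<lparr>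
    ob = \<A>_ob \<M> S C,
    ar = (\<lambda>(x, f, y). (\<A>_ob \<M> S C x, ar S f, \<A>_ob \<M> S C y))\<rparr>"

text \<open>
  The two arrows \<open>C \<odot> P \<rightarrow> C \<odot> (Z \<odot> P)\<close> between cofree \<open>C\<close>-comodules whose equalizer defines
  \<open>\<B> (P, \<sigma>, \<zeta>)\<close>.
\<close>

definition \<B>_left ::
  "('o, 'a, 'x) monoidal_category_scheme \<Rightarrow> ('o, 'a, 'p, 'b, 'y) module_category_scheme
    \<Rightarrow> ('o, 'a, 'z) bimonad_scheme \<Rightarrow> ('o, 'a, 'v) comonoid_scheme \<Rightarrow> 'p \<times> 'b \<times> 'b
    \<Rightarrow> ('p \<times> 'b) \<times> 'b \<times> ('p \<times> 'b)" where
  "\<B>_left \<C> \<M> T C = (\<lambda>(P, \<sigma>, \<zeta>).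
    (cofree \<M> C P,
     (Ident \<C> (carr C) \<odot>\<^sub>a\<^bsub>\<M>\<^esub> (iota T (carr C) \<odot>\<^sub>a\<^bsub>\<M>\<^esub> Ident \<M> P)) \<bullet>\<^bsub>\<M>\<^esub>
       hat_comult \<M> C P,
     cofree \<M> C (ob T (carr C) \<odot>\<^bsub>\<M>\<^esub> P)))"

definition \<B>_right ::
  "('o, 'a, 'x) monoidal_category_scheme \<Rightarrow> ('o, 'a, 'p, 'b, 'y) module_category_scheme
    \<Rightarrow> ('o, 'a, 'z) bimonad_scheme \<Rightarrow> ('o, 'a, 'v) comonoid_scheme \<Rightarrow> 'p \<times> 'b \<times> 'b
    \<Rightarrow> ('p \<times> 'b) \<times> 'b \<times> ('p \<times> 'b)" where
  "\<B>_right \<C> \<M> T C = (\<lambda>(P, \<sigma>, \<zeta>).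
    (cofree \<M> C P,
     Ident \<C> (carr C) \<odot>\<^sub>a\<^bsub>\<M>\<^esub> \<zeta>,
     cofree \<M> C (ob T (carr C) \<odot>\<^bsub>\<M>\<^esub> P)))"

text \<open>
  \<open>\<B>_eq y\<close> is a chosen equalizer \<open>\<B> y \<rightarrow> C \<odot> P\<close> in the category of \<open>C\<close>-comodules. The choice is
  arbitrary; if no equalizer existed, nothing would be known about it.
\<close>

definition \<B>_eq ::
  "('o, 'a, 'x) monoidal_category_scheme \<Rightarrow> ('o, 'a, 'p, 'b, 'y) module_category_scheme
    \<Rightarrow> ('o, 'a, 'z) bimonad_scheme \<Rightarrow> ('o, 'a, 'v) comonoid_scheme \<Rightarrow> 'p \<times> 'b \<times> 'b
    \<Rightarrow> ('p \<times> 'b) \<times> 'b \<times> ('p \<times> 'b)" where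
  "\<B>_eq \<C> \<M> T C y =
    (SOME e. is_equalizer (comodule_category \<C> \<M> C) (\<B>_left \<C> \<M> T C y) (\<B>_right \<C> \<M> T C y) e)"

definition \<B>_ob ::
  "('o, 'a, 'x) monoidal_category_scheme \<Rightarrow> ('o, 'a, 'p, 'b, 'y) module_category_scheme
    \<Rightarrow> ('o, 'a, 'z) bimonad_scheme \<Rightarrow> ('o, 'a, 'v) comonoid_scheme \<Rightarrow> 'p \<times> 'b \<times> 'b
    \<Rightarrow> 'p \<times> 'b" where
  "\<B>_ob \<C> \<M> T C y = Dom (comodule_category \<C> \<M> C) (\<B>_eq \<C> \<M> T C y)"

text \<open>
  On arrows, \<open>\<B> f\<close> is the unique arrow induced on equalizers by the arrow \<open>C \<odot> f\<close> of cofree comodules.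
\<close>

definition \<B>_functor ::
  "('o, 'a, 'x) monoidal_category_scheme \<Rightarrow> ('o, 'a, 'p, 'b, 'y) module_category_scheme
    \<Rightarrow> ('o, 'a, 'z) bimonad_scheme \<Rightarrow> ('o, 'a, 'v) comonoid_scheme
    \<Rightarrow> ('p \<times> 'b \<times> 'b, ('p \<times> 'b \<times> 'b) \<times> 'b \<times> ('p \<times> 'b \<times> 'b),
        'p \<times> 'b, ('p \<times> 'b) \<times> 'b \<times> ('p \<times> 'b)) functor_data" where
  "\<B>_functor \<C> \<M> T C = \<lparr>
    ob = \<B>_ob \<C> \<M> T C,
    ar = (\<lambda>(x, f, y). THE k.
      k \<in> hom (comodule_category \<C> \<M> C) (\<B>_ob \<C> \<M> T C x) (\<B>_ob \<C> \<M> T C y) \<and>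
      \<B>_eq \<C> \<M> T C y \<bullet>\<^bsub>comodule_category \<C> \<M> C\<^esub> k
        = (cofree \<M> C (fst x), Ident \<C> (carr C) \<odot>\<^sub>a\<^bsub>\<M>\<^esub> f, cofree \<M> C (fst y))
            \<bullet>\<^bsub>comodule_category \<C> \<M> C\<^esub> \<B>_eq \<C> \<M> T C x)\<rparr>"

definition \<A>\<B>_unit ::
  "('o, 'a, 'x) monoidal_category_scheme \<Rightarrow> ('o, 'a, 'p, 'b, 'y) module_category_scheme
    \<Rightarrow> ('o, 'a, 'z) bimonad_scheme \<Rightarrow> ('o, 'p, 'b, 'w) comodule_monad_scheme
    \<Rightarrow> ('o, 'a, 'v) comonoid_scheme
    \<Rightarrow> 'p \<times> 'b \<Rightarrow> ('p \<times> 'b) \<times> 'b \<times> ('p \<times> 'b)" where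
  "\<A>\<B>_unit \<C> \<M> T S C = (\<lambda>(P, c). THE k.
    k \<in> hom (comodule_category \<C> \<M> C) (P, c) (\<B>_ob \<C> \<M> T C (\<A>_ob \<M> S C (P, c))) \<and>
    \<B>_eq \<C> \<M> T C (\<A>_ob \<M> S C (P, c)) \<bullet>\<^bsub>comodule_category \<C> \<M> C\<^esub> k
      = ((P, c), (Ident \<C> (carr C) \<odot>\<^sub>a\<^bsub>\<M>\<^esub> iota S P) \<bullet>\<^bsub>\<M>\<^esub> c, cofree \<M> C (ob S P)))"

definition \<A>\<B>_counit ::
  "('o, 'a, 'x) monoidal_category_scheme \<Rightarrow> ('o, 'a, 'p, 'b, 'y) module_category_scheme
    \<Rightarrow> ('o, 'a, 'z) bimonad_scheme \<Rightarrow> ('o, 'p, 'b, 'w) comodule_monad_scheme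
    \<Rightarrow> ('o, 'a, 'v) comonoid_scheme
    \<Rightarrow> 'p \<times> 'b \<times> 'b \<Rightarrow> ('p \<times> 'b \<times> 'b) \<times> 'b \<times> ('p \<times> 'b \<times> 'b)" where
  "\<A>\<B>_counit \<C> \<M> T S C = (\<lambda>(P, \<sigma>, \<zeta>).
    (\<A>_ob \<M> S C (\<B>_ob \<C> \<M> T C (P, \<sigma>, \<zeta>)),
     \<sigma> \<bullet>\<^bsub>\<M>\<^esub> ar S (hat_counit \<M> C P) \<bullet>\<^bsub>\<M>\<^esub> ar S (fst (snd (\<B>_eq \<C> \<M> T C (P, \<sigma>, \<zeta>)))),
     (P, \<sigma>, \<zeta>)))"

end

theory Submission
  imports Defs
begin

text \<open>
  The actions of \<open>C\<close> and of \<open>Z = T(C)\<close> define comonads \<open>G = C \<odot> -\<close> and \<open>K = Z \<odot> -\<close> on \<open>\<M>\<close>, the unit of \<open>T\<close>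
  defines a morphism of comonads \<open>j = \<iota>\<^sub>C \<odot> - : G \<rightarrow> K\<close>, and the coaction \<open>\<chi>\<close> of \<open>S\<close> followed by the action
  \<open>\<mu>\<^sub>C : T Z \<rightarrow> Z\<close> defines a mixed distributive law \<open>S K \<rightarrow> K S\<close>. A Hopf module is then a bialgebra for this
  law, that is a coalgebra for the lift of \<open>K\<close> to \<open>S\<close>-algebras, and \<open>\<A>\<close> sends a \<open>G\<close>-coalgebra \<open>(P, c)\<close> to the
  free algebra \<open>S P\<close> with the coaction \<open>law \<circ> S (j \<circ> c)\<close>. The whole argument takes place in this
  one-categorical setting (locale \<open>mixed_law\<close>); the monoidal structure enters through the construction of
  the data (lemma \<open>mixed_law\<close>).

  For every \<open>S\<close>-algebra \<open>(P, \<sigma>)\<close> there is a comparison \<open>\<gamma> = K \<sigma> \<circ> law \<circ> S j : S G P \<rightarrow> K P\<close>, here called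
  \<open>galois P \<sigma>\<close>; on free algebras it is the Galois map. Let \<open>e : N \<rightarrow> G P\<close> be the equalizer that defines
  \<open>\<B> (P, \<sigma>, \<zeta>)\<close>, and \<open>q : S N \<rightarrow> P\<close> the counit of the adjunction. The key identity is
  \<open>\<zeta> \<circ> q = \<gamma> \<circ> S e\<close> (\<open>coaction_evaluation\<close>).

  Suppose that the Galois maps are invertible. Every algebra is a coequalizer of free ones that splits in \<open>\<M>\<close>, so \<open>\<gamma>\<close> is
  invertible on all algebras (\<open>galois_algebra_iso\<close>). Now \<open>S e\<close> is the equalizer of a pair
  \<open>S G P \<rightrightarrows> S G K P\<close>, because \<open>S\<close> preserves it, and \<open>\<zeta>\<close> is the split equalizer of the pair
  \<open>K P \<rightrightarrows> K K P\<close> given by the comultiplication and \<open>K \<zeta>\<close>. The maps \<open>\<gamma>\<close> of \<open>P\<close> and of \<open>K P\<close> identify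
  the two pairs, so \<open>q\<close> is invertible (\<open>evaluation_iso\<close>). The triangle identity shows that \<open>S\<close> maps the
  unit to the inverse of a counit, so the unit is invertible because \<open>S\<close> is conservative.

  Conversely, on the cofree bialgebra \<open>K P\<close> over an algebra \<open>P\<close>, the equalizer is split and \<open>\<B>\<close> returns the
  cofree coalgebra \<open>G P\<close>. Up to this isomorphism the counit is \<open>\<gamma>\<close>, so it is invertible if
  the adjunction is an equivalence (\<open>galois_iso_of_evaluation_iso\<close>).
\<close>

section \<open>Arrow calculus\<close>

text \<open>
  Typing is expressed through \<open>Arr\<close>, \<open>Dom\<close> and \<open>Cod\<close> rather than through hom-sets, so that the side
  conditions of an equation between composites are computed by rewriting, with no objects to be guessed.
\<close>

context category
begin

lemma Ident_type [simp]:
  "X \<in> Ob \<C> \<Longrightarrow> Ident \<C> X \<in> Arr \<C> \<and> Dom \<C> (Ident \<C> X) = X \<and> Cod \<C> (Ident \<C> X) = X"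
  using Ident_hom by (simp add: hom_def)

lemma Comp_type [simp]:
  "\<lbrakk>f \<in> Arr \<C>; g \<in> Arr \<C>; Cod \<C> f = Dom \<C> g\<rbrakk>
    \<Longrightarrow> g \<bullet> f \<in> Arr \<C> \<and> Dom \<C> (g \<bullet> f) = Dom \<C> f \<and> Cod \<C> (g \<bullet> f) = Cod \<C> g"
  using Comp_hom by (simp add: hom_def)

lemma Comp_Ident_arr [simp]: "\<lbrakk>f \<in> Arr \<C>; Dom \<C> f = X\<rbrakk> \<Longrightarrow> f \<bullet> Ident \<C> X = f"
  using Comp_Ident[of f X] by (simp add: hom_def)

lemma Ident_Comp_arr [simp]: "\<lbrakk>f \<in> Arr \<C>; Cod \<C> f = X\<rbrakk> \<Longrightarrow> Ident \<C> X \<bullet> f = f"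
  using Ident_Comp[of f _ X] by (simp add: hom_def)

lemma Comp_assoc_arr:
  "\<lbrakk>f \<in> Arr \<C>; g \<in> Arr \<C>; h \<in> Arr \<C>; Cod \<C> f = Dom \<C> g; Cod \<C> g = Dom \<C> h\<rbrakk>
    \<Longrightarrow> (h \<bullet> g) \<bullet> f = h \<bullet> (g \<bullet> f)"
  using Comp_assoc by (simp add: hom_def)

text \<open>
  The form in which an equation between composites applies inside a longer, right-nested composite.
\<close>

lemma Comp_reduce:
  "\<lbrakk>g \<bullet> f = k; f \<in> Arr \<C>; g \<in> Arr \<C>; h \<in> Arr \<C>; Cod \<C> h = Dom \<C> f; Cod \<C> f = Dom \<C> g\<rbrakk>
    \<Longrightarrow> g \<bullet> (f \<bullet> h) = k \<bullet> h"
  by (simp add: Comp_assoc_arr[symmetric])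

lemma hom_iff: "f \<in> hom \<C> X Y \<longleftrightarrow> f \<in> Arr \<C> \<and> Dom \<C> f = X \<and> Cod \<C> f = Y"
  by (simp add: hom_def)

lemma iso_inverse:
  assumes "is_iso \<C> f"
  obtains g where "f \<in> Arr \<C>" "g \<in> Arr \<C>" "Dom \<C> g = Cod \<C> f" "Cod \<C> g = Dom \<C> f"
    "g \<bullet> f = Ident \<C> (Dom \<C> f)" "f \<bullet> g = Ident \<C> (Cod \<C> f)"
  using assms unfolding is_iso_def hom_def by blast

lemma is_isoI:
  "\<lbrakk>f \<in> Arr \<C>; g \<in> Arr \<C>; Dom \<C> g = Cod \<C> f; Cod \<C> g = Dom \<C> f;
    g \<bullet> f = Ident \<C> (Dom \<C> f); f \<bullet> g = Ident \<C> (Cod \<C> f)\<rbrakk> \<Longrightarrow> is_iso \<C> f"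
  unfolding is_iso_def hom_def by blast

lemma iso_cancel_left:
  assumes "is_iso \<C> f" and [simp]: "x \<in> Arr \<C>" "y \<in> Arr \<C>" "Cod \<C> x = Dom \<C> f" "Cod \<C> y = Dom \<C> f"
    and eq: "f \<bullet> x = f \<bullet> y"
  shows "x = y"
proof -
  from assms(1) obtain g where [simp]: "f \<in> Arr \<C>" "g \<in> Arr \<C>" "Dom \<C> g = Cod \<C> f"
    "Cod \<C> g = Dom \<C> f" and gf: "g \<bullet> f = Ident \<C> (Dom \<C> f)"
    by (rule iso_inverse)
  have "g \<bullet> (f \<bullet> x) = g \<bullet> (f \<bullet> y)" using eq by simp
  then show ?thesis by (simp add: Comp_reduce[OF gf])
qed

lemma iso_cancel_right:
  assumes "is_iso \<C> f" and [simp]: "x \<in> Arr \<C>" "y \<in> Arr \<C>" "Dom \<C> x = Cod \<C> f" "Dom \<C> y = Cod \<C> f"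
    and eq: "x \<bullet> f = y \<bullet> f"
  shows "x = y"
proof -
  from assms(1) obtain g where [simp]: "f \<in> Arr \<C>" "g \<in> Arr \<C>" "Dom \<C> g = Cod \<C> f"
    "Cod \<C> g = Dom \<C> f" and fg: "f \<bullet> g = Ident \<C> (Cod \<C> f)"
    by (rule iso_inverse)
  have "(x \<bullet> f) \<bullet> g = (y \<bullet> f) \<bullet> g" using eq by simp
  then show ?thesis by (simp add: Comp_assoc_arr fg)
qed

lemma is_iso_Comp:
  assumes "is_iso \<C> f" "is_iso \<C> g" and [simp]: "Cod \<C> f = Dom \<C> g"
  shows "is_iso \<C> (g \<bullet> f)"
proof -
  from assms(1) obtain f' where [simp]: "f \<in> Arr \<C>" "f' \<in> Arr \<C>" "Dom \<C> f' = Cod \<C> f"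
    "Cod \<C> f' = Dom \<C> f" and f: "f' \<bullet> f = Ident \<C> (Dom \<C> f)" "f \<bullet> f' = Ident \<C> (Cod \<C> f)"
    by (rule iso_inverse)
  from assms(2) obtain g' where [simp]: "g \<in> Arr \<C>" "g' \<in> Arr \<C>" "Dom \<C> g' = Cod \<C> g"
    "Cod \<C> g' = Dom \<C> g" and g: "g' \<bullet> g = Ident \<C> (Dom \<C> g)" "g \<bullet> g' = Ident \<C> (Cod \<C> g)"
    by (rule iso_inverse)
  show ?thesis
    by (rule is_isoI[of _ "f' \<bullet> g'"])
      (simp_all add: Comp_assoc_arr Comp_reduce[OF f(2)] Comp_reduce[OF g(1)] f g Dom_Ob)
qed

lemma is_iso_cancel_left:
  assumes "is_iso \<C> (g \<bullet> f)" "is_iso \<C> g" and [simp]: "f \<in> Arr \<C>" "Cod \<C> f = Dom \<C> g"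
  shows "is_iso \<C> f"
proof -
  from assms(2) obtain g' where [simp]: "g \<in> Arr \<C>" "g' \<in> Arr \<C>" "Dom \<C> g' = Cod \<C> g"
    "Cod \<C> g' = Dom \<C> g" and g: "g' \<bullet> g = Ident \<C> (Dom \<C> g)" "g \<bullet> g' = Ident \<C> (Cod \<C> g)"
    by (rule iso_inverse)
  have "is_iso \<C> g'" by (rule is_isoI[of _ g]) (simp_all add: g)
  then have "is_iso \<C> (g' \<bullet> (g \<bullet> f))" by (rule is_iso_Comp[OF assms(1)]) simp
  then show ?thesis by (simp add: Comp_reduce[OF g(1)])
qed

lemma is_iso_cancel_right:
  assumes "is_iso \<C> (g \<bullet> f)" "is_iso \<C> f" and [simp]: "g \<in> Arr \<C>" "Cod \<C> f = Dom \<C> g"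
  shows "is_iso \<C> g"
proof -
  from assms(2) obtain f' where [simp]: "f \<in> Arr \<C>" "f' \<in> Arr \<C>" "Dom \<C> f' = Cod \<C> f"
    "Cod \<C> f' = Dom \<C> f" and f: "f' \<bullet> f = Ident \<C> (Dom \<C> f)" "f \<bullet> f' = Ident \<C> (Cod \<C> f)"
    by (rule iso_inverse)
  have "is_iso \<C> f'" by (rule is_isoI[of _ f]) (simp_all add: f)
  then have "is_iso \<C> ((g \<bullet> f) \<bullet> f')" by (rule is_iso_Comp[OF _ assms(1)]) simp
  then show ?thesis by (simp add: Comp_assoc_arr f)
qed

lemma is_iso_Ident: "X \<in> Ob \<C> \<Longrightarrow> is_iso \<C> (Ident \<C> X)"
  by (rule is_isoI[of _ "Ident \<C> X"]) simp_all

lemma equalizer_type: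
  assumes "is_equalizer \<C> f g e"
  shows "f \<in> Arr \<C>" "g \<in> Arr \<C>" "e \<in> Arr \<C>" "Dom \<C> g = Dom \<C> f" "Cod \<C> g = Cod \<C> f"
    "Cod \<C> e = Dom \<C> f" "f \<bullet> e = g \<bullet> e"
  using assms unfolding is_equalizer_def parallel_def by auto

lemma equalizer_factor:
  assumes "is_equalizer \<C> f g e" "h \<in> Arr \<C>" "Cod \<C> h = Dom \<C> f" "f \<bullet> h = g \<bullet> h"
  obtains k where "k \<in> Arr \<C>" "Dom \<C> k = Dom \<C> h" "Cod \<C> k = Dom \<C> e" "e \<bullet> k = h"
  using assms unfolding is_equalizer_def hom_def by blast

lemma equalizer_mono:
  assumes eq: "is_equalizer \<C> f g e" and xy: "x \<in> Arr \<C>" "y \<in> Arr \<C>" "Cod \<C> x = Dom \<C> e"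
    "Cod \<C> y = Dom \<C> e" and "Dom \<C> x = Dom \<C> y" "e \<bullet> x = e \<bullet> y"
  shows "x = y"
proof -
  note t = equalizer_type[OF eq]
  have ex: "\<exists>!k. k \<in> hom \<C> (Dom \<C> h) (Dom \<C> e) \<and> e \<bullet> k = h"
    if "h \<in> Arr \<C>" "Cod \<C> h = Dom \<C> f" "f \<bullet> h = g \<bullet> h" for h
    using eq that unfolding is_equalizer_def by blast
  have "f \<bullet> (e \<bullet> x) = g \<bullet> (e \<bullet> x)"
    using t xy by (simp add: Comp_reduce[OF t(7)] Comp_assoc_arr)
  then have "\<exists>!k. k \<in> hom \<C> (Dom \<C> (e \<bullet> x)) (Dom \<C> e) \<and> e \<bullet> k = e \<bullet> x"
    using t(3,6) xy(1,3) by (intro ex) simp_all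
  moreover have "x \<in> hom \<C> (Dom \<C> (e \<bullet> x)) (Dom \<C> e)" "y \<in> hom \<C> (Dom \<C> (e \<bullet> x)) (Dom \<C> e)"
    using t(3) xy assms(6) by (simp_all add: hom_iff)
  ultimately show ?thesis using assms(7)[symmetric] by blast
qed

text \<open>Uniqueness of factorizations enters as the property that \<open>e\<close> is a monomorphism.\<close>

lemma is_equalizerI:
  assumes "f \<in> Arr \<C>" "g \<in> Arr \<C>" "e \<in> Arr \<C>" "Dom \<C> g = Dom \<C> f" "Cod \<C> g = Cod \<C> f"
    "Cod \<C> e = Dom \<C> f" "f \<bullet> e = g \<bullet> e"
    and "\<And>h. \<lbrakk>h \<in> Arr \<C>; Cod \<C> h = Dom \<C> f; f \<bullet> h = g \<bullet> h\<rbrakk>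
      \<Longrightarrow> \<exists>k \<in> hom \<C> (Dom \<C> h) (Dom \<C> e). e \<bullet> k = h"
    and "\<And>x y. \<lbrakk>x \<in> Arr \<C>; y \<in> Arr \<C>; Dom \<C> x = Dom \<C> y; Cod \<C> x = Dom \<C> e; Cod \<C> y = Dom \<C> e;
      e \<bullet> x = e \<bullet> y\<rbrakk> \<Longrightarrow> x = y"
  shows "is_equalizer \<C> f g e"
  unfolding is_equalizer_def parallel_def
proof (intro conjI ballI impI ex_ex1I; (elim conjE)?)
  fix h assume "h \<in> Arr \<C>" "Cod \<C> h = Dom \<C> f" "f \<bullet> h = g \<bullet> h"
  then show "\<exists>k. k \<in> hom \<C> (Dom \<C> h) (Dom \<C> e) \<and> e \<bullet> k = h"
    using assms(8) by blast
next
  fix h x y assume "x \<in> hom \<C> (Dom \<C> h) (Dom \<C> e)" "e \<bullet> x = h" "y \<in> hom \<C> (Dom \<C> h) (Dom \<C> e)" "e \<bullet> y = h"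
  then show "x = y" using assms(9) by (simp add: hom_def)
qed (simp_all add: assms(1-7))

lemma equalizer_Comp_iso:
  assumes eq: "is_equalizer \<C> f g e" and k: "k \<in> Arr \<C>" "Cod \<C> k = Dom \<C> e" and iso: "is_iso \<C> k"
  shows "is_equalizer \<C> f g (e \<bullet> k)"
proof -
  note et = equalizer_type[OF eq]
  from iso obtain l where l: "l \<in> Arr \<C>" "Dom \<C> l = Cod \<C> k"
    "Cod \<C> l = Dom \<C> k" and lk: "k \<bullet> l = Ident \<C> (Cod \<C> k)"
    by (rule iso_inverse)
  have c: "f \<bullet> (e \<bullet> k) = g \<bullet> (e \<bullet> k)"
    using et k by (simp add: Comp_reduce[OF et(7)] Comp_assoc_arr)
  show ?thesis
  proof (rule is_equalizerI[OF et(1,2) _ et(4,5) _ c])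
    fix h assume h: "h \<in> Arr \<C>" "Cod \<C> h = Dom \<C> f" "f \<bullet> h = g \<bullet> h"
    from eq h obtain m where m: "m \<in> Arr \<C>" "Dom \<C> m = Dom \<C> h" "Cod \<C> m = Dom \<C> e" "e \<bullet> m = h"
      by (rule equalizer_factor)
    have "(e \<bullet> k) \<bullet> (l \<bullet> m) = h"
      using et k l m by (simp add: Comp_assoc_arr Comp_reduce[OF lk])
    then show "\<exists>n \<in> hom \<C> (Dom \<C> h) (Dom \<C> (e \<bullet> k)). (e \<bullet> k) \<bullet> n = h"
      using et k l m by (intro bexI[of _ "l \<bullet> m"]) (simp_all add: hom_iff)
  next
    fix x y assume x: "x \<in> Arr \<C>" "y \<in> Arr \<C>" "Dom \<C> x = Dom \<C> y" "Cod \<C> x = Dom \<C> (e \<bullet> k)"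
      "Cod \<C> y = Dom \<C> (e \<bullet> k)" "(e \<bullet> k) \<bullet> x = (e \<bullet> k) \<bullet> y"
    have "k \<bullet> x = k \<bullet> y"
      by (rule equalizer_mono[OF eq]) (use x et k in \<open>simp_all add: Comp_assoc_arr\<close>)
    then show "x = y"
      by (rule iso_cancel_left[OF iso, rotated 4]) (use x et k in simp_all)
  qed (use et k in simp_all)
qed

end

lemma coreflexiveI:
  "\<lbrakk>f \<in> Arr \<C>; g \<in> Arr \<C>; Dom \<C> g = Dom \<C> f; Cod \<C> g = Cod \<C> f; r \<in> Arr \<C>; Dom \<C> r = Cod \<C> f;
    Cod \<C> r = Dom \<C> f; r \<bullet>\<^bsub>\<C>\<^esub> f = Ident \<C> (Dom \<C> f); r \<bullet>\<^bsub>\<C>\<^esub> g = Ident \<C> (Dom \<C> f)\<rbrakk>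
    \<Longrightarrow> coreflexive \<C> f g"
  unfolding coreflexive_def parallel_def hom_def by auto

context cat_functor
begin

lemma ar_type [simp]:
  "f \<in> Arr \<C> \<Longrightarrow> ar F f \<in> Arr \<D> \<and> Dom \<D> (ar F f) = ob F (Dom \<C> f) \<and> Cod \<D> (ar F f) = ob F (Cod \<C> f)"
  using ar_hom by (simp add: hom_def)

lemma ar_Comp_arr [simp]:
  "\<lbrakk>f \<in> Arr \<C>; g \<in> Arr \<C>; Cod \<C> f = Dom \<C> g\<rbrakk> \<Longrightarrow> ar F (g \<bullet>\<^bsub>\<C>\<^esub> f) = ar F g \<bullet>\<^bsub>\<D>\<^esub> ar F f"
  using ar_Comp by (simp add: hom_def)

lemmas [simp] = ob_Ob ar_Ident

lemma ar_eq: "\<lbrakk>g \<bullet>\<^bsub>\<C>\<^esub> f = k; f \<in> Arr \<C>; g \<in> Arr \<C>; Cod \<C> f = Dom \<C> g\<rbrakk>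
  \<Longrightarrow> ar F g \<bullet>\<^bsub>\<D>\<^esub> ar F f = ar F k"
  using ar_Comp_arr by auto

lemma ar_is_iso:
  assumes "is_iso \<C> f" shows "is_iso \<D> (ar F f)"
proof -
  from assms obtain g where [simp]: "f \<in> Arr \<C>" "g \<in> Arr \<C>" "Dom \<C> g = Cod \<C> f" "Cod \<C> g = Dom \<C> f"
    and g: "g \<bullet>\<^bsub>\<C>\<^esub> f = Ident \<C> (Dom \<C> f)" "f \<bullet>\<^bsub>\<C>\<^esub> g = Ident \<C> (Cod \<C> f)"
    by (rule source.iso_inverse)
  show ?thesis
    by (rule target.is_isoI[of _ "ar F g"]) (simp_all add: ar_eq[OF g(1)] ar_eq[OF g(2)] source.Dom_Ob source.Cod_Ob)
qed

lemma ar_coreflexive: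
  assumes "coreflexive \<C> f g" shows "coreflexive \<D> (ar F f) (ar F g)"
proof -
  from assms obtain r where [simp]: "f \<in> Arr \<C>" "g \<in> Arr \<C>" "Dom \<C> g = Dom \<C> f" "Cod \<C> g = Cod \<C> f"
    "r \<in> Arr \<C>" "Dom \<C> r = Cod \<C> f" "Cod \<C> r = Dom \<C> f"
    and r: "r \<bullet>\<^bsub>\<C>\<^esub> f = Ident \<C> (Dom \<C> f)" "r \<bullet>\<^bsub>\<C>\<^esub> g = Ident \<C> (Dom \<C> f)"
    unfolding coreflexive_def parallel_def hom_def by auto
  show ?thesis
    by (rule coreflexiveI[of _ _ _ "ar F r"]) (simp_all add: ar_eq[OF r(1)] ar_eq[OF r(2)] source.Dom_Ob)
qed

end

lemma id_functor_simps [simp]: "ob id_functor X = X" "ar id_functor f = f"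
  by (simp_all add: id_functor_def)

lemma comp_functor_simps [simp]:
  "ob (comp_functor G F) X = ob G (ob F X)" "ar (comp_functor G F) f = ar G (ar F f)"
  by (simp_all add: comp_functor_def)

lemma (in category) cat_functor_id: "cat_functor \<C> \<C> id_functor"
  by unfold_locales (simp_all add: hom_def)

lemma cat_functor_comp:
  assumes "cat_functor \<C> \<D> F" "cat_functor \<D> \<E> G"
  shows "cat_functor \<C> \<E> (comp_functor G F)"
proof -
  interpret F: cat_functor \<C> \<D> F by fact
  interpret G: cat_functor \<D> \<E> G by fact
  show ?thesis
    by unfold_locales (auto simp: F.source.hom_iff G.target.hom_iff)
qed

section \<open>Coalgebras of comonads and algebras of monads\<close>

locale comonad = category \<M> + endo: cat_functor \<M> \<M> W
  for \<M> :: "('p, 'b, 'y) category_scheme" (structure)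
    and W :: "('p, 'b, 'p, 'b, 'w) functor_data_scheme" +
  fixes \<delta> \<epsilon> :: "'p \<Rightarrow> 'b"
  assumes comult_hom: "P \<in> Ob \<M> \<Longrightarrow> \<delta> P \<in> hom \<M> (ob W P) (ob W (ob W P))"
    and counit_hom: "P \<in> Ob \<M> \<Longrightarrow> \<epsilon> P \<in> hom \<M> (ob W P) P"
    and comult_natural: "f \<in> hom \<M> P Q \<Longrightarrow> \<delta> Q \<bullet> ar W f = ar W (ar W f) \<bullet> \<delta> P"
    and counit_natural: "f \<in> hom \<M> P Q \<Longrightarrow> \<epsilon> Q \<bullet> ar W f = f \<bullet> \<epsilon> P"
    and comult_coassoc: "P \<in> Ob \<M> \<Longrightarrow> \<delta> (ob W P) \<bullet> \<delta> P = ar W (\<delta> P) \<bullet> \<delta> P"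
    and counit_comult: "P \<in> Ob \<M> \<Longrightarrow> \<epsilon> (ob W P) \<bullet> \<delta> P = Ident \<M> (ob W P)"
    and ar_counit_comult: "P \<in> Ob \<M> \<Longrightarrow> ar W (\<epsilon> P) \<bullet> \<delta> P = Ident \<M> (ob W P)"
begin

lemma comult_type [simp]: "P \<in> Ob \<M>
    \<Longrightarrow> \<delta> P \<in> Arr \<M> \<and> Dom \<M> (\<delta> P) = ob W P \<and> Cod \<M> (\<delta> P) = ob W (ob W P)"
  using comult_hom by (simp add: hom_iff)

lemma counit_type [simp]: "P \<in> Ob \<M>
    \<Longrightarrow> \<epsilon> P \<in> Arr \<M> \<and> Dom \<M> (\<epsilon> P) = ob W P \<and> Cod \<M> (\<epsilon> P) = P"
  using counit_hom by (simp add: hom_iff)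

lemma comult_natural_arr:
  "\<lbrakk>f \<in> Arr \<M>; Cod \<M> f = Q\<rbrakk> \<Longrightarrow> \<delta> Q \<bullet> ar W f = ar W (ar W f) \<bullet> \<delta> (Dom \<M> f)"
  using comult_natural[of f _ Q] by (simp add: hom_iff)

lemma counit_natural_arr:
  "\<lbrakk>f \<in> Arr \<M>; Cod \<M> f = Q\<rbrakk> \<Longrightarrow> \<epsilon> Q \<bullet> ar W f = f \<bullet> \<epsilon> (Dom \<M> f)"
  using counit_natural[of f _ Q] by (simp add: hom_iff)

lemmas comonad_simps =
  comult_natural_arr Comp_reduce[OF comult_natural_arr]
  counit_natural_arr Comp_reduce[OF counit_natural_arr]
  comult_coassoc Comp_reduce[OF comult_coassoc]
  counit_comult Comp_reduce[OF counit_comult]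
  ar_counit_comult Comp_reduce[OF ar_counit_comult]

definition coalgebra :: "'p \<Rightarrow> 'b \<Rightarrow> bool" where
  "coalgebra P c \<longleftrightarrow> P \<in> Ob \<M> \<and> c \<in> hom \<M> P (ob W P) \<and>
    \<delta> P \<bullet> c = ar W c \<bullet> c \<and> \<epsilon> P \<bullet> c = Ident \<M> P"

definition coalgebra_hom :: "'p \<Rightarrow> 'b \<Rightarrow> 'b \<Rightarrow> 'p \<Rightarrow> 'b \<Rightarrow> bool" where
  "coalgebra_hom P c f Q d \<longleftrightarrow> f \<in> hom \<M> P Q \<and> d \<bullet> f = ar W f \<bullet> c"

lemma coalgebraD:
  assumes "coalgebra P c"
  shows "P \<in> Ob \<M>" "c \<in> Arr \<M>" "Dom \<M> c = P" "Cod \<M> c = ob W P"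
    "\<delta> P \<bullet> c = ar W c \<bullet> c" "\<epsilon> P \<bullet> c = Ident \<M> P"
  using assms by (simp_all add: coalgebra_def hom_iff)

lemma coalgebra_homD:
  assumes "coalgebra_hom P c f Q d"
  shows "f \<in> Arr \<M>" "Dom \<M> f = P" "Cod \<M> f = Q" "d \<bullet> f = ar W f \<bullet> c"
  using assms by (simp_all add: coalgebra_hom_def hom_iff)

lemma cofree_coalgebra: "P \<in> Ob \<M> \<Longrightarrow> coalgebra (ob W P) (\<delta> P)"
  by (simp add: coalgebra_def hom_iff comonad_simps)

lemma cofree_hom: "f \<in> hom \<M> P Q \<Longrightarrow> coalgebra_hom (ob W P) (\<delta> P) (ar W f) (ob W Q) (\<delta> Q)"
  by (auto simp: coalgebra_hom_def hom_iff comonad_simps)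

text \<open>The arrow into a cofree coalgebra that corresponds to \<open>f\<close> under the forgetful-cofree adjunction.\<close>

lemma hom_into_cofree:
  assumes P: "coalgebra P c" and f: "f \<in> hom \<M> P Q"
  shows "coalgebra_hom P c (ar W f \<bullet> c) (ob W Q) (\<delta> Q)"
proof -
  note [simp] = coalgebraD(1-4)[OF P]
  have [simp]: "f \<in> Arr \<M>" "Dom \<M> f = P" "Cod \<M> f = Q" using f by (simp_all add: hom_iff)
  have [simp]: "Q \<in> Ob \<M>" using Cod_Ob[of f] by simp
  show ?thesis
    by (simp add: coalgebra_hom_def hom_iff comonad_simps Comp_assoc_arr coalgebraD(5)[OF P])
qed

text \<open>
  If the comonad preserves the equalizer of a pair of coalgebra morphisms, then the equalizer inherits a
  coalgebra structure, by the universal property of its image. The coalgebra laws hold because \<open>e\<close>,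
  \<open>W e\<close> and \<open>W (W e)\<close> are monomorphisms.
\<close>

lemma equalizer_coalgebra:
  assumes pres: "preserves_coreflexive_equalizers \<M> \<M> W"
    and cor: "coreflexive \<M> f g" and eq: "is_equalizer \<M> f g e"
    and A: "coalgebra A a"
    and f: "coalgebra_hom A a f B b" and g: "coalgebra_hom A a g B b" and b: "b \<in> hom \<M> B (ob W B)"
  obtains c where "coalgebra (Dom \<M> e) c" "coalgebra_hom (Dom \<M> e) c e A a"
proof -
  note [simp] = coalgebraD(1-4)[OF A] coalgebra_homD(1-3)[OF f] coalgebra_homD(1-3)[OF g]
  note et = equalizer_type[OF eq]
  have [simp]: "e \<in> Arr \<M>" "Cod \<M> e = A" using et by simp_all
  have [simp]: "b \<in> Arr \<M>" "Dom \<M> b = B" "Cod \<M> b = ob W B" using b by (simp_all add: hom_iff)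
  have [simp]: "Dom \<M> e \<in> Ob \<M>" by (simp add: Dom_Ob)
  have eqW: "is_equalizer \<M> (ar W f) (ar W g) (ar W e)"
    using pres cor eq unfolding preserves_coreflexive_equalizers_def by blast
  have eqWW: "is_equalizer \<M> (ar W (ar W f)) (ar W (ar W g)) (ar W (ar W e))"
    using pres endo.ar_coreflexive[OF cor] eqW unfolding preserves_coreflexive_equalizers_def by blast
  have "ar W f \<bullet> (a \<bullet> e) = b \<bullet> (f \<bullet> e)"
    by (simp add: Comp_reduce[OF coalgebra_homD(4)[OF f]] Comp_assoc_arr)
  also have "\<dots> = ar W g \<bullet> (a \<bullet> e)"
    by (simp add: et(7) Comp_reduce[OF coalgebra_homD(4)[OF g]] Comp_assoc_arr)
  finally have "ar W f \<bullet> (a \<bullet> e) = ar W g \<bullet> (a \<bullet> e)" .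
  from equalizer_factor[OF eqW _ _ this] obtain c where "c \<in> Arr \<M>" "Dom \<M> c = Dom \<M> (a \<bullet> e)"
    "Cod \<M> c = Dom \<M> (ar W e)" and c: "ar W e \<bullet> c = a \<bullet> e"
    by (metis Comp_type \<open>Cod \<M> e = A\<close> \<open>e \<in> Arr \<M>\<close> coalgebraD(2-4)[OF A] endo.ar_type
      coalgebra_homD(1,2)[OF f])
  then have [simp]: "c \<in> Arr \<M>" "Dom \<M> c = Dom \<M> e" "Cod \<M> c = ob W (Dom \<M> e)" by simp_all
  have "\<epsilon> (Dom \<M> e) \<bullet> c = Ident \<M> (Dom \<M> e)"
  proof (rule equalizer_mono[OF eq])
    have "e \<bullet> (\<epsilon> (Dom \<M> e) \<bullet> c) = \<epsilon> A \<bullet> (ar W e \<bullet> c)"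
      by (simp add: comonad_simps Comp_assoc_arr)
    also have "\<dots> = e" by (simp add: c Comp_reduce[OF coalgebraD(6)[OF A]])
    finally show "e \<bullet> (\<epsilon> (Dom \<M> e) \<bullet> c) = e \<bullet> Ident \<M> (Dom \<M> e)" by simp
  qed simp_all
  moreover have "\<delta> (Dom \<M> e) \<bullet> c = ar W c \<bullet> c"
  proof (rule equalizer_mono[OF eqWW])
    have "ar W (ar W e) \<bullet> (\<delta> (Dom \<M> e) \<bullet> c) = \<delta> A \<bullet> (ar W e \<bullet> c)"
      by (simp add: comonad_simps Comp_assoc_arr)
    also have "\<dots> = ar W a \<bullet> (ar W e \<bullet> c)"
      by (simp add: c Comp_reduce[OF coalgebraD(5)[OF A]] Comp_assoc_arr)
    also have "\<dots> = ar W (ar W e) \<bullet> (ar W c \<bullet> c)"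
      by (simp add: Comp_reduce[OF endo.ar_eq[OF c]] Comp_assoc_arr)
    finally show "ar W (ar W e) \<bullet> (\<delta> (Dom \<M> e) \<bullet> c) = ar W (ar W e) \<bullet> (ar W c \<bullet> c)" .
  qed simp_all
  ultimately have "coalgebra (Dom \<M> e) c" by (simp add: coalgebra_def hom_iff)
  moreover have "coalgebra_hom (Dom \<M> e) c e A a" by (simp add: coalgebra_hom_def hom_iff c)
  ultimately show ?thesis by (rule that)
qed

text \<open>
  The equalizer of the previous lemma is also an equalizer among coalgebras, since the factorization of a
  coalgebra morphism through \<open>e\<close> is one: \<open>W e\<close> is a monomorphism.
\<close>

lemma factor_coalgebra_hom:
  assumes mono: "is_equalizer \<M> f g (ar W e)"
    and e: "coalgebra_hom E c e A a" and EA: "coalgebra E c" "coalgebra A a"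
    and h: "coalgebra_hom X x (e \<bullet> k) A a" and X: "coalgebra X x" and k: "k \<in> hom \<M> X E"
  shows "coalgebra_hom X x k E c"
proof -
  note [simp] = coalgebra_homD(1-3)[OF e] coalgebraD(1-4)[OF EA(1)] coalgebraD(1-4)[OF EA(2)]
    coalgebraD(1-4)[OF X]
  have [simp]: "k \<in> Arr \<M>" "Dom \<M> k = X" "Cod \<M> k = E" using k by (simp_all add: hom_iff)
  have "c \<bullet> k = ar W k \<bullet> x"
  proof (rule equalizer_mono[OF mono])
    have "ar W e \<bullet> (c \<bullet> k) = a \<bullet> (e \<bullet> k)"
      by (simp add: Comp_reduce[OF coalgebra_homD(4)[OF e]] Comp_assoc_arr)
    also have "\<dots> = ar W e \<bullet> (ar W k \<bullet> x)"
      by (simp add: coalgebra_homD(4)[OF h] Comp_assoc_arr)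
    finally show "ar W e \<bullet> (c \<bullet> k) = ar W e \<bullet> (ar W k \<bullet> x)" .
  qed simp_all
  then show ?thesis by (simp add: coalgebra_hom_def hom_iff)
qed

lemma coalgebra_hom_Ident: "coalgebra P c \<Longrightarrow> coalgebra_hom P c (Ident \<M> P) P c"
  by (simp add: coalgebra_hom_def hom_iff coalgebraD)

lemma coalgebra_hom_Comp:
  assumes PQR: "coalgebra P c" "coalgebra Q d" "coalgebra R b"
    and f: "coalgebra_hom P c f Q d" and g: "coalgebra_hom Q d g R b"
  shows "coalgebra_hom P c (g \<bullet> f) R b"
proof -
  note [simp] = coalgebraD(1-4)[OF PQR(1)] coalgebraD(1-4)[OF PQR(2)] coalgebraD(1-4)[OF PQR(3)]
    coalgebra_homD(1-3)[OF f] coalgebra_homD(1-3)[OF g]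
  show ?thesis
    by (simp add: coalgebra_hom_def hom_iff Comp_reduce[OF coalgebra_homD(4)[OF g]]
      coalgebra_homD(4)[OF f] Comp_assoc_arr)
qed

lemma coalgebra_hom_inverse:
  assumes PQ: "coalgebra P c" "coalgebra Q d" and f: "coalgebra_hom P c f Q d"
    and g: "g \<in> hom \<M> Q P" and inv: "g \<bullet> f = Ident \<M> P" "f \<bullet> g = Ident \<M> Q"
  shows "coalgebra_hom Q d g P c"
proof -
  note [simp] = coalgebraD(1-4)[OF PQ(1)] coalgebraD(1-4)[OF PQ(2)] coalgebra_homD(1-3)[OF f]
  have [simp]: "g \<in> Arr \<M>" "Dom \<M> g = Q" "Cod \<M> g = P" using g by (simp_all add: hom_iff)
  have "ar W g \<bullet> (ar W f \<bullet> c) \<bullet> g = c \<bullet> g"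
    by (simp add: Comp_assoc_arr Comp_reduce[OF endo.ar_eq[OF inv(1)]])
  moreover have "ar W g \<bullet> (ar W f \<bullet> c) \<bullet> g = ar W g \<bullet> d"
    unfolding coalgebra_homD(4)[OF f, symmetric] by (simp add: Comp_assoc_arr inv)
  ultimately show ?thesis by (simp add: coalgebra_hom_def hom_iff)
qed

end

context cat_monad
begin

lemma mu_type [simp]: "X \<in> Ob \<C>
    \<Longrightarrow> mu T X \<in> Arr \<C> \<and> Dom \<C> (mu T X) = ob T (ob T X) \<and> Cod \<C> (mu T X) = ob T X"
  using mu.component_hom by (simp add: hom_iff)

lemma iota_type [simp]: "X \<in> Ob \<C>
    \<Longrightarrow> iota T X \<in> Arr \<C> \<and> Dom \<C> (iota T X) = X \<and> Cod \<C> (iota T X) = ob T X"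
  using iota.component_hom by (simp add: hom_iff)

lemma mu_natural_arr:
  "\<lbrakk>f \<in> Arr \<C>; Cod \<C> f = Q\<rbrakk> \<Longrightarrow> mu T Q \<bullet> ar T (ar T f) = ar T f \<bullet> mu T (Dom \<C> f)"
  using mu.naturality[of f _ Q] by (simp add: hom_iff)

lemma iota_natural_arr:
  "\<lbrakk>f \<in> Arr \<C>; Cod \<C> f = Q\<rbrakk> \<Longrightarrow> iota T Q \<bullet> f = ar T f \<bullet> iota T (Dom \<C> f)"
  using iota.naturality[of f _ Q] by (simp add: hom_iff)

lemmas monad_simps =
  mu_natural_arr Comp_reduce[OF mu_natural_arr]
  mu_assoc Comp_reduce[OF mu_assoc]
  mu_iota Comp_reduce[OF mu_iota]
  mu_ar_iota Comp_reduce[OF mu_ar_iota]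

lemma algebraD:
  assumes "is_algebra \<C> T P \<sigma>"
  shows "P \<in> Ob \<C>" "\<sigma> \<in> Arr \<C>" "Dom \<C> \<sigma> = ob T P" "Cod \<C> \<sigma> = P"
    "\<sigma> \<bullet> ar T \<sigma> = \<sigma> \<bullet> mu T P" "\<sigma> \<bullet> iota T P = Ident \<C> P"
  using assms by (simp_all add: is_algebra_def hom_iff)

lemma free_algebra: "P \<in> Ob \<C> \<Longrightarrow> is_algebra \<C> T (ob T P) (mu T P)"
  by (simp add: is_algebra_def hom_iff monad_simps)

end

section \<open>Mixed distributive laws\<close>

text \<open>
  The mixed distributive law \<open>law : S K \<rightarrow> K S\<close> is what lifts \<open>K\<close> to \<open>S\<close>-algebras and \<open>S\<close> to \<open>K\<close>-coalgebras.
  The second comonad \<open>G\<close> is related to it by the comonad morphism \<open>j : G \<rightarrow> K\<close>: the \<open>G\<close>-coalgebras are the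
  objects from which free bialgebras will be formed.
\<close>

locale mixed_law = cat_monad \<M> S + G: comonad \<M> G \<delta> \<epsilon> + K: comonad \<M> K \<Delta> E
  for \<M> :: "('p, 'b, 'y) category_scheme" (structure)
    and S :: "('p, 'b, 's) monad_scheme"
    and G :: "('p, 'b, 'p, 'b, 'g) functor_data_scheme" and \<delta> \<epsilon> :: "'p \<Rightarrow> 'b"
    and K :: "('p, 'b, 'p, 'b, 'k) functor_data_scheme" and \<Delta> E :: "'p \<Rightarrow> 'b" +
  fixes j law :: "'p \<Rightarrow> 'b"
  assumes j_hom: "P \<in> Ob \<M> \<Longrightarrow> j P \<in> hom \<M> (ob G P) (ob K P)"
    and j_natural: "f \<in> hom \<M> P Q \<Longrightarrow> j Q \<bullet> ar G f = ar K f \<bullet> j P"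
    and j_comult: "P \<in> Ob \<M> \<Longrightarrow> \<Delta> P \<bullet> j P = ar K (j P) \<bullet> j (ob G P) \<bullet> \<delta> P"
    and j_counit: "P \<in> Ob \<M> \<Longrightarrow> E P \<bullet> j P = \<epsilon> P"
    and law_hom: "P \<in> Ob \<M> \<Longrightarrow> law P \<in> hom \<M> (ob S (ob K P)) (ob K (ob S P))"
    and law_natural: "f \<in> hom \<M> P Q \<Longrightarrow> law Q \<bullet> ar S (ar K f) = ar K (ar S f) \<bullet> law P"
    and law_iota: "P \<in> Ob \<M> \<Longrightarrow> law P \<bullet> iota S (ob K P) = ar K (iota S P)"
    and law_mu: "P \<in> Ob \<M> \<Longrightarrow> law P \<bullet> mu S (ob K P) = ar K (mu S P) \<bullet> law (ob S P) \<bullet> ar S (law P)"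
    and law_comult: "P \<in> Ob \<M> \<Longrightarrow> \<Delta> (ob S P) \<bullet> law P = ar K (law P) \<bullet> law (ob K P) \<bullet> ar S (\<Delta> P)"
    and law_counit: "P \<in> Ob \<M> \<Longrightarrow> E (ob S P) \<bullet> law P = ar S (E P)"
begin

lemma j_type [simp]: "P \<in> Ob \<M> \<Longrightarrow> j P \<in> Arr \<M> \<and> Dom \<M> (j P) = ob G P \<and> Cod \<M> (j P) = ob K P"
  using j_hom by (simp add: hom_iff)

lemma law_type [simp]: "P \<in> Ob \<M>
    \<Longrightarrow> law P \<in> Arr \<M> \<and> Dom \<M> (law P) = ob S (ob K P) \<and> Cod \<M> (law P) = ob K (ob S P)"
  using law_hom by (simp add: hom_iff)

lemma j_natural_arr:
  "\<lbrakk>f \<in> Arr \<M>; Cod \<M> f = Q\<rbrakk> \<Longrightarrow> j Q \<bullet> ar G f = ar K f \<bullet> j (Dom \<M> f)"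
  using j_natural[of f _ Q] by (simp add: hom_iff)

lemma law_natural_arr:
  "\<lbrakk>f \<in> Arr \<M>; Cod \<M> f = Q\<rbrakk> \<Longrightarrow> law Q \<bullet> ar S (ar K f) = ar K (ar S f) \<bullet> law (Dom \<M> f)"
  using law_natural[of f _ Q] by (simp add: hom_iff)

lemmas law_simps =
  j_natural_arr Comp_reduce[OF j_natural_arr]
  j_comult Comp_reduce[OF j_comult]
  j_counit Comp_reduce[OF j_counit]
  law_natural_arr Comp_reduce[OF law_natural_arr]
  law_iota Comp_reduce[OF law_iota]
  law_mu Comp_reduce[OF law_mu]
  law_comult Comp_reduce[OF law_comult]
  law_counit Comp_reduce[OF law_counit]

definition bialgebra :: "'p \<Rightarrow> 'b \<Rightarrow> 'b \<Rightarrow> bool" where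
  "bialgebra P \<sigma> \<zeta> \<longleftrightarrow> is_algebra \<M> S P \<sigma> \<and> K.coalgebra P \<zeta> \<and> \<zeta> \<bullet> \<sigma> = ar K \<sigma> \<bullet> law P \<bullet> ar S \<zeta>"

lemma bialgebraD:
  assumes "bialgebra P \<sigma> \<zeta>"
  shows "is_algebra \<M> S P \<sigma>" "K.coalgebra P \<zeta>" "\<zeta> \<bullet> \<sigma> = ar K \<sigma> \<bullet> law P \<bullet> ar S \<zeta>"
  using assms by (simp_all add: bialgebra_def)

definition algebra_hom :: "'p \<Rightarrow> 'b \<Rightarrow> 'b \<Rightarrow> 'p \<Rightarrow> 'b \<Rightarrow> bool" where
  "algebra_hom P \<sigma> f Q \<tau> \<longleftrightarrow> f \<in> hom \<M> P Q \<and> \<tau> \<bullet> ar S f = f \<bullet> \<sigma>"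

lemma algebra_homD:
  assumes "algebra_hom P \<sigma> f Q \<tau>"
  shows "f \<in> Arr \<M>" "Dom \<M> f = P" "Cod \<M> f = Q" "\<tau> \<bullet> ar S f = f \<bullet> \<sigma>"
  using assms by (simp_all add: algebra_hom_def hom_iff)

lemma algebra_hom_Ident: "is_algebra \<M> S P \<sigma> \<Longrightarrow> algebra_hom P \<sigma> (Ident \<M> P) P \<sigma>"
  by (simp add: algebra_hom_def hom_iff algebraD)

lemma algebra_hom_Comp:
  assumes PQR: "is_algebra \<M> S P \<sigma>" "is_algebra \<M> S Q \<tau>" "is_algebra \<M> S R \<rho>"
    and f: "algebra_hom P \<sigma> f Q \<tau>" and g: "algebra_hom Q \<tau> g R \<rho>"
  shows "algebra_hom P \<sigma> (g \<bullet> f) R \<rho>"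
proof -
  note [simp] = algebraD(1-4)[OF PQR(1)] algebraD(1-4)[OF PQR(2)] algebraD(1-4)[OF PQR(3)]
    algebra_homD(1-3)[OF f] algebra_homD(1-3)[OF g]
  show ?thesis
    by (simp add: algebra_hom_def hom_iff Comp_reduce[OF algebra_homD(4)[OF g]]
      algebra_homD(4)[OF f] Comp_assoc_arr)
qed

lemma algebra_hom_inverse:
  assumes PQ: "is_algebra \<M> S P \<sigma>" "is_algebra \<M> S Q \<tau>" and f: "algebra_hom P \<sigma> f Q \<tau>"
    and g: "g \<in> hom \<M> Q P" and inv: "g \<bullet> f = Ident \<M> P" "f \<bullet> g = Ident \<M> Q"
  shows "algebra_hom Q \<tau> g P \<sigma>"
proof -
  note [simp] = algebraD(1-4)[OF PQ(1)] algebraD(1-4)[OF PQ(2)] algebra_homD(1-3)[OF f]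
  have [simp]: "g \<in> Arr \<M>" "Dom \<M> g = Q" "Cod \<M> g = P" using g by (simp_all add: hom_iff)
  have "g \<bullet> (f \<bullet> \<sigma>) \<bullet> ar S g = \<sigma> \<bullet> ar S g"
    by (simp add: Comp_assoc_arr Comp_reduce[OF inv(1)])
  moreover have "g \<bullet> (f \<bullet> \<sigma>) \<bullet> ar S g = g \<bullet> \<tau>"
    unfolding algebra_homD(4)[OF f, symmetric] by (simp add: Comp_assoc_arr endo.ar_eq[OF inv(2)])
  ultimately show ?thesis by (simp add: algebra_hom_def hom_iff)
qed

text \<open>Corestriction of coactions along the comonad morphism \<open>j\<close>.\<close>

lemma pushforward_coalgebra:
  assumes P: "G.coalgebra P c"
  shows "K.coalgebra P (j P \<bullet> c)"
proof -
  note [simp] = G.coalgebraD(1-4)[OF P]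
  note c = G.coalgebraD(5,6)[OF P]
  show ?thesis
    by (simp add: K.coalgebra_def hom_iff law_simps Comp_assoc_arr c)
qed

text \<open>
  The monad \<open>S\<close> lifts to \<open>K\<close>-coalgebras by \<open>law\<close>: compatibility with the comonad makes \<open>law \<circ> S z\<close> a
  coaction, and compatibility with \<open>mu\<close> makes the free action a morphism of coalgebras.
\<close>

lemma free_bialgebra:
  assumes P: "K.coalgebra P z"
  shows "bialgebra (ob S P) (mu S P) (law P \<bullet> ar S z)"
proof -
  note [simp] = K.coalgebraD(1-4)[OF P]
  note c = endo.ar_eq[OF K.coalgebraD(5)[OF P]] endo.ar_eq[OF K.coalgebraD(6)[OF P]]
  have "K.coalgebra (ob S P) (law P \<bullet> ar S z)"
    by (simp add: K.coalgebra_def hom_iff law_simps Comp_assoc_arr c)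
  moreover have "law P \<bullet> ar S z \<bullet> mu S P = ar K (mu S P) \<bullet> law (ob S P) \<bullet> ar S (law P \<bullet> ar S z)"
  proof -
    have "law P \<bullet> (ar S z \<bullet> mu S P) = law P \<bullet> (mu S (ob K P) \<bullet> ar S (ar S z))"
      by (simp add: mu_natural_arr)
    then show ?thesis by (simp add: law_simps Comp_assoc_arr)
  qed
  ultimately show ?thesis by (simp add: bialgebra_def free_algebra)
qed

text \<open>Dually, \<open>K\<close> lifts to \<open>S\<close>-algebras.\<close>

lemma cofree_bialgebra:
  assumes P: "is_algebra \<M> S P \<sigma>"
  shows "bialgebra (ob K P) (ar K \<sigma> \<bullet> law P) (\<Delta> P)"
proof -
  note [simp] = algebraD(1-4)[OF P]
  note s = algebraD(5,6)[OF P]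
  note Ks = K.endo.ar_eq[OF s(1)] K.endo.ar_eq[OF s(2)]
  have "is_algebra \<M> S (ob K P) (ar K \<sigma> \<bullet> law P)"
  proof -
    have "ar K \<sigma> \<bullet> (law P \<bullet> (ar S (ar K \<sigma>) \<bullet> ar S (law P)))
        = (ar K \<sigma> \<bullet> ar K (ar S \<sigma>)) \<bullet> (law (ob S P) \<bullet> ar S (law P))"
      by (simp add: law_simps Comp_assoc_arr)
    also have "\<dots> = ar K \<sigma> \<bullet> (law P \<bullet> mu S (ob K P))"
      by (simp add: Ks law_simps Comp_assoc_arr)
    finally show ?thesis by (simp add: is_algebra_def hom_iff Comp_assoc_arr law_simps Ks)
  qed
  then show ?thesis
    by (simp add: bialgebra_def K.cofree_coalgebra Comp_assoc_arr law_simps K.comonad_simps)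
qed

lemma free_algebra_hom:
  assumes "f \<in> hom \<M> P Q"
  shows "algebra_hom (ob S P) (mu S P) (ar S f) (ob S Q) (mu S Q)"
proof -
  have [simp]: "f \<in> Arr \<M>" "Dom \<M> f = P" "Cod \<M> f = Q" using assms by (simp_all add: hom_iff)
  show ?thesis by (simp add: algebra_hom_def hom_iff mu_natural_arr)
qed

lemma free_coalgebra_hom:
  assumes PQ: "G.coalgebra P c" "G.coalgebra Q d" and f: "G.coalgebra_hom P c f Q d"
  shows "K.coalgebra_hom (ob S P) (law P \<bullet> ar S (j P \<bullet> c)) (ar S f) (ob S Q) (law Q \<bullet> ar S (j Q \<bullet> d))"
proof -
  note [simp] = G.coalgebraD(1-4)[OF PQ(1)] G.coalgebraD(1-4)[OF PQ(2)] G.coalgebra_homD(1-3)[OF f]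
  have "ar S (j Q) \<bullet> (ar S d \<bullet> ar S f) = (ar S (j Q) \<bullet> ar S (ar G f)) \<bullet> ar S c"
    by (simp add: endo.ar_eq[OF G.coalgebra_homD(4)[OF f]] Comp_assoc_arr)
  also have "\<dots> = ar S (ar K f) \<bullet> (ar S (j P) \<bullet> ar S c)"
    using endo.ar_eq[OF j_natural_arr[of f Q]] by (simp add: Comp_assoc_arr)
  finally show ?thesis
    by (simp add: K.coalgebra_hom_def hom_iff Comp_assoc_arr Comp_reduce[OF law_natural_arr[of f Q]])
qed

section \<open>The Galois map of an algebra\<close>

text \<open>
  The component at \<open>(P, \<sigma>)\<close> of the comparison between two comonads on \<open>S\<close>-algebras: the one sending \<open>P\<close> to
  the free algebra on \<open>G P\<close>, and the lift of \<open>K\<close>.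
\<close>

definition galois :: "'p \<Rightarrow> 'b \<Rightarrow> 'b" where
  "galois P \<sigma> = ar K \<sigma> \<bullet> law P \<bullet> ar S (j P)"

lemma galois_type [simp]: "is_algebra \<M> S P \<sigma>
    \<Longrightarrow> galois P \<sigma> \<in> Arr \<M> \<and> Dom \<M> (galois P \<sigma>) = ob S (ob G P) \<and> Cod \<M> (galois P \<sigma>) = ob K P"
  by (simp add: galois_def algebraD)

lemma galois_natural:
  assumes P: "is_algebra \<M> S P \<sigma>" and Q: "is_algebra \<M> S Q \<tau>" and f: "algebra_hom P \<sigma> f Q \<tau>"
  shows "galois Q \<tau> \<bullet> ar S (ar G f) = ar K f \<bullet> galois P \<sigma>"
proof -
  note [simp] = algebraD(1-4)[OF P] algebraD(1-4)[OF Q]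
  have [simp]: "f \<in> Arr \<M>" "Dom \<M> f = P" "Cod \<M> f = Q" and e: "\<tau> \<bullet> ar S f = f \<bullet> \<sigma>"
    using f by (simp_all add: algebra_hom_def hom_iff)
  have "galois Q \<tau> \<bullet> ar S (ar G f) = (ar K \<tau> \<bullet> ar K (ar S f)) \<bullet> (law P \<bullet> ar S (j P))"
    using endo.ar_eq[OF j_natural_arr[of f Q]] Comp_reduce[OF law_natural_arr[of f Q]]
    by (simp add: galois_def Comp_assoc_arr)
  also have "\<dots> = ar K f \<bullet> galois P \<sigma>"
    by (simp add: K.endo.ar_eq[OF e] galois_def Comp_assoc_arr)
  finally show ?thesis .
qed

text \<open>
  An algebra \<open>P\<close> is the coequalizer of the free algebras on \<open>S P\<close> and on \<open>P\<close>, split in \<open>\<M>\<close> by the units of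
  the monad, and \<open>S G\<close> and \<open>K\<close> preserve the splitting. So the inverse \<open>h\<close> of the comparison at the free
  algebra descends to \<open>P\<close>.
\<close>

lemma galois_algebra_iso:
  assumes iso: "\<And>P. P \<in> Ob \<M> \<Longrightarrow> is_iso \<M> (galois (ob S P) (mu S P))"
    and P: "is_algebra \<M> S P \<sigma>"
  shows "is_iso \<M> (galois P \<sigma>)"
proof -
  note [simp] = algebraD(1-4)[OF P]
  note s = algebraD(5,6)[OF P]
  let ?g = "galois (ob S P) (mu S P)" and ?g2 = "galois (ob S (ob S P)) (mu S (ob S P))"
  have [simp]: "is_algebra \<M> S (ob S P) (mu S P)" "is_algebra \<M> S (ob S (ob S P)) (mu S (ob S P))"
    by (simp_all add: free_algebra)
  \<comment> \<open>\<open>h\<close> and \<open>h2\<close> invert the comparisons at the free algebras on \<open>P\<close> and on \<open>S P\<close>.\<close>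
  have inv: "\<exists>h. h \<in> hom \<M> (ob K (ob S Q)) (ob S (ob G (ob S Q)))
      \<and> h \<bullet> galois (ob S Q) (mu S Q) = Ident \<M> (ob S (ob G (ob S Q)))
      \<and> galois (ob S Q) (mu S Q) \<bullet> h = Ident \<M> (ob K (ob S Q))" if "Q \<in> Ob \<M>" for Q
    using iso[OF that] that unfolding is_iso_def by (auto simp: free_algebra)
  from inv[of P] obtain h where [simp]: "h \<in> Arr \<M>" "Dom \<M> h = ob K (ob S P)"
    "Cod \<M> h = ob S (ob G (ob S P))"
    and h: "h \<bullet> ?g = Ident \<M> (ob S (ob G (ob S P)))" "?g \<bullet> h = Ident \<M> (ob K (ob S P))"
    by (auto simp: hom_iff)
  from inv[of "ob S P"] obtain h2 where [simp]: "h2 \<in> Arr \<M>" "Dom \<M> h2 = ob K (ob S (ob S P))"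
    "Cod \<M> h2 = ob S (ob G (ob S (ob S P)))" and h2: "?g2 \<bullet> h2 = Ident \<M> (ob K (ob S (ob S P)))"
    by (auto simp: hom_iff)
  have n1: "galois P \<sigma> \<bullet> ar S (ar G \<sigma>) = ar K \<sigma> \<bullet> ?g"
    by (rule galois_natural) (simp_all add: P algebra_hom_def hom_iff s)
  have n2: "?g \<bullet> ar S (ar G (ar S \<sigma>)) = ar K (ar S \<sigma>) \<bullet> ?g2"
    by (rule galois_natural) (simp_all add: algebra_hom_def hom_iff monad_simps)
  have n3: "?g \<bullet> ar S (ar G (mu S P)) = ar K (mu S P) \<bullet> ?g2"
    by (rule galois_natural) (simp_all add: algebra_hom_def hom_iff monad_simps)
  \<comment> \<open>The inverse: lift along the section \<open>K \<iota>\<close> of \<open>K \<sigma>\<close>, invert there, project back.\<close>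
  let ?k = "ar S (ar G \<sigma>) \<bullet> (h \<bullet> ar K (iota S P))"
  have "galois P \<sigma> \<bullet> ?k = Ident \<M> (ob K P)"
    by (simp add: Comp_reduce[OF n1] P Comp_assoc_arr Comp_reduce[OF h(2)] K.endo.ar_eq[OF s(2)])
  moreover have "?k \<bullet> galois P \<sigma> = Ident \<M> (ob S (ob G P))"
  proof -
    have h_natural: "h \<bullet> ar K u = ar S (ar G u) \<bullet> h2"
      if [simp]: "u \<in> Arr \<M>" "Dom \<M> u = ob S (ob S P)" "Cod \<M> u = ob S P"
        and u: "?g \<bullet> ar S (ar G u) = ar K u \<bullet> ?g2" for u
    proof -
      have "h \<bullet> ar K u = h \<bullet> (ar K u \<bullet> ?g2 \<bullet> h2)" by (simp add: Comp_assoc_arr h2)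
      also have "\<dots> = ar S (ar G u) \<bullet> h2"
        by (simp add: u[symmetric] Comp_assoc_arr Comp_reduce[OF h(1)])
      finally show ?thesis .
    qed
    note hS = h_natural[OF _ _ _ n2] h_natural[OF _ _ _ n3]
    \<comment> \<open>As \<open>S G \<sigma>\<close> is a split epimorphism, it suffices to compare after composing with it.\<close>
    have "?k \<bullet> (galois P \<sigma> \<bullet> ar S (ar G \<sigma>))
        = ar S (ar G \<sigma>) \<bullet> (h \<bullet> (ar K (iota S P) \<bullet> ar K \<sigma> \<bullet> ?g))"
      by (simp add: n1 Comp_assoc_arr)
    also have "\<dots> = ar S (ar G \<sigma>) \<bullet> ((h \<bullet> ar K (ar S \<sigma>)) \<bullet> (ar K (iota S (ob S P)) \<bullet> ?g))"
      by (simp add: K.endo.ar_eq[OF iota_natural_arr[of \<sigma> P]] Comp_assoc_arr)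
    also have "\<dots> = (ar S (ar G \<sigma>) \<bullet> ar S (ar G (ar S \<sigma>))) \<bullet> (h2 \<bullet> (ar K (iota S (ob S P)) \<bullet> ?g))"
      by (simp add: hS Comp_assoc_arr)
    also have "\<dots> = ar S (ar G \<sigma>) \<bullet> ((h \<bullet> ar K (mu S P)) \<bullet> (ar K (iota S (ob S P)) \<bullet> ?g))"
      by (simp add: hS endo.ar_eq[OF G.endo.ar_eq[OF s(1)]] Comp_assoc_arr)
    also have "\<dots> = ar S (ar G \<sigma>)"
      by (simp add: Comp_reduce[OF K.endo.ar_eq[OF mu_iota[of P]]] Comp_assoc_arr h)
    finally have "?k \<bullet> (galois P \<sigma> \<bullet> ar S (ar G \<sigma>)) \<bullet> ar S (ar G (iota S P))
        = ar S (ar G \<sigma>) \<bullet> ar S (ar G (iota S P))" by simp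
    then show ?thesis by (simp add: P Comp_assoc_arr endo.ar_eq[OF G.endo.ar_eq[OF s(2)]])
  qed
  ultimately show ?thesis
    by (intro is_isoI[of _ ?k]) (simp_all add: P)
qed

section \<open>Coinvariants\<close>

text \<open>
  The parallel pair \<open>G P \<rightrightarrows> G (K P)\<close> whose equalizer is the value of \<open>\<B>\<close> consists of morphisms of cofree
  coalgebras.
\<close>

lemma pair_hom:
  assumes P: "K.coalgebra P \<zeta>"
  shows "G.coalgebra_hom (ob G P) (\<delta> P) (ar G (j P) \<bullet> \<delta> P) (ob G (ob K P)) (\<delta> (ob K P))"
    and "G.coalgebra_hom (ob G P) (\<delta> P) (ar G \<zeta>) (ob G (ob K P)) (\<delta> (ob K P))"
proof -
  note [simp] = K.coalgebraD(1-4)[OF P]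
  show "G.coalgebra_hom (ob G P) (\<delta> P) (ar G (j P) \<bullet> \<delta> P) (ob G (ob K P)) (\<delta> (ob K P))"
    by (rule G.hom_into_cofree[OF G.cofree_coalgebra]) (simp_all add: hom_iff)
  show "G.coalgebra_hom (ob G P) (\<delta> P) (ar G \<zeta>) (ob G (ob K P)) (\<delta> (ob K P))"
    by (rule G.cofree_hom) (simp add: hom_iff)
qed

text \<open>The common retraction is \<open>G\<close> applied to the counit of \<open>K\<close>, since \<open>E \<circ> j = \<epsilon>\<close> and \<open>E \<circ> \<zeta> = id\<close>.\<close>

lemma pair_coreflexive:
  assumes P: "K.coalgebra P \<zeta>"
  shows "coreflexive \<M> (ar G (j P) \<bullet> \<delta> P) (ar G \<zeta>)"
proof -
  note [simp] = K.coalgebraD(1-4)[OF P]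
  note z = G.endo.ar_eq[OF K.coalgebraD(6)[OF P]]
  show ?thesis
    by (rule coreflexiveI[of _ _ _ "ar G (E P)"])
      (simp_all add: z Comp_reduce[OF G.endo.ar_eq[OF j_counit[of P]]] G.comonad_simps)
qed

text \<open>
  \<open>N\<close> with its coaction \<open>c\<close> is the value of \<open>\<B>\<close> at the bialgebra \<open>(P, \<sigma>, \<zeta>)\<close>, and \<open>e\<close> is its inclusion into
  the cofree coalgebra on \<open>P\<close>. A relation is used because the equalizer is determined up to isomorphism only.
\<close>

definition coinvariants :: "'p \<Rightarrow> 'b \<Rightarrow> 'b \<Rightarrow> 'p \<Rightarrow> 'b \<Rightarrow> 'b \<Rightarrow> bool" where
  "coinvariants P \<sigma> \<zeta> N c e \<longleftrightarrow> bialgebra P \<sigma> \<zeta> \<and> G.coalgebra N c \<and>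
    G.coalgebra_hom N c e (ob G P) (\<delta> P) \<and> is_equalizer \<M> (ar G (j P) \<bullet> \<delta> P) (ar G \<zeta>) e"

lemma coinvariantsD:
  assumes "coinvariants P \<sigma> \<zeta> N c e"
  shows "bialgebra P \<sigma> \<zeta>" "G.coalgebra N c" "G.coalgebra_hom N c e (ob G P) (\<delta> P)"
    "is_equalizer \<M> (ar G (j P) \<bullet> \<delta> P) (ar G \<zeta>) e"
  using assms by (simp_all add: coinvariants_def)

lemma coinvariants_exist:
  assumes "has_coreflexive_equalizers \<M>" "preserves_coreflexive_equalizers \<M> \<M> G"
    and y: "bialgebra P \<sigma> \<zeta>"
  obtains N c e where "coinvariants P \<sigma> \<zeta> N c e"
proof -
  note P = bialgebraD(2)[OF y]
  note [simp] = K.coalgebraD(1-4)[OF P]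
  from assms(1) pair_coreflexive[OF P] obtain e
    where e: "is_equalizer \<M> (ar G (j P) \<bullet> \<delta> P) (ar G \<zeta>) e"
    unfolding has_coreflexive_equalizers_def by blast
  have d: "\<delta> (ob K P) \<in> hom \<M> (ob G (ob K P)) (ob G (ob G (ob K P)))"
    by (simp add: hom_iff)
  from G.equalizer_coalgebra[OF assms(2) pair_coreflexive[OF P] e G.cofree_coalgebra pair_hom[OF P] d]
  obtain c where "G.coalgebra (Dom \<M> e) c" "G.coalgebra_hom (Dom \<M> e) c e (ob G P) (\<delta> P)"
    by auto
  with y e that show ?thesis unfolding coinvariants_def by blast
qed

lemma coinvariants_mono:
  assumes y: "coinvariants P \<sigma> \<zeta> N c e" and k: "G.coalgebra_hom X x k N c" and l: "G.coalgebra_hom X x l N c"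
    and kl: "e \<bullet> k = e \<bullet> l"
  shows "k = l"
  by (rule equalizer_mono[OF coinvariantsD(4)[OF y] _ _ _ _ _ kl])
    (simp_all add: G.coalgebra_homD(1-3)[OF k] G.coalgebra_homD(1-3)[OF l]
      G.coalgebra_homD(1-3)[OF coinvariantsD(3)[OF y]])

lemma coinvariants_factor:
  assumes G: "preserves_coreflexive_equalizers \<M> \<M> G"
    and y: "coinvariants P \<sigma> \<zeta> N c e" and X: "G.coalgebra X x"
    and h: "G.coalgebra_hom X x h (ob G P) (\<delta> P)"
    and eq: "(ar G (j P) \<bullet> \<delta> P) \<bullet> h = ar G \<zeta> \<bullet> h"
  obtains k where "G.coalgebra_hom X x k N c" "e \<bullet> k = h"
proof -
  note b = bialgebraD[OF coinvariantsD(1)[OF y]]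
  note [simp] = K.coalgebraD(1-4)[OF b(2)] G.coalgebraD(1-4)[OF X] G.coalgebra_homD(1-3)[OF h]
    G.coalgebraD(1-4)[OF coinvariantsD(2)[OF y]] G.coalgebra_homD(1-3)[OF coinvariantsD(3)[OF y]]
  note e = coinvariantsD(4)[OF y]
  have eG: "is_equalizer \<M> (ar G (ar G (j P) \<bullet> \<delta> P)) (ar G (ar G \<zeta>)) (ar G e)"
    using G e pair_coreflexive[OF b(2)] unfolding preserves_coreflexive_equalizers_def by blast
  from equalizer_factor[OF e _ _ eq] obtain k where k: "k \<in> hom \<M> X N" "e \<bullet> k = h"
    by (auto simp: hom_iff)
  have "G.coalgebra_hom X x k N c"
    by (rule G.factor_coalgebra_hom[OF eG coinvariantsD(3,2)[OF y] G.cofree_coalgebra _ X k(1)])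
      (simp_all add: k h)
  then show ?thesis using k(2) that by blast
qed

text \<open>The two conditions under which \<open>G f\<close> induces an arrow between coinvariants.\<close>

lemma coinvariants_map:
  assumes y: "coinvariants P \<sigma> \<zeta> N c e" and Q: "bialgebra Q \<tau> \<xi>" and f: "K.coalgebra_hom P \<zeta> f Q \<xi>"
  shows "G.coalgebra_hom N c (ar G f \<bullet> e) (ob G Q) (\<delta> Q)"
    and "(ar G (j Q) \<bullet> \<delta> Q) \<bullet> (ar G f \<bullet> e) = ar G \<xi> \<bullet> (ar G f \<bullet> e)"
proof -
  note b = bialgebraD[OF coinvariantsD(1)[OF y]] and b' = bialgebraD[OF Q]
  note [simp] = K.coalgebraD(1-4)[OF b(2)] K.coalgebraD(1-4)[OF b'(2)] K.coalgebra_homD(1-3)[OF f]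
    G.coalgebraD(1-4)[OF coinvariantsD(2)[OF y]] G.coalgebra_homD(1-3)[OF coinvariantsD(3)[OF y]]
  have f': "f \<in> hom \<M> P Q" by (simp add: hom_iff)
  show "G.coalgebra_hom N c (ar G f \<bullet> e) (ob G Q) (\<delta> Q)"
    by (rule G.coalgebra_hom_Comp[OF _ _ _ coinvariantsD(3)[OF y] G.cofree_hom[OF f']])
      (simp_all add: G.cofree_coalgebra coinvariantsD(2)[OF y])
  have "(ar G (j Q) \<bullet> \<delta> Q) \<bullet> (ar G f \<bullet> e) = ar G (j Q \<bullet> ar G f) \<bullet> (\<delta> P \<bullet> e)"
    by (simp add: G.comonad_simps Comp_assoc_arr)
  also have "\<dots> = ar G (ar K f) \<bullet> (ar G (j P) \<bullet> \<delta> P \<bullet> e)"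
    by (simp add: j_natural_arr Comp_assoc_arr)
  also have "\<dots> = ar G \<xi> \<bullet> (ar G f \<bullet> e)"
    by (simp add: equalizer_type(7)[OF coinvariantsD(4)[OF y]]
      Comp_reduce[OF G.endo.ar_eq[OF K.coalgebra_homD(4)[OF f]]] Comp_assoc_arr)
  finally show "(ar G (j Q) \<bullet> \<delta> Q) \<bullet> (ar G f \<bullet> e) = ar G \<xi> \<bullet> (ar G f \<bullet> e)" .
qed

text \<open>
  The transpose \<open>G \<iota> \<circ> c\<close> of the unit of \<open>S\<close> factors through the coinvariants of the free bialgebra on
  \<open>(P, c)\<close>. Both composites equal \<open>G (K \<iota> \<circ> j \<circ> c) \<circ> c\<close>: the left one by naturality of \<open>j\<close>, the right one
  because \<open>law\<close> turns the unit at \<open>K P\<close> into \<open>K \<iota>\<close>.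
\<close>

lemma unit_fork:
  assumes P: "G.coalgebra P c"
  shows "(ar G (j (ob S P)) \<bullet> \<delta> (ob S P)) \<bullet> (ar G (iota S P) \<bullet> c)
    = ar G (law P \<bullet> ar S (j P \<bullet> c)) \<bullet> (ar G (iota S P) \<bullet> c)"
proof -
  note [simp] = G.coalgebraD(1-4)[OF P]
  have j: "ar G (j (ob S P)) \<bullet> ar G (ar G (iota S P)) = ar G (ar K (iota S P)) \<bullet> ar G (j P)"
    using G.endo.ar_eq[OF j_natural_arr[of "iota S P" "ob S P"]] by simp
  have i: "ar S (j P \<bullet> c) \<bullet> iota S P = iota S (ob K P) \<bullet> (j P \<bullet> c)"
    using iota_natural_arr[of "j P \<bullet> c" "ob K P"] by simp
  have "ar G (law P \<bullet> ar S (j P \<bullet> c)) \<bullet> (ar G (iota S P) \<bullet> c)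
      = ar G (law P \<bullet> (ar S (j P \<bullet> c) \<bullet> iota S P)) \<bullet> c"
    by (simp add: Comp_assoc_arr)
  also have "\<dots> = ar G (ar K (iota S P) \<bullet> (j P \<bullet> c)) \<bullet> c"
    unfolding i by (simp add: Comp_reduce[OF law_iota[of P]] Comp_assoc_arr del: G.endo.ar_Comp_arr)
  also have "\<dots> = (ar G (j (ob S P)) \<bullet> \<delta> (ob S P)) \<bullet> (ar G (iota S P) \<bullet> c)"
    by (simp add: G.comonad_simps Comp_reduce[OF j] G.coalgebraD(5)[OF P] Comp_assoc_arr)
  finally show ?thesis by (rule sym)
qed

text \<open>The counit of the adjunction: the algebra morphism on \<open>S N\<close> that extends \<open>\<epsilon> \<circ> e : N \<rightarrow> P\<close>.\<close>

definition evaluation :: "'p \<Rightarrow> 'b \<Rightarrow> 'b \<Rightarrow> 'b" where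
  "evaluation P \<sigma> e = \<sigma> \<bullet> ar S (\<epsilon> P) \<bullet> ar S e"

lemma evaluation_type [simp]:
  "\<lbrakk>is_algebra \<M> S P \<sigma>; e \<in> Arr \<M>; Cod \<M> e = ob G P\<rbrakk> \<Longrightarrow> evaluation P \<sigma> e \<in> Arr \<M> \<and>
    Dom \<M> (evaluation P \<sigma> e) = ob S (Dom \<M> e) \<and> Cod \<M> (evaluation P \<sigma> e) = P"
  by (simp add: evaluation_def algebraD)

text \<open>
  The identity that ties the counit to the Galois maps. Since \<open>\<zeta>\<close> is a morphism of algebras, it
  reduces to \<open>\<zeta> \<circ> \<epsilon> \<circ> e = j \<circ> e\<close>, which is the fork condition on \<open>e\<close> followed by the counit of \<open>G\<close>.
\<close>

lemma coaction_evaluation: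
  assumes y: "coinvariants P \<sigma> \<zeta> N c e"
  shows "\<zeta> \<bullet> evaluation P \<sigma> e = galois P \<sigma> \<bullet> ar S e"
proof -
  note b = bialgebraD[OF coinvariantsD(1)[OF y]]
  note [simp] = K.coalgebraD(1-4)[OF b(2)] algebraD(1-4)[OF b(1)] G.coalgebraD(1-4)[OF coinvariantsD(2)[OF y]]
    G.coalgebra_homD(1-3)[OF coinvariantsD(3)[OF y]]
  have "\<zeta> \<bullet> (\<epsilon> P \<bullet> e) = \<epsilon> (ob K P) \<bullet> (ar G \<zeta> \<bullet> e)"
    by (simp add: G.comonad_simps Comp_assoc_arr)
  also have "\<dots> = \<epsilon> (ob K P) \<bullet> (ar G (j P) \<bullet> \<delta> P \<bullet> e)"
    by (simp add: equalizer_type(7)[OF coinvariantsD(4)[OF y]])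
  also have "\<dots> = j P \<bullet> e"
    by (simp add: G.comonad_simps Comp_assoc_arr)
  finally have z: "ar S \<zeta> \<bullet> ar S (\<epsilon> P \<bullet> e) = ar S (j P \<bullet> e)"
    by (rule endo.ar_eq) simp_all
  show ?thesis
    using z by (simp add: evaluation_def galois_def Comp_reduce[OF b(3)] Comp_assoc_arr)
qed

lemma evaluation_algebra_hom:
  assumes y: "coinvariants P \<sigma> \<zeta> N c e"
  shows "algebra_hom (ob S N) (mu S N) (evaluation P \<sigma> e) P \<sigma>"
proof -
  note b = bialgebraD[OF coinvariantsD(1)[OF y]]
  note [simp] = algebraD(1-4)[OF b(1)] G.coalgebraD(1-4)[OF coinvariantsD(2)[OF y]]
    G.coalgebra_homD(1-3)[OF coinvariantsD(3)[OF y]]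
  have "\<sigma> \<bullet> (ar S \<sigma> \<bullet> (ar S (ar S (\<epsilon> P)) \<bullet> ar S (ar S e)))
      = \<sigma> \<bullet> (ar S (\<epsilon> P) \<bullet> (ar S e \<bullet> mu S N))"
    by (simp add: Comp_reduce[OF algebraD(5)[OF b(1)]] monad_simps Comp_assoc_arr)
  then show ?thesis
    by (simp add: algebra_hom_def hom_iff evaluation_def Comp_assoc_arr)
qed

lemma evaluation_coalgebra_hom:
  assumes y: "coinvariants P \<sigma> \<zeta> N c e"
  shows "K.coalgebra_hom (ob S N) (law N \<bullet> ar S (j N \<bullet> c)) (evaluation P \<sigma> e) P \<zeta>"
proof -
  note b = bialgebraD[OF coinvariantsD(1)[OF y]]
  note [simp] = algebraD(1-4)[OF b(1)] K.coalgebraD(1-4)[OF b(2)] G.coalgebraD(1-4)[OF coinvariantsD(2)[OF y]]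
    G.coalgebra_homD(1-3)[OF coinvariantsD(3)[OF y]]
  have "ar K (\<epsilon> P) \<bullet> (ar K e \<bullet> (j N \<bullet> c)) = j P \<bullet> (ar G (\<epsilon> P) \<bullet> (ar G e \<bullet> c))"
    by (simp add: law_simps Comp_assoc_arr)
  also have "\<dots> = j P \<bullet> e"
    by (simp add: G.coalgebra_homD(4)[OF coinvariantsD(3)[OF y], symmetric] G.comonad_simps)
  finally have z: "ar S (ar K (\<epsilon> P) \<bullet> (ar K e \<bullet> (j N \<bullet> c))) = ar S (j P \<bullet> e)" by simp
  have "ar K (evaluation P \<sigma> e) \<bullet> (law N \<bullet> ar S (j N \<bullet> c))
      = ar K \<sigma> \<bullet> (law P \<bullet> ar S (ar K (\<epsilon> P) \<bullet> (ar K e \<bullet> (j N \<bullet> c))))"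
    by (simp add: evaluation_def law_simps Comp_assoc_arr)
  also have "\<dots> = \<zeta> \<bullet> evaluation P \<sigma> e"
    unfolding z coaction_evaluation[OF y] by (simp add: galois_def Comp_assoc_arr)
  finally show ?thesis by (simp add: K.coalgebra_hom_def hom_iff b(1))
qed

text \<open>The triangle identity at a free bialgebra, \<open>k\<close> being the unit of the adjunction.\<close>

lemma evaluation_free:
  assumes P: "G.coalgebra P c" and e: "e \<in> Arr \<M>" "Cod \<M> e = ob G (ob S P)"
    and k: "k \<in> hom \<M> P (Dom \<M> e)" and ek: "e \<bullet> k = ar G (iota S P) \<bullet> c"
  shows "evaluation (ob S P) (mu S P) e \<bullet> ar S k = Ident \<M> (ob S P)"
proof -
  note [simp] = G.coalgebraD(1-4)[OF P] e
  have [simp]: "k \<in> Arr \<M>" "Dom \<M> k = P" "Cod \<M> k = Dom \<M> e" using k by (simp_all add: hom_iff)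
  have "evaluation (ob S P) (mu S P) e \<bullet> ar S k = mu S P \<bullet> ar S (\<epsilon> (ob S P) \<bullet> (e \<bullet> k))"
    by (simp add: evaluation_def Comp_assoc_arr)
  also have "\<epsilon> (ob S P) \<bullet> (e \<bullet> k) = iota S P"
    unfolding ek by (simp add: G.comonad_simps Comp_assoc_arr G.coalgebraD(6)[OF P])
  finally show ?thesis by (simp add: mu_ar_iota)
qed

text \<open>The other triangle identity, after composition with the monomorphism \<open>e\<close>.\<close>

lemma evaluation_iota:
  assumes y: "coinvariants P \<sigma> \<zeta> N c e"
  shows "ar G (evaluation P \<sigma> e) \<bullet> (ar G (iota S N) \<bullet> c) = e"
proof -
  note b = bialgebraD[OF coinvariantsD(1)[OF y]]
  note [simp] = algebraD(1-4)[OF b(1)] G.coalgebraD(1-4)[OF coinvariantsD(2)[OF y]]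
    G.coalgebra_homD(1-3)[OF coinvariantsD(3)[OF y]]
  have "evaluation P \<sigma> e \<bullet> iota S N = (\<sigma> \<bullet> iota S P) \<bullet> (\<epsilon> P \<bullet> e)"
    by (simp add: evaluation_def Comp_assoc_arr iota_natural_arr Comp_reduce[OF iota_natural_arr])
  then have i: "evaluation P \<sigma> e \<bullet> iota S N = \<epsilon> P \<bullet> e" by (simp add: algebraD(6)[OF b(1)])
  have "ar G (evaluation P \<sigma> e) \<bullet> (ar G (iota S N) \<bullet> c) = ar G (\<epsilon> P) \<bullet> (ar G e \<bullet> c)"
    by (simp add: Comp_reduce[OF G.endo.ar_eq[OF i]] b(1) Comp_assoc_arr)
  also have "\<dots> = e"
    by (simp add: G.coalgebra_homD(4)[OF coinvariantsD(3)[OF y], symmetric] G.comonad_simps)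
  finally show ?thesis .
qed

lemma evaluation_natural:
  assumes y: "coinvariants P \<sigma> \<zeta> N c e" and y': "coinvariants Q \<tau> \<xi> N' c' e'"
    and f: "algebra_hom P \<sigma> f Q \<tau>" and k: "k \<in> hom \<M> N N'" and ek: "e' \<bullet> k = ar G f \<bullet> e"
  shows "evaluation Q \<tau> e' \<bullet> ar S k = f \<bullet> evaluation P \<sigma> e"
proof -
  note b = bialgebraD[OF coinvariantsD(1)[OF y]] and b' = bialgebraD[OF coinvariantsD(1)[OF y']]
  note [simp] = algebraD(1-4)[OF b(1)] G.coalgebraD(1-4)[OF coinvariantsD(2)[OF y]]
    G.coalgebra_homD(1-3)[OF coinvariantsD(3)[OF y]] algebra_homD(1-3)[OF f]
    algebraD(1-4)[OF b'(1)] G.coalgebraD(1-4)[OF coinvariantsD(2)[OF y']]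
    G.coalgebra_homD(1-3)[OF coinvariantsD(3)[OF y']]
  have [simp]: "k \<in> Arr \<M>" "Dom \<M> k = N" "Cod \<M> k = N'" using k by (simp_all add: hom_iff)
  have "evaluation Q \<tau> e' \<bullet> ar S k = \<tau> \<bullet> ar S (\<epsilon> Q \<bullet> (e' \<bullet> k))"
    by (simp add: evaluation_def Comp_assoc_arr)
  also have "\<epsilon> Q \<bullet> (e' \<bullet> k) = f \<bullet> (\<epsilon> P \<bullet> e)"
    unfolding ek by (simp add: G.comonad_simps Comp_assoc_arr)
  also have "\<tau> \<bullet> ar S (f \<bullet> (\<epsilon> P \<bullet> e)) = f \<bullet> evaluation P \<sigma> e"
    by (simp add: evaluation_def Comp_reduce[OF algebra_homD(4)[OF f]] Comp_assoc_arr)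
  finally show ?thesis .
qed

text \<open>
  Both \<open>S e\<close> and \<open>\<zeta>\<close> are equalizers, the first by preservation and the second split, and the
  comparisons at \<open>P\<close> and at \<open>K P\<close> are an isomorphism between the two parallel pairs. By
  \<open>coaction_evaluation\<close> the induced map on equalizers is the counit.
\<close>

lemma evaluation_iso:
  assumes iso: "\<And>P \<sigma>. is_algebra \<M> S P \<sigma> \<Longrightarrow> is_iso \<M> (galois P \<sigma>)"
    and S: "preserves_coreflexive_equalizers \<M> \<M> S"
    and y: "coinvariants P \<sigma> \<zeta> N c e"
  shows "is_iso \<M> (evaluation P \<sigma> e)"
proof -
  note b = bialgebraD[OF coinvariantsD(1)[OF y]]
  note [simp] = b(1) algebraD(1-4)[OF b(1)] K.coalgebraD(1-4)[OF b(2)]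
    G.coalgebraD(1-4)[OF coinvariantsD(2)[OF y]] G.coalgebra_homD(1-3)[OF coinvariantsD(3)[OF y]]
  note z = K.coalgebraD(5,6)[OF b(2)]
  have KP [simp]: "is_algebra \<M> S (ob K P) (ar K \<sigma> \<bullet> law P)"
    using bialgebraD(1)[OF cofree_bialgebra[OF b(1)]] .
  let ?g = "galois P \<sigma>" and ?g2 = "galois (ob K P) (ar K \<sigma> \<bullet> law P)"
  let ?L = "ar S (ar G (j P) \<bullet> \<delta> P)" and ?R = "ar S (ar G \<zeta>)"
  have eqS: "is_equalizer \<M> ?L ?R (ar S e)"
    using S coinvariantsD(4)[OF y] pair_coreflexive[OF b(2)]
    unfolding preserves_coreflexive_equalizers_def by blast
  have nR: "?g2 \<bullet> ?R = ar K \<zeta> \<bullet> ?g"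
    by (rule galois_natural) (simp_all add: algebra_hom_def hom_iff b(3))
  have nL: "?g2 \<bullet> ?L = \<Delta> P \<bullet> ?g"
  proof -
    have j: "j (ob K P) \<bullet> (ar G (j P) \<bullet> \<delta> P) = \<Delta> P \<bullet> j P"
      by (simp add: law_simps Comp_assoc_arr)
    have "?g2 \<bullet> ?L = ar K (ar K \<sigma>) \<bullet> (ar K (law P) \<bullet> (law (ob K P) \<bullet>
        ar S (j (ob K P) \<bullet> (ar G (j P) \<bullet> \<delta> P))))"
      by (simp add: galois_def Comp_assoc_arr)
    also have "\<dots> = \<Delta> P \<bullet> ?g"
      unfolding j
      by (simp add: galois_def endo.ar_eq[OF j_comult[of P]] Comp_assoc_arr law_simps K.comonad_simps)
    finally show ?thesis .
  qed
  from iso[OF b(1)] obtain h where "h \<in> Arr \<M>" "Dom \<M> h = Cod \<M> ?g" "Cod \<M> h = Dom \<M> ?g"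
    "h \<bullet> ?g = Ident \<M> (Dom \<M> ?g)" "?g \<bullet> h = Ident \<M> (Cod \<M> ?g)"
    by (rule iso_inverse)
  then have [simp]: "h \<in> Arr \<M>" "Dom \<M> h = ob K P" "Cod \<M> h = ob S (ob G P)"
    and h: "h \<bullet> ?g = Ident \<M> (ob S (ob G P))" "?g \<bullet> h = Ident \<M> (ob K P)"
    by simp_all
  \<comment> \<open>The inverse of the counit is the factorization \<open>k\<close> of \<open>h \<circ> \<zeta>\<close> through \<open>S e\<close>.\<close>
  have "?L \<bullet> (h \<bullet> \<zeta>) = ?R \<bullet> (h \<bullet> \<zeta>)"
  proof (rule iso_cancel_left[OF iso[OF KP]])
    have "?g2 \<bullet> (?L \<bullet> (h \<bullet> \<zeta>)) = (?g2 \<bullet> ?L) \<bullet> (h \<bullet> \<zeta>)" by (simp add: Comp_assoc_arr)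
    also have "\<dots> = ar K \<zeta> \<bullet> \<zeta>" unfolding nL by (simp add: Comp_assoc_arr Comp_reduce[OF h(2)] z)
    also have "\<dots> = (?g2 \<bullet> ?R) \<bullet> (h \<bullet> \<zeta>)" unfolding nR by (simp add: Comp_assoc_arr Comp_reduce[OF h(2)])
    also have "\<dots> = ?g2 \<bullet> (?R \<bullet> (h \<bullet> \<zeta>))" by (simp add: Comp_assoc_arr)
    finally show "?g2 \<bullet> (?L \<bullet> (h \<bullet> \<zeta>)) = ?g2 \<bullet> (?R \<bullet> (h \<bullet> \<zeta>))" .
  qed simp_all
  then obtain k where "k \<in> hom \<M> P (ob S N)" and k: "ar S e \<bullet> k = h \<bullet> \<zeta>"
    using equalizer_factor[OF eqS, of "h \<bullet> \<zeta>"] by (auto simp: hom_iff)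
  then have [simp]: "k \<in> Arr \<M>" "Dom \<M> k = P" "Cod \<M> k = ob S N" by (simp_all add: hom_iff)
  note ze = coaction_evaluation[OF y]
  have "\<zeta> \<bullet> (evaluation P \<sigma> e \<bullet> k) = \<zeta>"
    by (simp add: Comp_reduce[OF ze] Comp_assoc_arr k Comp_reduce[OF h(2)])
  then have "E P \<bullet> (\<zeta> \<bullet> (evaluation P \<sigma> e \<bullet> k)) = E P \<bullet> \<zeta>" by simp
  then have ek: "evaluation P \<sigma> e \<bullet> k = Ident \<M> P" by (simp add: Comp_reduce[OF z(2)] z(2))
  have ke: "k \<bullet> evaluation P \<sigma> e = Ident \<M> (ob S N)"
  proof (rule equalizer_mono[OF eqS])
    show "ar S e \<bullet> (k \<bullet> evaluation P \<sigma> e) = ar S e \<bullet> Ident \<M> (ob S N)"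
      by (simp add: Comp_reduce[OF k] Comp_assoc_arr ze Comp_reduce[OF h(1)])
  qed simp_all
  show ?thesis by (rule is_isoI[of _ k]) (simp_all add: ek ke)
qed

text \<open>
  For the cofree bialgebra over \<open>P\<close> the pair is split by the counit of \<open>K\<close>, with equalizer
  \<open>G j \<circ> \<delta> : G P \<rightarrow> G (K P)\<close>. Hence \<open>u = G E \<circ> e : N \<rightarrow> G P\<close> is invertible, and the counit is
  \<open>galois P \<sigma> \<circ> S u\<close>.
\<close>

lemma galois_iso_of_evaluation_iso:
  assumes P: "is_algebra \<M> S P \<sigma>"
    and y: "coinvariants (ob K P) (ar K \<sigma> \<bullet> law P) (\<Delta> P) N c e"
    and iso: "is_iso \<M> (evaluation (ob K P) (ar K \<sigma> \<bullet> law P) e)"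
  shows "is_iso \<M> (galois P \<sigma>)"
proof -
  note [simp] = P algebraD(1-4)[OF P]
    G.coalgebraD(1-4)[OF coinvariantsD(2)[OF y]] G.coalgebra_homD(1-3)[OF coinvariantsD(3)[OF y]]
  note eq = coinvariantsD(4)[OF y]
  let ?e = "ar G (j P) \<bullet> \<delta> P"
  have fork: "ar G (j (ob K P)) \<bullet> (\<delta> (ob K P) \<bullet> ?e) = ar G (\<Delta> P) \<bullet> ?e"
  proof -
    have "ar G (j (ob K P)) \<bullet> (\<delta> (ob K P) \<bullet> ?e) = ar G (j (ob K P) \<bullet> (ar G (j P) \<bullet> \<delta> P)) \<bullet> \<delta> P"
      by (simp add: G.comonad_simps Comp_assoc_arr)
    also have "j (ob K P) \<bullet> (ar G (j P) \<bullet> \<delta> P) = \<Delta> P \<bullet> j P"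
      by (simp add: law_simps Comp_assoc_arr)
    finally show ?thesis by (simp add: Comp_assoc_arr)
  qed
  then obtain v where "v \<in> hom \<M> (ob G P) N" and v: "e \<bullet> v = ?e"
    using equalizer_factor[OF eq, of ?e] by (auto simp: hom_iff Comp_assoc_arr)
  then have [simp]: "v \<in> Arr \<M>" "Dom \<M> v = ob G P" "Cod \<M> v = N" by (simp_all add: hom_iff)
  let ?u = "ar G (E P) \<bullet> e"
  have ue: "?e \<bullet> ?u = e"
  proof -
    have "?e \<bullet> ?u = ar G (j P) \<bullet> (ar G (ar G (E P)) \<bullet> (\<delta> (ob K P) \<bullet> e))"
      by (simp add: G.comonad_simps Comp_assoc_arr)
    also have "\<dots> = ar G (ar K (E P)) \<bullet> (ar G (j (ob K P)) \<bullet> \<delta> (ob K P) \<bullet> e)"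
      by (simp add: Comp_reduce[OF G.endo.ar_eq[OF j_natural_arr[of "E P" P]]] Comp_assoc_arr)
    also have "\<dots> = ar G (ar K (E P)) \<bullet> (ar G (\<Delta> P) \<bullet> e)"
      by (simp add: equalizer_type(7)[OF eq])
    also have "\<dots> = e"
      by (simp add: Comp_reduce[OF G.endo.ar_eq[OF K.ar_counit_comult[of P]]])
    finally show ?thesis .
  qed
  have vu: "v \<bullet> ?u = Ident \<M> N"
  proof (rule equalizer_mono[OF eq])
    have "e \<bullet> (v \<bullet> ?u) = (e \<bullet> v) \<bullet> ?u" by (simp add: Comp_assoc_arr)
    also have "\<dots> = e \<bullet> Ident \<M> N" unfolding v ue by simp
    finally show "e \<bullet> (v \<bullet> ?u) = e \<bullet> Ident \<M> N" .
  qed simp_all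
  have uv: "?u \<bullet> v = Ident \<M> (ob G P)"
    by (simp add: Comp_assoc_arr v Comp_reduce[OF G.endo.ar_eq[OF j_counit[of P]]] G.comonad_simps)
  have "is_iso \<M> ?u" by (rule is_isoI[of _ v]) (simp_all add: vu uv)
  then have Su: "is_iso \<M> (ar S ?u)" by (rule endo.ar_is_iso)
  have "evaluation (ob K P) (ar K \<sigma> \<bullet> law P) e
      = ar K \<sigma> \<bullet> (law P \<bullet> ar S (\<epsilon> (ob K P) \<bullet> (?e \<bullet> ?u)))"
    unfolding ue by (simp add: evaluation_def Comp_assoc_arr)
  also have "\<epsilon> (ob K P) \<bullet> (?e \<bullet> ?u) = j P \<bullet> ?u"
    by (simp add: G.comonad_simps Comp_assoc_arr)
  finally have "evaluation (ob K P) (ar K \<sigma> \<bullet> law P) e = galois P \<sigma> \<bullet> ar S ?u"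
    by (simp add: galois_def Comp_assoc_arr)
  with iso have "is_iso \<M> (galois P \<sigma> \<bullet> ar S ?u)" by simp
  then show ?thesis by (rule is_iso_cancel_right[OF _ Su]) simp_all
qed

end

section \<open>Module categories and comonoids\<close>

context monoidal_category
begin

lemmas [simp] = unit_Ob tensor_Ob tensor_Ident

lemma tensor_type [simp]: "\<lbrakk>f \<in> Arr \<C>; g \<in> Arr \<C>\<rbrakk> \<Longrightarrow> f \<otimes>\<^sub>a g \<in> Arr \<C> \<and>
    Dom \<C> (f \<otimes>\<^sub>a g) = Dom \<C> f \<otimes> Dom \<C> g \<and> Cod \<C> (f \<otimes>\<^sub>a g) = Cod \<C> f \<otimes> Cod \<C> g"
  using tensor_hom by (simp add: hom_iff)

lemma tensor_merge:
  "\<lbrakk>f \<in> Arr \<C>; f' \<in> Arr \<C>; g \<in> Arr \<C>; g' \<in> Arr \<C>; Cod \<C> f = Dom \<C> f'; Cod \<C> g = Dom \<C> g'\<rbrakk>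
    \<Longrightarrow> (f' \<otimes>\<^sub>a g') \<bullet> (f \<otimes>\<^sub>a g) = (f' \<bullet> f) \<otimes>\<^sub>a (g' \<bullet> g)"
  using tensor_Comp by (simp add: hom_iff)

lemmas tensor_simps = tensor_merge Comp_reduce[OF tensor_merge]

lemma assoc_type [simp]: "\<lbrakk>X \<in> Ob \<C>; Y \<in> Ob \<C>; Z \<in> Ob \<C>\<rbrakk> \<Longrightarrow> assoc \<C> X Y Z \<in> Arr \<C> \<and>
    Dom \<C> (assoc \<C> X Y Z) = (X \<otimes> Y) \<otimes> Z \<and> Cod \<C> (assoc \<C> X Y Z) = X \<otimes> (Y \<otimes> Z)"
  using assoc_hom by (simp add: hom_iff)

lemma lunit_type [simp]: "X \<in> Ob \<C> \<Longrightarrow> lunit \<C> X \<in> Arr \<C> \<and>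
    Dom \<C> (lunit \<C> X) = unit_ob \<C> \<otimes> X \<and> Cod \<C> (lunit \<C> X) = X"
  using lunit_hom by (simp add: hom_iff)

lemma runit_type [simp]: "X \<in> Ob \<C> \<Longrightarrow> runit \<C> X \<in> Arr \<C> \<and>
    Dom \<C> (runit \<C> X) = X \<otimes> unit_ob \<C> \<and> Cod \<C> (runit \<C> X) = X"
  using runit_hom by (simp add: hom_iff)

end

context module_category
begin

lemmas [simp] = act_Ob act_Ident

lemma act_type [simp]: "\<lbrakk>f \<in> Arr \<C>; p \<in> Arr \<M>\<rbrakk> \<Longrightarrow> f \<odot>\<^sub>a p \<in> Arr \<M> \<and>
    Dom \<M> (f \<odot>\<^sub>a p) = Dom \<C> f \<odot> Dom \<M> p \<and> Cod \<M> (f \<odot>\<^sub>a p) = Cod \<C> f \<odot> Cod \<M> p"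
  using act_hom by (simp add: hom_iff base.hom_iff)

lemma act_merge:
  "\<lbrakk>f \<in> Arr \<C>; f' \<in> Arr \<C>; p \<in> Arr \<M>; p' \<in> Arr \<M>; Cod \<C> f = Dom \<C> f'; Cod \<M> p = Dom \<M> p'\<rbrakk>
    \<Longrightarrow> (f' \<odot>\<^sub>a p') \<bullet> (f \<odot>\<^sub>a p) = (f' \<bullet>\<^bsub>\<C>\<^esub> f) \<odot>\<^sub>a (p' \<bullet> p)"
  using act_Comp by (simp add: hom_iff base.hom_iff)

lemmas act_simps = act_merge Comp_reduce[OF act_merge]

lemma massoc_type [simp]: "\<lbrakk>X \<in> Ob \<C>; Y \<in> Ob \<C>; P \<in> Ob \<M>\<rbrakk> \<Longrightarrow> massoc \<M> X Y P \<in> Arr \<M> \<and>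
    Dom \<M> (massoc \<M> X Y P) = (X \<otimes>\<^bsub>\<C>\<^esub> Y) \<odot> P \<and> Cod \<M> (massoc \<M> X Y P) = X \<odot> (Y \<odot> P)"
  using massoc_hom by (simp add: hom_iff)

lemma mlunit_type [simp]: "P \<in> Ob \<M> \<Longrightarrow> mlunit \<M> P \<in> Arr \<M> \<and>
    Dom \<M> (mlunit \<M> P) = unit_ob \<C> \<odot> P \<and> Cod \<M> (mlunit \<M> P) = P"
  using mlunit_hom by (simp add: hom_iff)

lemma massoc_natural_arr:
  "\<lbrakk>f \<in> Arr \<C>; g \<in> Arr \<C>; p \<in> Arr \<M>; Dom \<C> f = X; Dom \<C> g = Y; Dom \<M> p = P\<rbrakk>
    \<Longrightarrow> (f \<odot>\<^sub>a (g \<odot>\<^sub>a p)) \<bullet> massoc \<M> X Y P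
      = massoc \<M> (Cod \<C> f) (Cod \<C> g) (Cod \<M> p) \<bullet> ((f \<otimes>\<^sub>a\<^bsub>\<C>\<^esub> g) \<odot>\<^sub>a p)"
  using massoc_natural[of f X _ g Y _ p P] by (simp add: hom_iff base.hom_iff)

lemma mlunit_natural_arr:
  "\<lbrakk>p \<in> Arr \<M>; Cod \<M> p = Q\<rbrakk>
    \<Longrightarrow> mlunit \<M> Q \<bullet> (Ident \<C> (unit_ob \<C>) \<odot>\<^sub>a p) = p \<bullet> mlunit \<M> (Dom \<M> p)"
  using mlunit_natural[of p _ Q] by (simp add: hom_iff)

lemmas massoc_simps = massoc_natural_arr Comp_reduce[OF massoc_natural_arr]

lemma act_is_iso:
  assumes "is_iso \<C> f" "is_iso \<M> p" shows "is_iso \<M> (f \<odot>\<^sub>a p)"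
proof -
  from assms(1) obtain f' where [simp]: "f \<in> Arr \<C>" "f' \<in> Arr \<C>" "Dom \<C> f' = Cod \<C> f"
    "Cod \<C> f' = Dom \<C> f" and f: "f' \<bullet>\<^bsub>\<C>\<^esub> f = Ident \<C> (Dom \<C> f)" "f \<bullet>\<^bsub>\<C>\<^esub> f' = Ident \<C> (Cod \<C> f)"
    by (rule base.iso_inverse)
  from assms(2) obtain p' where [simp]: "p \<in> Arr \<M>" "p' \<in> Arr \<M>" "Dom \<M> p' = Cod \<M> p"
    "Cod \<M> p' = Dom \<M> p" and p: "p' \<bullet> p = Ident \<M> (Dom \<M> p)" "p \<bullet> p' = Ident \<M> (Cod \<M> p)"
    by (rule iso_inverse)
  show ?thesis
    by (rule is_isoI[of _ "f' \<odot>\<^sub>a p'"])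
      (simp_all add: act_simps f p Dom_Ob Cod_Ob base.Dom_Ob base.Cod_Ob)
qed

text \<open>
  Kelly's argument: after tensoring with the unit object, the two sides agree up to invertible constraints by
  the pentagon and the triangle axioms, and the functor \<open>I \<odot> -\<close> is faithful because it is isomorphic to
  the identity.
\<close>

lemma mlunit_massoc:
  assumes [simp]: "Y \<in> Ob \<C>" "P \<in> Ob \<M>"
  shows "mlunit \<M> (Y \<odot> P) \<bullet> massoc \<M> (unit_ob \<C>) Y P = lunit \<C> Y \<odot>\<^sub>a Ident \<M> P"
proof -
  let ?I = "unit_ob \<C>" let ?i = "Ident \<C> ?I" let ?p = "Ident \<M> P"
  let ?f = "mlunit \<M> (Y \<odot> P) \<bullet> massoc \<M> ?I Y P" and ?g = "lunit \<C> Y \<odot>\<^sub>a ?p"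
  let ?a = "massoc \<M> ?I (?I \<otimes>\<^bsub>\<C>\<^esub> Y) P \<bullet> (assoc \<C> ?I ?I Y \<odot>\<^sub>a ?p)"
  have a: "is_iso \<M> ?a"
    by (rule is_iso_Comp) (simp_all add: act_is_iso base.assoc_iso is_iso_Ident massoc_iso)
  have "(?i \<odot>\<^sub>a ?f) \<bullet> ?a = (?i \<odot>\<^sub>a mlunit \<M> (Y \<odot> P)) \<bullet> ((?i \<odot>\<^sub>a massoc \<M> ?I Y P)
      \<bullet> massoc \<M> ?I (?I \<otimes>\<^bsub>\<C>\<^esub> Y) P \<bullet> (assoc \<C> ?I ?I Y \<odot>\<^sub>a ?p))"
    by (simp add: Comp_assoc_arr act_simps)
  also have "\<dots> = ((?i \<odot>\<^sub>a mlunit \<M> (Y \<odot> P)) \<bullet> massoc \<M> ?I ?I (Y \<odot> P)) \<bullet> massoc \<M> (?I \<otimes>\<^bsub>\<C>\<^esub> ?I) Y P"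
    by (simp add: mpentagon Comp_assoc_arr)
  also have "\<dots> = (runit \<C> ?I \<odot>\<^sub>a (Ident \<C> Y \<odot>\<^sub>a ?p)) \<bullet> massoc \<M> (?I \<otimes>\<^bsub>\<C>\<^esub> ?I) Y P"
    by (simp add: mtriangle)
  also have "\<dots> = massoc \<M> ?I Y P \<bullet> ((runit \<C> ?I \<otimes>\<^sub>a\<^bsub>\<C>\<^esub> Ident \<C> Y) \<odot>\<^sub>a ?p)"
    by (simp add: massoc_simps del: act_Ident)
  also have "\<dots> = massoc \<M> ?I Y P \<bullet> ((?i \<otimes>\<^sub>a\<^bsub>\<C>\<^esub> lunit \<C> Y) \<odot>\<^sub>a ?p) \<bullet> (assoc \<C> ?I ?I Y \<odot>\<^sub>a ?p)"
    by (simp add: base.triangle[symmetric] act_simps Comp_assoc_arr)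
  also have "\<dots> = (?i \<odot>\<^sub>a ?g) \<bullet> ?a"
    by (simp add: massoc_simps Comp_assoc_arr)
  finally have "?i \<odot>\<^sub>a ?f = ?i \<odot>\<^sub>a ?g"
    by (rule iso_cancel_right[OF a, rotated 4]) simp_all
  then have "mlunit \<M> (Y \<odot> P) \<bullet> (?i \<odot>\<^sub>a ?f) = mlunit \<M> (Y \<odot> P) \<bullet> (?i \<odot>\<^sub>a ?g)" by simp
  then have "?f \<bullet> mlunit \<M> ((?I \<otimes>\<^bsub>\<C>\<^esub> Y) \<odot> P) = ?g \<bullet> mlunit \<M> ((?I \<otimes>\<^bsub>\<C>\<^esub> Y) \<odot> P)"
    using mlunit_natural_arr[of ?f "Y \<odot> P"] mlunit_natural_arr[of ?g "Y \<odot> P"] by simp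
  then show ?thesis
    by (rule iso_cancel_right[OF mlunit_iso, rotated 5]) simp_all
qed

end

context comonoid
begin

lemma comonoid_type [simp]:
  "carr C \<in> Ob \<C>"
  "comult C \<in> Arr \<C>" "Dom \<C> (comult C) = carr C" "Cod \<C> (comult C) = carr C \<otimes> carr C"
  "counit C \<in> Arr \<C>" "Dom \<C> (counit C) = carr C" "Cod \<C> (counit C) = unit_ob \<C>"
  using carr_Ob comult_hom counit_hom by (simp_all add: hom_iff)

end

lemma hat_simps [simp]:
  "ob (hat \<C> \<M> C) P = carr C \<odot>\<^bsub>\<M>\<^esub> P" "ar (hat \<C> \<M> C) f = Ident \<C> (carr C) \<odot>\<^sub>a\<^bsub>\<M>\<^esub> f"
  by (simp_all add: hat_def)

context module_category
begin

text \<open>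
  Coassociativity of the comonad is coassociativity of \<open>C\<close> and the pentagon; the two counit laws use
  \<open>mlunit_massoc\<close> and the triangle.
\<close>

lemma hat_comonad:
  assumes "comonoid \<C> C"
  shows "comonad \<M> (hat \<C> \<M> C) (hat_comult \<M> C) (hat_counit \<M> C)"
proof -
  interpret C: comonoid \<C> C by fact
  let ?c = "carr C" and ?D = "comult C" and ?e = "counit C"
  show ?thesis
  proof unfold_locales
    fix P assume P [simp]: "P \<in> Ob \<M>"
    let ?p = "Ident \<M> P"
    show "hat_comult \<M> C (ob (hat \<C> \<M> C) P) \<bullet> hat_comult \<M> C P
        = ar (hat \<C> \<M> C) (hat_comult \<M> C P) \<bullet> hat_comult \<M> C P"
    proof -
      have "hat_comult \<M> C (?c \<odot> P) \<bullet> hat_comult \<M> C P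
          = massoc \<M> ?c ?c (?c \<odot> P) \<bullet> ((?D \<odot>\<^sub>a (Ident \<C> ?c \<odot>\<^sub>a ?p)) \<bullet> massoc \<M> ?c ?c P) \<bullet> (?D \<odot>\<^sub>a ?p)"
        by (simp add: hat_comult_def Comp_assoc_arr)
      also have "\<dots> = (massoc \<M> ?c ?c (?c \<odot> P) \<bullet> massoc \<M> (?c \<otimes>\<^bsub>\<C>\<^esub> ?c) ?c P)
          \<bullet> (((?D \<otimes>\<^sub>a\<^bsub>\<C>\<^esub> Ident \<C> ?c) \<odot>\<^sub>a ?p) \<bullet> (?D \<odot>\<^sub>a ?p))"
        by (simp add: massoc_natural_arr Comp_assoc_arr del: act_Ident)
      also have "\<dots> = (Ident \<C> ?c \<odot>\<^sub>a massoc \<M> ?c ?c P) \<bullet> (massoc \<M> ?c (?c \<otimes>\<^bsub>\<C>\<^esub> ?c) P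
          \<bullet> ((assoc \<C> ?c ?c ?c \<bullet>\<^bsub>\<C>\<^esub> (?D \<otimes>\<^sub>a\<^bsub>\<C>\<^esub> Ident \<C> ?c) \<bullet>\<^bsub>\<C>\<^esub> ?D) \<odot>\<^sub>a ?p))"
        by (simp add: mpentagon act_simps Comp_assoc_arr base.Comp_assoc_arr)
      also have "\<dots> = ar (hat \<C> \<M> C) (hat_comult \<M> C P) \<bullet> hat_comult \<M> C P"
      proof -
        have "ar (hat \<C> \<M> C) (hat_comult \<M> C P) \<bullet> hat_comult \<M> C P
          = (Ident \<C> ?c \<odot>\<^sub>a massoc \<M> ?c ?c P)
            \<bullet> (((Ident \<C> ?c \<odot>\<^sub>a (?D \<odot>\<^sub>a ?p)) \<bullet> massoc \<M> ?c ?c P) \<bullet> (?D \<odot>\<^sub>a ?p))"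
          by (simp add: hat_comult_def Comp_assoc_arr act_simps)
        also have "\<dots> = (Ident \<C> ?c \<odot>\<^sub>a massoc \<M> ?c ?c P) \<bullet> (massoc \<M> ?c (?c \<otimes>\<^bsub>\<C>\<^esub> ?c) P
            \<bullet> (((Ident \<C> ?c \<otimes>\<^sub>a\<^bsub>\<C>\<^esub> ?D) \<bullet>\<^bsub>\<C>\<^esub> ?D) \<odot>\<^sub>a ?p))"
          by (simp add: massoc_natural_arr act_simps Comp_assoc_arr)
        finally show ?thesis by (simp add: C.coassoc)
      qed
      finally show ?thesis by simp
    qed
    show "hat_counit \<M> C (ob (hat \<C> \<M> C) P) \<bullet> hat_comult \<M> C P = Ident \<M> (ob (hat \<C> \<M> C) P)"
    proof -
      have "hat_counit \<M> C (?c \<odot> P) \<bullet> hat_comult \<M> C P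
          = mlunit \<M> (?c \<odot> P) \<bullet> (((?e \<odot>\<^sub>a (Ident \<C> ?c \<odot>\<^sub>a ?p)) \<bullet> massoc \<M> ?c ?c P) \<bullet> (?D \<odot>\<^sub>a ?p))"
        by (simp add: hat_comult_def hat_counit_def Comp_assoc_arr)
      also have "\<dots> = (mlunit \<M> (?c \<odot> P) \<bullet> massoc \<M> (unit_ob \<C>) ?c P)
          \<bullet> (((?e \<otimes>\<^sub>a\<^bsub>\<C>\<^esub> Ident \<C> ?c) \<bullet>\<^bsub>\<C>\<^esub> ?D) \<odot>\<^sub>a ?p)"
        by (simp add: massoc_natural_arr act_simps Comp_assoc_arr del: act_Ident)
      also have "\<dots> = (lunit \<C> ?c \<bullet>\<^bsub>\<C>\<^esub> (?e \<otimes>\<^sub>a\<^bsub>\<C>\<^esub> Ident \<C> ?c) \<bullet>\<^bsub>\<C>\<^esub> ?D) \<odot>\<^sub>a ?p"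
        by (simp add: mlunit_massoc act_simps base.Comp_assoc_arr)
      finally show ?thesis by (simp add: C.left_counit)
    qed
    show "ar (hat \<C> \<M> C) (hat_counit \<M> C P) \<bullet> hat_comult \<M> C P = Ident \<M> (ob (hat \<C> \<M> C) P)"
    proof -
      have "ar (hat \<C> \<M> C) (hat_counit \<M> C P) \<bullet> hat_comult \<M> C P
          = (Ident \<C> ?c \<odot>\<^sub>a mlunit \<M> P) \<bullet> (((Ident \<C> ?c \<odot>\<^sub>a (?e \<odot>\<^sub>a ?p)) \<bullet> massoc \<M> ?c ?c P) \<bullet> (?D \<odot>\<^sub>a ?p))"
        by (simp add: hat_comult_def hat_counit_def Comp_assoc_arr act_simps)
      also have "\<dots> = ((Ident \<C> ?c \<odot>\<^sub>a mlunit \<M> P) \<bullet> massoc \<M> ?c (unit_ob \<C>) P)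
          \<bullet> (((Ident \<C> ?c \<otimes>\<^sub>a\<^bsub>\<C>\<^esub> ?e) \<bullet>\<^bsub>\<C>\<^esub> ?D) \<odot>\<^sub>a ?p)"
        by (simp add: massoc_natural_arr act_simps Comp_assoc_arr)
      also have "\<dots> = (runit \<C> ?c \<bullet>\<^bsub>\<C>\<^esub> (Ident \<C> ?c \<otimes>\<^sub>a\<^bsub>\<C>\<^esub> ?e) \<bullet>\<^bsub>\<C>\<^esub> ?D) \<odot>\<^sub>a ?p"
        by (simp add: mtriangle act_simps base.Comp_assoc_arr)
      finally show ?thesis by (simp add: C.right_counit)
    qed
  next
    fix f P Q assume "f \<in> hom \<M> P Q"
    then have [simp]: "f \<in> Arr \<M>" "Dom \<M> f = P" "Cod \<M> f = Q" by (simp_all add: hom_iff)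
    have [simp]: "P \<in> Ob \<M>" "Q \<in> Ob \<M>" using Dom_Ob[of f] Cod_Ob[of f] by simp_all
    show "hat_comult \<M> C Q \<bullet> ar (hat \<C> \<M> C) f = ar (hat \<C> \<M> C) (ar (hat \<C> \<M> C) f) \<bullet> hat_comult \<M> C P"
      by (simp add: hat_comult_def Comp_assoc_arr act_simps massoc_simps)
    show "hat_counit \<M> C Q \<bullet> ar (hat \<C> \<M> C) f = f \<bullet> hat_counit \<M> C P"
      using Comp_reduce[OF mlunit_natural_arr[of f Q, symmetric], of "?e \<odot>\<^sub>a Ident \<M> P"]
      by (simp add: hat_counit_def Comp_assoc_arr act_simps)
  qed (simp_all add: hom_iff hat_comult_def hat_counit_def act_simps)
qed

end

section \<open>The free algebra-comonoid and its mixed distributive law\<close>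

context bimonad
begin

lemma psi_type [simp]: "\<lbrakk>X \<in> Ob \<C>; Y \<in> Ob \<C>\<rbrakk> \<Longrightarrow> psi T X Y \<in> Arr \<C> \<and>
    Dom \<C> (psi T X Y) = ob T (X \<otimes> Y) \<and> Cod \<C> (psi T X Y) = ob T X \<otimes> ob T Y"
  using psi_hom by (simp add: hom_iff)

lemma psi0_type [simp]: "psi0 T \<in> Arr \<C>" "Dom \<C> (psi0 T) = ob T (unit_ob \<C>)"
  "Cod \<C> (psi0 T) = unit_ob \<C>"
  using psi0_hom by (simp_all add: hom_iff)

lemma psi_natural_arr:
  "\<lbrakk>f \<in> Arr \<C>; g \<in> Arr \<C>; Dom \<C> f = X; Dom \<C> g = Y\<rbrakk>
    \<Longrightarrow> (ar T f \<otimes>\<^sub>a ar T g) \<bullet> psi T X Y = psi T (Cod \<C> f) (Cod \<C> g) \<bullet> ar T (f \<otimes>\<^sub>a g)"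
  using psi_natural[of f X _ g Y] by (simp add: hom_iff)

lemma free_comonoid_comonoid:
  assumes "comonoid \<C> C"
  shows "comonoid \<C> (free_comonoid \<C> T C)"
proof -
  interpret C: comonoid \<C> C by fact
  let ?c = "carr C" and ?D = "comult C" and ?e = "counit C" and ?i = "Ident \<C> (carr C)"
  let ?z = "ob T ?c" and ?I = "unit_ob \<C>"
  let ?iz = "Ident \<C> ?z" and ?Dz = "psi T ?c ?c \<bullet> ar T ?D" and ?ez = "psi0 T \<bullet> ar T ?e"
  have eI: "ar T ?i = ?iz" by simp
  have nl: "(ar T g \<otimes>\<^sub>a ?iz) \<bullet> psi T (Dom \<C> g) ?c = psi T (Cod \<C> g) ?c \<bullet> ar T (g \<otimes>\<^sub>a ?i)"
    if "g \<in> Arr \<C>" for g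
    using psi_natural_arr[of g ?i "Dom \<C> g" ?c] that by simp
  have nr: "(?iz \<otimes>\<^sub>a ar T g) \<bullet> psi T ?c (Dom \<C> g) = psi T ?c (Cod \<C> g) \<bullet> ar T (?i \<otimes>\<^sub>a g)"
    if "g \<in> Arr \<C>" for g
    using psi_natural_arr[of ?i g ?c "Dom \<C> g"] that by simp
  have "assoc \<C> ?z ?z ?z \<bullet> (?Dz \<otimes>\<^sub>a ?iz) \<bullet> ?Dz = (?iz \<otimes>\<^sub>a ?Dz) \<bullet> ?Dz"
  proof -
    have "assoc \<C> ?z ?z ?z \<bullet> (?Dz \<otimes>\<^sub>a ?iz) \<bullet> ?Dz
        = assoc \<C> ?z ?z ?z \<bullet> (psi T ?c ?c \<otimes>\<^sub>a ?iz) \<bullet> (((ar T ?D \<otimes>\<^sub>a ?iz) \<bullet> psi T ?c ?c) \<bullet> ar T ?D)"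
      by (simp add: Comp_assoc_arr tensor_simps)
    also have "\<dots> = (assoc \<C> ?z ?z ?z \<bullet> (psi T ?c ?c \<otimes>\<^sub>a ?iz) \<bullet> psi T (?c \<otimes> ?c) ?c)
        \<bullet> ar T ((?D \<otimes>\<^sub>a ?i) \<bullet> ?D)"
      using nl[of ?D] by (simp add: Comp_assoc_arr)
    also have "\<dots> = (?iz \<otimes>\<^sub>a psi T ?c ?c) \<bullet> psi T ?c (?c \<otimes> ?c)
        \<bullet> ar T (assoc \<C> ?c ?c ?c \<bullet> (?D \<otimes>\<^sub>a ?i) \<bullet> ?D)"
      by (subst psi_coassoc) (simp_all add: Comp_assoc_arr)
    also have "\<dots> = (?iz \<otimes>\<^sub>a psi T ?c ?c) \<bullet> (psi T ?c (?c \<otimes> ?c) \<bullet> ar T (?i \<otimes>\<^sub>a ?D)) \<bullet> ar T ?D"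
      unfolding C.coassoc by (simp add: Comp_assoc_arr)
    also have "\<dots> = (?iz \<otimes>\<^sub>a ?Dz) \<bullet> ?Dz"
      using nr[of ?D, symmetric] by (simp add: Comp_assoc_arr tensor_simps)
    finally show ?thesis .
  qed
  moreover have "lunit \<C> ?z \<bullet> (?ez \<otimes>\<^sub>a ?iz) \<bullet> ?Dz = ?iz"
  proof -
    have "lunit \<C> ?z \<bullet> (?ez \<otimes>\<^sub>a ?iz) \<bullet> ?Dz
        = lunit \<C> ?z \<bullet> (psi0 T \<otimes>\<^sub>a ?iz) \<bullet> (((ar T ?e \<otimes>\<^sub>a ?iz) \<bullet> psi T ?c ?c) \<bullet> ar T ?D)"
      by (simp add: Comp_assoc_arr tensor_simps)
    also have "\<dots> = (lunit \<C> ?z \<bullet> (psi0 T \<otimes>\<^sub>a ?iz) \<bullet> psi T ?I ?c) \<bullet> ar T ((?e \<otimes>\<^sub>a ?i) \<bullet> ?D)"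
      using nl[of ?e] by (simp add: Comp_assoc_arr)
    also have "\<dots> = ar T (lunit \<C> ?c \<bullet> (?e \<otimes>\<^sub>a ?i) \<bullet> ?D)"
      by (subst psi_left_counit) (simp_all add: Comp_assoc_arr)
    finally show ?thesis unfolding C.left_counit by simp
  qed
  moreover have "runit \<C> ?z \<bullet> (?iz \<otimes>\<^sub>a ?ez) \<bullet> ?Dz = ?iz"
  proof -
    have "runit \<C> ?z \<bullet> (?iz \<otimes>\<^sub>a ?ez) \<bullet> ?Dz
        = runit \<C> ?z \<bullet> (?iz \<otimes>\<^sub>a psi0 T) \<bullet> (((?iz \<otimes>\<^sub>a ar T ?e) \<bullet> psi T ?c ?c) \<bullet> ar T ?D)"
      by (simp add: Comp_assoc_arr tensor_simps)
    also have "\<dots> = (runit \<C> ?z \<bullet> (?iz \<otimes>\<^sub>a psi0 T) \<bullet> psi T ?c ?I) \<bullet> ar T ((?i \<otimes>\<^sub>a ?e) \<bullet> ?D)"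
      using nr[of ?e] by (simp add: Comp_assoc_arr)
    also have "\<dots> = ar T (runit \<C> ?c \<bullet> (?i \<otimes>\<^sub>a ?e) \<bullet> ?D)"
      by (subst psi_right_counit) (simp_all add: Comp_assoc_arr)
    finally show ?thesis unfolding C.right_counit by simp
  qed
  ultimately show ?thesis
    by unfold_locales (simp_all add: free_comonoid_def hom_iff)
qed

text \<open>
  The next two lemmas say that the comonoid \<open>Z = T(C)\<close> lives in \<open>T\<close>-algebras: its structure arrows commute with
  the action \<open>mu\<close>, because \<open>mu\<close> is a morphism of comonoidal functors.
\<close>

lemma mu_comult:
  assumes "comonoid \<C> C"
  shows "comult (free_comonoid \<C> T C) \<bullet> mu T (carr C)
    = (mu T (carr C) \<otimes>\<^sub>a mu T (carr C)) \<bullet> psi T (ob T (carr C)) (ob T (carr C))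
        \<bullet> ar T (comult (free_comonoid \<C> T C))"
proof -
  interpret C: comonoid \<C> C by fact
  have "ar T (comult C) \<bullet> mu T (carr C) = mu T (carr C \<otimes> carr C) \<bullet> ar T (ar T (comult C))"
    using mu_natural_arr[of "comult C" "carr C \<otimes> carr C"] by simp
  then show ?thesis
    by (simp add: free_comonoid_def Comp_assoc_arr
      Comp_reduce[OF mu_comonoidal[of "carr C" "carr C"]])
qed

lemma mu_counit:
  assumes "comonoid \<C> C"
  shows "counit (free_comonoid \<C> T C) \<bullet> mu T (carr C) = psi0 T \<bullet> ar T (counit (free_comonoid \<C> T C))"
proof -
  interpret C: comonoid \<C> C by fact
  have "ar T (counit C) \<bullet> mu T (carr C) = mu T (unit_ob \<C>) \<bullet> ar T (ar T (counit C))"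
    using mu_natural_arr[of "counit C" "unit_ob \<C>"] by simp
  then show ?thesis
    by (simp add: free_comonoid_def Comp_assoc_arr
      Comp_reduce[OF mu_comonoidal0])
qed

text \<open>The next two lemmas say that the unit of \<open>T\<close> at \<open>C\<close> is a morphism of comonoids \<open>C \<rightarrow> Z\<close>.\<close>

lemma iota_comult:
  assumes "comonoid \<C> C"
  shows "comult (free_comonoid \<C> T C) \<bullet> iota T (carr C)
    = (iota T (carr C) \<otimes>\<^sub>a iota T (carr C)) \<bullet> comult C"
proof -
  interpret C: comonoid \<C> C by fact
  have "ar T (comult C) \<bullet> iota T (carr C) = iota T (carr C \<otimes> carr C) \<bullet> comult C"
    using iota_natural_arr[of "comult C" "carr C \<otimes> carr C"] by simp
  then show ?thesis
    by (simp add: free_comonoid_def Comp_assoc_arr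
      Comp_reduce[OF iota_comonoidal[of "carr C" "carr C"]])
qed

lemma iota_counit:
  assumes "comonoid \<C> C"
  shows "counit (free_comonoid \<C> T C) \<bullet> iota T (carr C) = counit C"
proof -
  interpret C: comonoid \<C> C by fact
  have "ar T (counit C) \<bullet> iota T (carr C) = iota T (unit_ob \<C>) \<bullet> counit C"
    using iota_natural_arr[of "counit C" "unit_ob \<C>"] by simp
  then show ?thesis
    by (simp add: free_comonoid_def Comp_assoc_arr
      Comp_reduce[OF iota_comonoidal0])
qed

end

locale hopf_setting = comodule_monad \<C> \<M> T S + C: comonoid \<C> C
  for \<C> :: "('o, 'a, 'x) monoidal_category_scheme"
    and \<M> :: "('o, 'a, 'p, 'b, 'y) module_category_scheme" (structure)
    and T :: "('o, 'a, 'z) bimonad_scheme"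
    and S :: "('o, 'p, 'b, 'w) comodule_monad_scheme"
    and C :: "('o, 'a, 'v) comonoid_scheme"
begin

abbreviation "Z \<equiv> free_comonoid \<C> T C"
abbreviation "\<alpha> \<equiv> mu T (carr C)"
abbreviation "\<iota>C P \<equiv> iota T (carr C) \<odot>\<^sub>a Ident \<M> P"
abbreviation "law P \<equiv> (mu T (carr C) \<odot>\<^sub>a Ident \<M> (ob S P)) \<bullet> chi S (ob T (carr C)) P"

lemma chi_type [simp]: "\<lbrakk>X \<in> Ob \<C>; P \<in> Ob \<M>\<rbrakk> \<Longrightarrow> chi S X P \<in> Arr \<M> \<and>
    Dom \<M> (chi S X P) = ob S (X \<odot> P) \<and> Cod \<M> (chi S X P) = ob T X \<odot> ob S P"
  using chi_hom by (simp add: hom_iff)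

lemma chi_natural_arr:
  "\<lbrakk>f \<in> Arr \<C>; p \<in> Arr \<M>; Cod \<C> f = X; Cod \<M> p = Q\<rbrakk>
    \<Longrightarrow> chi S X Q \<bullet> ar S (f \<odot>\<^sub>a p) = (ar T f \<odot>\<^sub>a ar S p) \<bullet> chi S (Dom \<C> f) (Dom \<M> p)"
  using chi_natural[of f _ X p _ Q] by (simp add: hom_iff base.hom_iff)

lemma Z_simps [simp]: "carr Z = ob T (carr C)"
  by (simp add: free_comonoid_def)

sublocale Z: comonoid \<C> Z
  by (rule base.free_comonoid_comonoid[OF C.comonoid_axioms])

sublocale G: comonad \<M> "hat \<C> \<M> C" "hat_comult \<M> C" "hat_counit \<M> C"
  by (rule hat_comonad[OF C.comonoid_axioms])

sublocale K: comonad \<M> "hat \<C> \<M> Z" "hat_comult \<M> Z" "hat_counit \<M> Z"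
  by (rule hat_comonad[OF Z.comonoid_axioms])

text \<open>
  The axioms that relate \<open>law\<close> to the monad are those of the coaction \<open>chi\<close> together with the action laws of
  \<open>mu\<close>; those that relate it to the comonad are the coassociativity and counit of \<open>chi\<close> together with
  \<open>mu_comult\<close> and \<open>mu_counit\<close>.
\<close>

lemma mixed_law:
  "mixed_law \<M> S (hat \<C> \<M> C) (hat_comult \<M> C) (hat_counit \<M> C)
     (hat \<C> \<M> Z) (hat_comult \<M> Z) (hat_counit \<M> Z) \<iota>C law"
proof unfold_locales
  fix P assume [simp]: "P \<in> Ob \<M>"
  note CM = C.comonoid_axioms
  let ?z = "ob T (carr C)" and ?p = "Ident \<M> P" and ?sp = "Ident \<M> (ob S P)" and ?i = "iota T (carr C)"
  show "\<iota>C P \<in> hom \<M> (ob (hat \<C> \<M> C) P) (ob (hat \<C> \<M> Z) P)"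
    and "law P \<in> hom \<M> (ob S (ob (hat \<C> \<M> Z) P)) (ob (hat \<C> \<M> Z) (ob S P))"
    by (simp_all add: hom_iff)
  show "hat_comult \<M> Z P \<bullet> \<iota>C P = ar (hat \<C> \<M> Z) (\<iota>C P) \<bullet> \<iota>C (ob (hat \<C> \<M> C) P) \<bullet> hat_comult \<M> C P"
  proof -
    have "ar (hat \<C> \<M> Z) (\<iota>C P) \<bullet> \<iota>C (ob (hat \<C> \<M> C) P) \<bullet> hat_comult \<M> C P
        = ((?i \<odot>\<^sub>a (?i \<odot>\<^sub>a ?p)) \<bullet> massoc \<M> (carr C) (carr C) P) \<bullet> (comult C \<odot>\<^sub>a ?p)"
      by (simp add: hat_comult_def act_simps Comp_assoc_arr)
    also have "\<dots> = hat_comult \<M> Z P \<bullet> \<iota>C P"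
      by (simp add: massoc_natural_arr act_simps Comp_assoc_arr hat_comult_def base.iota_comult[OF CM])
    finally show ?thesis by (rule sym)
  qed
  show "hat_counit \<M> Z P \<bullet> \<iota>C P = hat_counit \<M> C P"
    by (simp add: hat_counit_def act_simps Comp_assoc_arr base.iota_counit[OF CM])
  show "law P \<bullet> iota S (ob (hat \<C> \<M> Z) P) = ar (hat \<C> \<M> Z) (iota S P)"
    by (simp add: Comp_assoc_arr chi_iota act_simps base.mu_iota)
  show "law P \<bullet> mu S (ob (hat \<C> \<M> Z) P) = ar (hat \<C> \<M> Z) (mu S P) \<bullet> law (ob S P) \<bullet> ar S (law P)"
    by (simp add: Comp_assoc_arr chi_mu act_simps Comp_reduce[OF chi_natural_arr] base.mu_assoc)
  show "hat_comult \<M> Z (ob S P) \<bullet> law P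
      = ar (hat \<C> \<M> Z) (law P) \<bullet> law (ob (hat \<C> \<M> Z) P) \<bullet> ar S (hat_comult \<M> Z P)"
  proof -
    have "ar (hat \<C> \<M> Z) (law P) \<bullet> law (ob (hat \<C> \<M> Z) P) \<bullet> ar S (hat_comult \<M> Z P)
       = (\<alpha> \<odot>\<^sub>a (\<alpha> \<odot>\<^sub>a ?sp)) \<bullet> (((Ident \<C> (ob T ?z) \<odot>\<^sub>a chi S ?z P) \<bullet> chi S ?z (?z \<odot> P) \<bullet> ar S (massoc \<M> ?z ?z P))
           \<bullet> ar S (comult Z \<odot>\<^sub>a ?p))"
      by (simp add: hat_comult_def act_simps Comp_assoc_arr)
    also have "\<dots> = ((\<alpha> \<odot>\<^sub>a (\<alpha> \<odot>\<^sub>a ?sp)) \<bullet> massoc \<M> (ob T ?z) (ob T ?z) (ob S P)) \<bullet> ((psi T ?z ?z \<odot>\<^sub>a ?sp)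
           \<bullet> (chi S (?z \<otimes>\<^bsub>\<C>\<^esub> ?z) P \<bullet> ar S (comult Z \<odot>\<^sub>a ?p)))"
      by (subst chi_coassoc) (simp_all add: Comp_assoc_arr)
    also have "\<dots> = massoc \<M> ?z ?z (ob S P) \<bullet>
        ((((\<alpha> \<otimes>\<^sub>a\<^bsub>\<C>\<^esub> \<alpha>) \<bullet>\<^bsub>\<C>\<^esub> psi T ?z ?z \<bullet>\<^bsub>\<C>\<^esub> ar T (comult Z)) \<odot>\<^sub>a ?sp) \<bullet> chi S ?z P)"
      by (simp add: massoc_natural_arr chi_natural_arr act_simps Comp_assoc_arr base.Comp_assoc_arr)
    also have "\<dots> = hat_comult \<M> Z (ob S P) \<bullet> law P"
      unfolding base.mu_comult[OF CM, symmetric]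
      by (simp add: hat_comult_def act_simps Comp_assoc_arr)
    finally show ?thesis by (rule sym)
  qed
  show "hat_counit \<M> Z (ob S P) \<bullet> law P = ar S (hat_counit \<M> Z P)"
  proof -
    have "hat_counit \<M> Z (ob S P) \<bullet> law P
        = mlunit \<M> (ob S P) \<bullet> (((counit Z \<bullet>\<^bsub>\<C>\<^esub> \<alpha>) \<odot>\<^sub>a ?sp) \<bullet> chi S ?z P)"
      by (simp add: hat_counit_def act_simps Comp_assoc_arr)
    also have "\<dots> = (mlunit \<M> (ob S P) \<bullet> (psi0 T \<odot>\<^sub>a ?sp) \<bullet> chi S (unit_ob \<C>) P) \<bullet> ar S (counit Z \<odot>\<^sub>a ?p)"
      unfolding base.mu_counit[OF CM]
      by (simp add: chi_natural_arr act_simps Comp_assoc_arr)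
    also have "\<dots> = ar S (hat_counit \<M> Z P)"
      by (simp add: chi_counit hat_counit_def)
    finally show ?thesis .
  qed
next
  fix f P Q assume "f \<in> hom \<M> P Q"
  then have [simp]: "f \<in> Arr \<M>" "Dom \<M> f = P" "Cod \<M> f = Q" by (simp_all add: hom_iff)
  have [simp]: "P \<in> Ob \<M>" "Q \<in> Ob \<M>" using Dom_Ob[of f] Cod_Ob[of f] by simp_all
  show "\<iota>C Q \<bullet> ar (hat \<C> \<M> C) f = ar (hat \<C> \<M> Z) f \<bullet> \<iota>C P"
    by (simp add: act_simps)
  show "law Q \<bullet> ar S (ar (hat \<C> \<M> Z) f) = ar (hat \<C> \<M> Z) (ar S f) \<bullet> law P"
    by (simp add: Comp_assoc_arr chi_natural_arr act_simps)
qed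

sublocale mixed_law \<M> S "hat \<C> \<M> C" "hat_comult \<M> C" "hat_counit \<M> C"
    "hat \<C> \<M> Z" "hat_comult \<M> Z" "hat_counit \<M> Z" \<iota>C law
  by (rule mixed_law)

section \<open>The categories of comodules and of Hopf modules\<close>

text \<open>The comonads stay folded from here on, so that the results on mixed distributive laws match them.\<close>

declare hat_simps [simp del]

abbreviation "CM \<equiv> comodule_category \<C> \<M> C"
abbreviation "HM \<equiv> free_hopf_category \<C> \<M> T S C"
abbreviation "G \<equiv> hat \<C> \<M> C"
abbreviation "K \<equiv> hat \<C> \<M> Z"
abbreviation "\<delta> \<equiv> hat_comult \<M> C"

text \<open>
  Since the action \<open>mu\<close> restricts along the unit to the identity, \<open>chi\<close> at \<open>C\<close> is recovered from \<open>law\<close>. This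
  identifies the coaction of \<open>\<A>\<close> with that of a free bialgebra, and the Galois map with \<open>galois\<close>.
\<close>

lemma law_iota_eq_chi: "P \<in> Ob \<M> \<Longrightarrow> law P \<bullet> ar S (\<iota>C P) = chi S (carr C) P"
  by (simp add: Comp_assoc_arr chi_natural_arr act_simps base.mu_ar_iota)

lemma is_comodule_iff: "is_comodule \<C> \<M> C P d \<longleftrightarrow> G.coalgebra P d"
  by (simp add: is_comodule_def G.coalgebra_def hat_simps)

lemma is_hopf_module_iff: "is_hopf_module \<C> \<M> S Z (mu T (carr C)) P \<sigma> \<zeta> \<longleftrightarrow> bialgebra P \<sigma> \<zeta>"
proof -
  have co: "is_comodule \<C> \<M> Z P \<zeta> \<longleftrightarrow> K.coalgebra P \<zeta>"
    by (simp add: is_comodule_def K.coalgebra_def hat_simps)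
  show ?thesis
  proof (cases "is_algebra \<M> S P \<sigma> \<and> K.coalgebra P \<zeta>")
    case True
    then have [simp]: "P \<in> Ob \<M>" "\<sigma> \<in> Arr \<M>" "Dom \<M> \<sigma> = ob S P" "Cod \<M> \<sigma> = P"
      "\<zeta> \<in> Arr \<M>" "Dom \<M> \<zeta> = P" "Cod \<M> \<zeta> = ob T (carr C) \<odot> P"
      by (simp_all add: is_algebra_def K.coalgebra_def hom_iff hat_simps)
    have "ar K \<sigma> \<bullet> law P \<bullet> ar S \<zeta> = (mu T (carr C) \<odot>\<^sub>a \<sigma>) \<bullet> chi S (ob T (carr C)) P \<bullet> ar S \<zeta>"
      by (simp add: hat_simps act_simps Comp_assoc_arr)
    then show ?thesis using True by (simp add: is_hopf_module_def bialgebra_def co)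
  next
    case False
    then show ?thesis unfolding is_hopf_module_def bialgebra_def co by blast
  qed
qed

lemma CM_simps [simp]:
  "(P, d) \<in> Ob CM \<longleftrightarrow> G.coalgebra P d"
  "((P, d), f, (Q, b)) \<in> Arr CM \<longleftrightarrow>
    G.coalgebra P d \<and> G.coalgebra Q b \<and> G.coalgebra_hom P d f Q b"
  "Dom CM (x, f, y) = x" "Cod CM (x, f, y) = y"
  "Ident CM (P, d) = ((P, d), Ident \<M> P, (P, d))"
  "(y', g, z) \<bullet>\<^bsub>CM\<^esub> (x, f, y) = (x, g \<bullet> f, z)"
  by (simp_all add: comodule_category_def is_comodule_iff G.coalgebra_hom_def hat_simps)

lemma HM_simps [simp]:
  "(P, \<sigma>, \<zeta>) \<in> Ob HM \<longleftrightarrow> bialgebra P \<sigma> \<zeta>"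
  "((P, \<sigma>, \<zeta>), f, (Q, \<tau>, \<xi>)) \<in> Arr HM \<longleftrightarrow>
    bialgebra P \<sigma> \<zeta> \<and> bialgebra Q \<tau> \<xi> \<and> algebra_hom P \<sigma> f Q \<tau> \<and> K.coalgebra_hom P \<zeta> f Q \<xi>"
  "Dom HM (x, f, y) = x" "Cod HM (x, f, y) = y"
  "Ident HM (P, \<sigma>, \<zeta>) = ((P, \<sigma>, \<zeta>), Ident \<M> P, (P, \<sigma>, \<zeta>))"
  "(y', g, z) \<bullet>\<^bsub>HM\<^esub> (x, f, y) = (x, g \<bullet> f, z)"
  by (auto simp add: free_hopf_category_def hopf_category_def is_hopf_module_iff K.coalgebra_hom_def
    algebra_hom_def hat_simps)

lemma CM_homE:
  assumes "t \<in> hom CM (P, d) (Q, b)"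
  obtains f where "t = ((P, d), f, (Q, b))" "G.coalgebra P d" "G.coalgebra Q b"
    "G.coalgebra_hom P d f Q b"
  using assms by (cases t) (auto simp: hom_def)

lemma HM_homE:
  assumes "t \<in> hom HM (P, \<sigma>, \<zeta>) (Q, \<tau>, \<xi>)"
  obtains f where "t = ((P, \<sigma>, \<zeta>), f, (Q, \<tau>, \<xi>))" "bialgebra P \<sigma> \<zeta>" "bialgebra Q \<tau> \<xi>"
    "algebra_hom P \<sigma> f Q \<tau>" "K.coalgebra_hom P \<zeta> f Q \<xi>"
  using assms by (cases t) (auto simp: hom_def)

lemma CM_category: "category CM"
proof (unfold_locales, simp_all only: split_paired_all)
  fix P d Q b R r N n f g h
  show "Dom CM ((P, d), f, Q, b) \<in> Ob CM" "Cod CM ((P, d), f, Q, b) \<in> Ob CM"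
    if "((P, d), f, Q, b) \<in> Arr CM" using that by simp_all
  show "Ident CM (P, d) \<in> hom CM (P, d) (P, d)" if "(P, d) \<in> Ob CM"
    using that by (simp add: hom_def G.coalgebra_hom_Ident)
qed (auto elim!: CM_homE simp: hom_def Comp_assoc_arr G.coalgebra_homD intro: G.coalgebra_hom_Comp)

lemma HM_category: "category HM"
proof (unfold_locales, simp_all only: split_paired_all)
  fix P \<sigma> \<zeta> Q \<tau> \<xi> f
  show "Dom HM ((P, \<sigma>, \<zeta>), f, Q, \<tau>, \<xi>) \<in> Ob HM" "Cod HM ((P, \<sigma>, \<zeta>), f, Q, \<tau>, \<xi>) \<in> Ob HM"
    if "((P, \<sigma>, \<zeta>), f, Q, \<tau>, \<xi>) \<in> Arr HM" using that by simp_all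
  show "Ident HM (P, \<sigma>, \<zeta>) \<in> hom HM (P, \<sigma>, \<zeta>) (P, \<sigma>, \<zeta>)" if "(P, \<sigma>, \<zeta>) \<in> Ob HM"
    using that by (simp add: hom_def algebra_hom_Ident K.coalgebra_hom_Ident bialgebraD)
qed (auto elim!: HM_homE simp: hom_def Comp_assoc_arr algebra_homD
    intro: K.coalgebra_hom_Comp algebra_hom_Comp dest: bialgebraD)

sublocale CM: category CM by (rule CM_category)
sublocale HM: category HM by (rule HM_category)

lemma CM_isoI:
  assumes "((P, d), f, (Q, b)) \<in> Arr CM" and "is_iso \<M> f"
  shows "is_iso CM ((P, d), f, (Q, b))"
proof -
  from assms(1) have f: "G.coalgebra P d" "G.coalgebra Q b" "G.coalgebra_hom P d f Q b" by simp_all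
  note [simp] = G.coalgebra_homD(1-3)[OF f(3)]
  from assms(2) obtain g where g: "g \<in> hom \<M> Q P" "g \<bullet> f = Ident \<M> P" "f \<bullet> g = Ident \<M> Q"
    unfolding is_iso_def by auto
  with G.coalgebra_hom_inverse[OF f] f show ?thesis
    by (intro CM.is_isoI[of _ "((Q, b), g, (P, d))"]) simp_all
qed

lemma HM_isoI:
  assumes "((P, \<sigma>, \<zeta>), f, (Q, \<tau>, \<xi>)) \<in> Arr HM" and "is_iso \<M> f"
  shows "is_iso HM ((P, \<sigma>, \<zeta>), f, (Q, \<tau>, \<xi>))"
proof -
  from assms(1) have f: "bialgebra P \<sigma> \<zeta>" "bialgebra Q \<tau> \<xi>" "algebra_hom P \<sigma> f Q \<tau>"
    "K.coalgebra_hom P \<zeta> f Q \<xi>" by simp_all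
  note [simp] = algebra_homD(1-3)[OF f(3)]
  from assms(2) obtain g where g: "g \<in> hom \<M> Q P" "g \<bullet> f = Ident \<M> P" "f \<bullet> g = Ident \<M> Q"
    unfolding is_iso_def by auto
  with K.coalgebra_hom_inverse[OF _ _ f(4)] algebra_hom_inverse[OF _ _ f(3)] f show ?thesis
    by (intro HM.is_isoI[of _ "((Q, \<tau>, \<xi>), g, (P, \<sigma>, \<zeta>))"]) (simp_all add: bialgebraD)
qed

lemma HM_isoD:
  assumes "is_iso HM ((P, \<sigma>, \<zeta>), f, (Q, \<tau>, \<xi>))"
  shows "is_iso \<M> f"
proof -
  from assms have f: "((P, \<sigma>, \<zeta>), f, (Q, \<tau>, \<xi>)) \<in> Arr HM" by (simp add: is_iso_def)
  then have "algebra_hom P \<sigma> f Q \<tau>" by simp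
  note [simp] = algebra_homD(1-3)[OF this]
  from assms obtain t where t: "t \<in> hom HM (Q, \<tau>, \<xi>) (P, \<sigma>, \<zeta>)"
    "t \<bullet>\<^bsub>HM\<^esub> ((P, \<sigma>, \<zeta>), f, (Q, \<tau>, \<xi>)) = Ident HM (P, \<sigma>, \<zeta>)"
    "((P, \<sigma>, \<zeta>), f, (Q, \<tau>, \<xi>)) \<bullet>\<^bsub>HM\<^esub> t = Ident HM (Q, \<tau>, \<xi>)"
    unfolding is_iso_def by auto
  from t(1) obtain g where g: "t = ((Q, \<tau>, \<xi>), g, (P, \<sigma>, \<zeta>))" "algebra_hom Q \<tau> g P \<sigma>"
    by (rule HM_homE)
  with t(2,3) algebra_homD[OF g(2)] show ?thesis by (intro is_isoI[of _ g]) simp_all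
qed

end

section \<open>The functors \<open>\<A>\<close> and \<open>\<B>\<close>\<close>

locale hopf_equalizer_setting = hopf_setting +
  assumes has_equalizers: "has_coreflexive_equalizers \<M>"
    and hat_preserves: "preserves_coreflexive_equalizers \<M> \<M> (hat \<C> \<M> C)"
begin

lemma \<A>_ob_eq: "G.coalgebra P d
    \<Longrightarrow> \<A>_ob \<M> S C (P, d) = (ob S P, mu S P, law P \<bullet> ar S (\<iota>C P \<bullet> d))"
proof -
  assume P: "G.coalgebra P d"
  note [simp] = G.coalgebraD(1-4)[OF P]
  show ?thesis
    using law_iota_eq_chi[of P] Comp_assoc_arr[of "ar S d" "ar S (\<iota>C P)" "law P"]
    by (simp add: \<A>_ob_def hat_simps)
qed

lemma \<A>_ob_bialgebra: "G.coalgebra P d \<Longrightarrow> bialgebra (ob S P) (mu S P) (law P \<bullet> ar S (\<iota>C P \<bullet> d))"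
  by (rule free_bialgebra[OF pushforward_coalgebra])

lemma \<A>_functor_simps:
  "ob (\<A>_functor \<M> S C) = \<A>_ob \<M> S C"
  "ar (\<A>_functor \<M> S C) (x, f, y) = (\<A>_ob \<M> S C x, ar S f, \<A>_ob \<M> S C y)"
  by (simp_all add: \<A>_functor_def)

lemma \<A>_cat_functor: "cat_functor CM HM (\<A>_functor \<M> S C)"
proof (unfold_locales, simp_all only: split_paired_all)
  fix P d Q b R r t u
  show "ob (\<A>_functor \<M> S C) (P, d) \<in> Ob HM" if "(P, d) \<in> Ob CM"
    using that by (simp add: \<A>_functor_simps \<A>_ob_eq \<A>_ob_bialgebra)
  show "ar (\<A>_functor \<M> S C) (Ident CM (P, d)) = Ident HM (ob (\<A>_functor \<M> S C) (P, d))"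
    if "(P, d) \<in> Ob CM"
    using that by (simp add: \<A>_functor_simps \<A>_ob_eq G.coalgebraD(1))
next
  fix v f w P d Q b
  assume "(v, f, w) \<in> hom CM (P, d) (Q, b)"
  then obtain "v = (P, d)" "w = (Q, b)" and f: "G.coalgebra P d" "G.coalgebra Q b"
    "G.coalgebra_hom P d f Q b" by (rule CM_homE) simp
  moreover have "f \<in> hom \<M> P Q" using G.coalgebra_homD[OF f(3)] by (simp add: hom_iff)
  ultimately show "ar (\<A>_functor \<M> S C) (v, f, w)
      \<in> hom HM (ob (\<A>_functor \<M> S C) (P, d)) (ob (\<A>_functor \<M> S C) (Q, b))"
    by (simp add: \<A>_functor_simps \<A>_ob_eq HM.hom_iff \<A>_ob_bialgebra free_algebra_hom free_coalgebra_hom)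
next
  fix v f w P d Q b v' g w' R r
  assume "(v, f, w) \<in> hom CM (P, d) (Q, b)" "(v', g, w') \<in> hom CM (Q, b) (R, r)"
  then obtain "v = (P, d)" "w = (Q, b)" "v' = (Q, b)" "w' = (R, r)"
    and f: "G.coalgebra_hom P d f Q b" and g: "G.coalgebra_hom Q b g R r"
    by (elim CM_homE) simp
  then show "ar (\<A>_functor \<M> S C) ((v', g, w') \<bullet>\<^bsub>CM\<^esub> (v, f, w))
      = ar (\<A>_functor \<M> S C) (v', g, w') \<bullet>\<^bsub>HM\<^esub> ar (\<A>_functor \<M> S C) (v, f, w)"
    using G.coalgebra_homD(1-3)[OF f] G.coalgebra_homD(1-3)[OF g] by (simp add: \<A>_functor_simps)
qed

lemma cofree_eq: "cofree \<M> C P = (ob G P, \<delta> P)"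
  by (simp add: cofree_def hat_simps)

lemma \<B>_pair_eq:
  "\<B>_left \<C> \<M> T C (P, \<sigma>, \<zeta>) = ((ob G P, \<delta> P), ar G (\<iota>C P) \<bullet> \<delta> P, (ob G (ob K P), \<delta> (ob K P)))"
  "\<B>_right \<C> \<M> T C (P, \<sigma>, \<zeta>) = ((ob G P, \<delta> P), ar G \<zeta>, (ob G (ob K P), \<delta> (ob K P)))"
  by (simp_all add: \<B>_left_def \<B>_right_def cofree_eq hat_simps)

lemma coinvariants_equalizer:
  assumes y: "coinvariants P \<sigma> \<zeta> N d e"
  shows "is_equalizer CM (\<B>_left \<C> \<M> T C (P, \<sigma>, \<zeta>)) (\<B>_right \<C> \<M> T C (P, \<sigma>, \<zeta>))
    ((N, d), e, (ob G P, \<delta> P))"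
  unfolding \<B>_pair_eq
proof (rule CM.is_equalizerI)
  note b = bialgebraD[OF coinvariantsD(1)[OF y]]
  note [simp] = coinvariantsD(2,3)[OF y]
  have [simp]: "P \<in> Ob \<M>" using K.coalgebraD(1)[OF b(2)] .
  show "((ob G P, \<delta> P), ar G (\<iota>C P) \<bullet> \<delta> P, (ob G (ob K P), \<delta> (ob K P))) \<in> Arr CM"
    "((ob G P, \<delta> P), ar G \<zeta>, (ob G (ob K P), \<delta> (ob K P))) \<in> Arr CM"
    "((N, d), e, (ob G P, \<delta> P)) \<in> Arr CM"
    using pair_hom[OF b(2)] by (simp_all add: G.cofree_coalgebra)
  show "((ob G P, \<delta> P), ar G (\<iota>C P) \<bullet> \<delta> P, (ob G (ob K P), \<delta> (ob K P))) \<bullet>\<^bsub>CM\<^esub> ((N, d), e, (ob G P, \<delta> P))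
      = ((ob G P, \<delta> P), ar G \<zeta>, (ob G (ob K P), \<delta> (ob K P))) \<bullet>\<^bsub>CM\<^esub> ((N, d), e, (ob G P, \<delta> P))"
    using equalizer_type(7)[OF coinvariantsD(4)[OF y]] by simp
next
  fix t
  assume t: "t \<in> Arr CM"
    "Cod CM t = Dom CM ((ob G P, \<delta> P), ar G (\<iota>C P) \<bullet> \<delta> P, (ob G (ob K P), \<delta> (ob K P)))"
    "((ob G P, \<delta> P), ar G (\<iota>C P) \<bullet> \<delta> P, (ob G (ob K P), \<delta> (ob K P))) \<bullet>\<^bsub>CM\<^esub> t
      = ((ob G P, \<delta> P), ar G \<zeta>, (ob G (ob K P), \<delta> (ob K P))) \<bullet>\<^bsub>CM\<^esub> t"
  obtain X x h w where t_eq: "t = ((X, x), h, w)" by (cases t) auto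
  with t(1,2) have w: "w = (ob G P, \<delta> P)" and X: "G.coalgebra X x"
    and h: "G.coalgebra_hom X x h (ob G P) (\<delta> P)" by auto
  have eq: "(ar G (\<iota>C P) \<bullet> \<delta> P) \<bullet> h = ar G \<zeta> \<bullet> h" using t(3) by (simp add: t_eq)
  from coinvariants_factor[OF hat_preserves y X h eq] obtain k
    where "G.coalgebra_hom X x k N d" "e \<bullet> k = h" by blast
  then show "\<exists>k \<in> hom CM (Dom CM t) (Dom CM ((N, d), e, (ob G P, \<delta> P))).
      ((N, d), e, (ob G P, \<delta> P)) \<bullet>\<^bsub>CM\<^esub> k = t"
    by (intro bexI[of _ "((X, x), k, (N, d))"]) (simp_all add: t_eq w X CM.hom_iff coinvariantsD(2)[OF y])
next
  fix s t
  assume "s \<in> Arr CM" "t \<in> Arr CM" "Dom CM s = Dom CM t"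
    "Cod CM s = Dom CM ((N, d), e, (ob G P, \<delta> P))" "Cod CM t = Dom CM ((N, d), e, (ob G P, \<delta> P))"
    "((N, d), e, (ob G P, \<delta> P)) \<bullet>\<^bsub>CM\<^esub> s = ((N, d), e, (ob G P, \<delta> P)) \<bullet>\<^bsub>CM\<^esub> t"
  then obtain X x k l where s: "s = ((X, x), k, (N, d))" "t = ((X, x), l, (N, d))"
    and kl: "G.coalgebra_hom X x k N d" "G.coalgebra_hom X x l N d" "e \<bullet> k = e \<bullet> l"
    by (cases s; cases t) auto
  have "k = l" by (rule coinvariants_mono[OF y kl])
  then show "s = t" by (simp add: s)
qed simp_all

text \<open>
  The chosen equalizer is specified among comodules only, whereas \<open>S\<close> preserves equalizers in \<open>\<M>\<close>. It is
  isomorphic to an equalizer lifted from \<open>\<M>\<close>, so its underlying arrow is an equalizer in \<open>\<M>\<close> as well.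
\<close>

lemma \<B>_eq_coinvariants:
  assumes y: "bialgebra P \<sigma> \<zeta>"
  obtains N d e where "\<B>_eq \<C> \<M> T C (P, \<sigma>, \<zeta>) = ((N, d), e, (ob G P, \<delta> P))"
    and "\<B>_ob \<C> \<M> T C (P, \<sigma>, \<zeta>) = (N, d)" and "coinvariants P \<sigma> \<zeta> N d e"
proof -
  from coinvariants_exist[OF has_equalizers hat_preserves y] obtain N0 d0 e0
    where 0: "coinvariants P \<sigma> \<zeta> N0 d0 e0" .
  let ?L = "\<B>_left \<C> \<M> T C (P, \<sigma>, \<zeta>)" and ?R = "\<B>_right \<C> \<M> T C (P, \<sigma>, \<zeta>)"
  let ?B = "\<B>_eq \<C> \<M> T C (P, \<sigma>, \<zeta>)" and ?F = "((N0, d0), e0, (ob G P, \<delta> P))"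
  note eq0 = coinvariants_equalizer[OF 0]
  then have eq: "is_equalizer CM ?L ?R ?B" unfolding \<B>_eq_def by (rule someI)
  note t = CM.equalizer_type[OF eq] and t0 = CM.equalizer_type[OF eq0]
  obtain N d e w where "?B = ((N, d), e, w)" by (cases ?B) auto
  then have B: "?B = ((N, d), e, (ob G P, \<delta> P))" using t(6) by (simp add: \<B>_pair_eq)
  have Nd: "G.coalgebra N d" "G.coalgebra_hom N d e (ob G P) (\<delta> P)" using t(3) by (simp_all add: B)
  from CM.equalizer_factor[OF eq0 t(3,6,7)] obtain k
    where k: "k \<in> Arr CM" "Dom CM k = Dom CM ?B" "Cod CM k = Dom CM ?F" "?F \<bullet>\<^bsub>CM\<^esub> k = ?B" .
  from CM.equalizer_factor[OF eq t0(3,6,7)] obtain l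
    where l: "l \<in> Arr CM" "Dom CM l = Dom CM ?F" "Cod CM l = Dom CM ?B" "?B \<bullet>\<^bsub>CM\<^esub> l = ?F" .
  have Ob: "Dom CM ?B \<in> Ob CM" "Dom CM ?F \<in> Ob CM"
    using CM.Dom_Ob[OF t(3)] CM.Dom_Ob[OF t0(3)] by blast+
  have kl: "k \<bullet>\<^bsub>CM\<^esub> l = Ident CM (Dom CM ?F)"
  proof (rule CM.equalizer_mono[OF eq0])
    show "?F \<bullet>\<^bsub>CM\<^esub> (k \<bullet>\<^bsub>CM\<^esub> l) = ?F \<bullet>\<^bsub>CM\<^esub> Ident CM (Dom CM ?F)"
      using k l t0(3) Ob by (simp add: CM.Comp_assoc_arr[symmetric] del: CM_simps)
  qed (use k l Ob in \<open>simp_all del: CM_simps\<close>)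
  have lk: "l \<bullet>\<^bsub>CM\<^esub> k = Ident CM (Dom CM ?B)"
  proof (rule CM.equalizer_mono[OF eq])
    show "?B \<bullet>\<^bsub>CM\<^esub> (l \<bullet>\<^bsub>CM\<^esub> k) = ?B \<bullet>\<^bsub>CM\<^esub> Ident CM (Dom CM ?B)"
      using k l t(3) Ob by (simp add: CM.Comp_assoc_arr[symmetric] del: CM_simps)
  qed (use k l Ob in \<open>simp_all del: CM_simps\<close>)
  obtain k1 k' k2 where "k = (k1, k', k2)" by (cases k)
  then have k': "k = ((N, d), k', (N0, d0))" using k(2,3) by (simp add: B)
  obtain l1 l' l2 where "l = (l1, l', l2)" by (cases l)
  then have l': "l = ((N0, d0), l', (N, d))" using l(2,3) by (simp add: B)
  have kM: "k' \<in> Arr \<M>" "Dom \<M> k' = N" "Cod \<M> k' = N0" and lM: "l' \<in> Arr \<M>" "Dom \<M> l' = N0" "Cod \<M> l' = N"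
    using k(1) l(1) G.coalgebra_homD(1-3)[of N d k' N0 d0] G.coalgebra_homD(1-3)[of N0 d0 l' N d]
    by (simp_all add: k' l')
  have "is_iso \<M> k'"
    by (rule is_isoI[of _ l']) (use kl lk kM lM in \<open>simp_all add: k' l' B\<close>)
  moreover have "e0 \<bullet> k' = e" using k(4) by (simp add: k' B)
  moreover have "Dom \<M> e0 = N0" using G.coalgebra_homD[OF coinvariantsD(3)[OF 0]] by simp
  ultimately have "is_equalizer \<M> (ar G (\<iota>C P) \<bullet> \<delta> P) (ar G \<zeta>) e"
    using equalizer_Comp_iso[OF coinvariantsD(4)[OF 0], of k'] kM by simp
  then have "coinvariants P \<sigma> \<zeta> N d e" using y Nd by (simp add: coinvariants_def)
  with B show ?thesis by (intro that) (simp_all add: \<B>_ob_def)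
qed

text \<open>Evaluates the definite descriptions by which \<open>\<B>\<close> on arrows and the unit are defined.\<close>

lemma the_factor:
  assumes y: "coinvariants P \<sigma> \<zeta> N d e" and X: "G.coalgebra X x" and k: "G.coalgebra_hom X x k N d"
  shows "(THE l. l \<in> hom CM (X, x) (N, d) \<and>
    ((N, d), e, (ob G P, \<delta> P)) \<bullet>\<^bsub>CM\<^esub> l = ((X, x), e \<bullet> k, (ob G P, \<delta> P))) = ((X, x), k, (N, d))"
proof (rule the_equality)
  show "((X, x), k, (N, d)) \<in> hom CM (X, x) (N, d) \<and>
    ((N, d), e, (ob G P, \<delta> P)) \<bullet>\<^bsub>CM\<^esub> ((X, x), k, (N, d)) = ((X, x), e \<bullet> k, (ob G P, \<delta> P))"
    by (simp add: CM.hom_iff X k coinvariantsD(2)[OF y])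
next
  fix l assume l: "l \<in> hom CM (X, x) (N, d) \<and>
    ((N, d), e, (ob G P, \<delta> P)) \<bullet>\<^bsub>CM\<^esub> l = ((X, x), e \<bullet> k, (ob G P, \<delta> P))"
  then obtain l' where l': "l = ((X, x), l', (N, d))" "G.coalgebra_hom X x l' N d"
    by (auto elim: CM_homE)
  have el: "e \<bullet> l' = e \<bullet> k" using l by (simp add: l'(1))
  have "l' = k" by (rule coinvariants_mono[OF y l'(2) k el])
  then show "l = ((X, x), k, (N, d))" by (simp add: l'(1))
qed

lemma \<B>_arrow:
  assumes f: "bialgebra P \<sigma> \<zeta>" "bialgebra Q \<tau> \<xi>" "K.coalgebra_hom P \<zeta> f Q \<xi>"
    and B: "\<B>_eq \<C> \<M> T C (P, \<sigma>, \<zeta>) = ((N, d), e, (ob G P, \<delta> P))" "coinvariants P \<sigma> \<zeta> N d e"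
    and B': "\<B>_eq \<C> \<M> T C (Q, \<tau>, \<xi>) = ((N', d'), e', (ob G Q, \<delta> Q))" "coinvariants Q \<tau> \<xi> N' d' e'"
  obtains k where "ar (\<B>_functor \<C> \<M> T C) ((P, \<sigma>, \<zeta>), f, (Q, \<tau>, \<xi>)) = ((N, d), k, (N', d'))"
    and "G.coalgebra_hom N d k N' d'" and "e' \<bullet> k = ar G f \<bullet> e"
proof -
  from coinvariants_factor[OF hat_preserves B'(2) coinvariantsD(2)[OF B(2)] coinvariants_map[OF B(2) f(2,3)]]
  obtain k where k: "G.coalgebra_hom N d k N' d'" "e' \<bullet> k = ar G f \<bullet> e" by blast
  have "ar (\<B>_functor \<C> \<M> T C) ((P, \<sigma>, \<zeta>), f, (Q, \<tau>, \<xi>)) = ((N, d), k, (N', d'))"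
    using the_factor[OF B'(2) coinvariantsD(2)[OF B(2)] k(1)]
    by (simp add: \<B>_functor_def \<B>_ob_def B(1) B'(1) k(2) cofree_eq hat_simps)
  with k that show ?thesis by blast
qed

lemma \<A>\<B>_unit_arrow:
  assumes P: "G.coalgebra P d"
    and B: "\<B>_eq \<C> \<M> T C (\<A>_ob \<M> S C (P, d)) = ((N, d'), e, (ob G (ob S P), \<delta> (ob S P)))"
      "coinvariants (ob S P) (mu S P) (law P \<bullet> ar S (\<iota>C P \<bullet> d)) N d' e"
  obtains k where "\<A>\<B>_unit \<C> \<M> T S C (P, d) = ((P, d), k, (N, d'))"
    and "G.coalgebra_hom P d k N d'" and "e \<bullet> k = ar G (iota S P) \<bullet> d"
proof -
  have i: "iota S P \<in> hom \<M> P (ob S P)" using G.coalgebraD(1)[OF P] by (simp add: hom_iff)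
  from coinvariants_factor[OF hat_preserves B(2) P G.hom_into_cofree[OF P i] unit_fork[OF P]]
  obtain k where k: "G.coalgebra_hom P d k N d'" "e \<bullet> k = ar G (iota S P) \<bullet> d" by blast
  have "\<A>\<B>_unit \<C> \<M> T S C (P, d) = ((P, d), k, (N, d'))"
    using the_factor[OF B(2) P k(1)]
    by (simp add: \<A>\<B>_unit_def \<B>_ob_def B(1) k(2) cofree_eq hat_simps)
  with k that show ?thesis by blast
qed

lemma \<A>\<B>_counit_eq:
  assumes B: "\<B>_eq \<C> \<M> T C (P, \<sigma>, \<zeta>) = ((N, d), e, (ob G P, \<delta> P))"
  shows "\<A>\<B>_counit \<C> \<M> T S C (P, \<sigma>, \<zeta>) = (\<A>_ob \<M> S C (N, d), evaluation P \<sigma> e, (P, \<sigma>, \<zeta>))"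
  by (simp add: \<A>\<B>_counit_def \<B>_ob_def B evaluation_def)

section \<open>The adjunction and the equivalence\<close>

lemma \<B>_functor_ob: "ob (\<B>_functor \<C> \<M> T C) = \<B>_ob \<C> \<M> T C"
  by (simp add: \<B>_functor_def)

text \<open>
  Here and below, arrows with values in coinvariants are compared after composition with the monomorphism \<open>e\<close>.
\<close>

lemma \<B>_cat_functor: "cat_functor HM CM (\<B>_functor \<C> \<M> T C)"
proof (unfold_locales, simp_all only: split_paired_all)
  fix P \<sigma> \<zeta>
  assume "(P, \<sigma>, \<zeta>) \<in> Ob HM"
  then have y: "bialgebra P \<sigma> \<zeta>" by simp
  from \<B>_eq_coinvariants[OF y] obtain N d e where
    B: "\<B>_eq \<C> \<M> T C (P, \<sigma>, \<zeta>) = ((N, d), e, (ob G P, \<delta> P))" "\<B>_ob \<C> \<M> T C (P, \<sigma>, \<zeta>) = (N, d)"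
      "coinvariants P \<sigma> \<zeta> N d e" .
  show "ob (\<B>_functor \<C> \<M> T C) (P, \<sigma>, \<zeta>) \<in> Ob CM"
    by (simp add: \<B>_functor_ob B coinvariantsD(2)[OF B(3)])
  have P: "P \<in> Ob \<M>" using K.coalgebraD(1)[OF bialgebraD(2)[OF y]] .
  from \<B>_arrow[OF y y K.coalgebra_hom_Ident[OF bialgebraD(2)[OF y]] B(1,3) B(1,3)]
  obtain k where k: "ar (\<B>_functor \<C> \<M> T C) ((P, \<sigma>, \<zeta>), Ident \<M> P, (P, \<sigma>, \<zeta>)) = ((N, d), k, (N, d))"
    "G.coalgebra_hom N d k N d" "e \<bullet> k = ar G (Ident \<M> P) \<bullet> e" .
  have "k = Ident \<M> N"
    by (rule coinvariants_mono[OF B(3) k(2) G.coalgebra_hom_Ident[OF coinvariantsD(2)[OF B(3)]]])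
      (simp add: k(3) P G.coalgebra_homD(1-3)[OF coinvariantsD(3)[OF B(3)]])
  then show "ar (\<B>_functor \<C> \<M> T C) (Ident HM (P, \<sigma>, \<zeta>)) = Ident CM (ob (\<B>_functor \<C> \<M> T C) (P, \<sigma>, \<zeta>))"
    by (simp add: \<B>_functor_ob B k(1))
next
  fix x f y P \<sigma> \<zeta> Q \<tau> \<xi>
  assume "(x, f, y) \<in> hom HM (P, \<sigma>, \<zeta>) (Q, \<tau>, \<xi>)"
  then obtain xy: "x = (P, \<sigma>, \<zeta>)" "y = (Q, \<tau>, \<xi>)"
    and f: "bialgebra P \<sigma> \<zeta>" "bialgebra Q \<tau> \<xi>" "K.coalgebra_hom P \<zeta> f Q \<xi>" by (rule HM_homE) simp
  from \<B>_eq_coinvariants[OF f(1)] obtain N d e where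
    B: "\<B>_eq \<C> \<M> T C (P, \<sigma>, \<zeta>) = ((N, d), e, (ob G P, \<delta> P))" "\<B>_ob \<C> \<M> T C (P, \<sigma>, \<zeta>) = (N, d)"
      "coinvariants P \<sigma> \<zeta> N d e" .
  from \<B>_eq_coinvariants[OF f(2)] obtain N' d' e' where
    B': "\<B>_eq \<C> \<M> T C (Q, \<tau>, \<xi>) = ((N', d'), e', (ob G Q, \<delta> Q))" "\<B>_ob \<C> \<M> T C (Q, \<tau>, \<xi>) = (N', d')"
      "coinvariants Q \<tau> \<xi> N' d' e'" .
  from \<B>_arrow[OF f B(1,3) B'(1,3)]
  obtain k where k: "ar (\<B>_functor \<C> \<M> T C) ((P, \<sigma>, \<zeta>), f, (Q, \<tau>, \<xi>)) = ((N, d), k, (N', d'))"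
    "G.coalgebra_hom N d k N' d'" "e' \<bullet> k = ar G f \<bullet> e" .
  show "ar (\<B>_functor \<C> \<M> T C) (x, f, y)
      \<in> hom CM (ob (\<B>_functor \<C> \<M> T C) (P, \<sigma>, \<zeta>)) (ob (\<B>_functor \<C> \<M> T C) (Q, \<tau>, \<xi>))"
    by (simp add: \<B>_functor_ob xy B(2) B'(2) k(1,2) CM.hom_iff coinvariantsD(2)[OF B(3)] coinvariantsD(2)[OF B'(3)])
next
  fix x f y x' g z P \<sigma> \<zeta> Q \<tau> \<xi> R \<rho> \<omega>
  assume "(x, f, y) \<in> hom HM (P, \<sigma>, \<zeta>) (Q, \<tau>, \<xi>)" "(x', g, z) \<in> hom HM (Q, \<tau>, \<xi>) (R, \<rho>, \<omega>)"
  then obtain xy: "x = (P, \<sigma>, \<zeta>)" "y = (Q, \<tau>, \<xi>)" "x' = (Q, \<tau>, \<xi>)" "z = (R, \<rho>, \<omega>)"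
    and b: "bialgebra P \<sigma> \<zeta>" "bialgebra Q \<tau> \<xi>" "bialgebra R \<rho> \<omega>"
    and f: "K.coalgebra_hom P \<zeta> f Q \<xi>" and g: "K.coalgebra_hom Q \<xi> g R \<omega>" by (elim HM_homE) simp
  from \<B>_eq_coinvariants[OF b(1)] obtain N d e where
    B: "\<B>_eq \<C> \<M> T C (P, \<sigma>, \<zeta>) = ((N, d), e, (ob G P, \<delta> P))" "\<B>_ob \<C> \<M> T C (P, \<sigma>, \<zeta>) = (N, d)"
      "coinvariants P \<sigma> \<zeta> N d e" .
  from \<B>_eq_coinvariants[OF b(2)] obtain N' d' e' where
    B': "\<B>_eq \<C> \<M> T C (Q, \<tau>, \<xi>) = ((N', d'), e', (ob G Q, \<delta> Q))" "\<B>_ob \<C> \<M> T C (Q, \<tau>, \<xi>) = (N', d')"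
      "coinvariants Q \<tau> \<xi> N' d' e'" .
  from \<B>_eq_coinvariants[OF b(3)] obtain N'' d'' e'' where
    B'': "\<B>_eq \<C> \<M> T C (R, \<rho>, \<omega>) = ((N'', d''), e'', (ob G R, \<delta> R))" "\<B>_ob \<C> \<M> T C (R, \<rho>, \<omega>) = (N'', d'')"
      "coinvariants R \<rho> \<omega> N'' d'' e''" .
  from \<B>_arrow[OF b(1,2) f B(1,3) B'(1,3)]
  obtain k where k: "ar (\<B>_functor \<C> \<M> T C) ((P, \<sigma>, \<zeta>), f, (Q, \<tau>, \<xi>)) = ((N, d), k, (N', d'))"
    "G.coalgebra_hom N d k N' d'" "e' \<bullet> k = ar G f \<bullet> e" .
  from \<B>_arrow[OF b(2,3) g B'(1,3) B''(1,3)]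
  obtain l where l: "ar (\<B>_functor \<C> \<M> T C) ((Q, \<tau>, \<xi>), g, (R, \<rho>, \<omega>)) = ((N', d'), l, (N'', d''))"
    "G.coalgebra_hom N' d' l N'' d''" "e'' \<bullet> l = ar G g \<bullet> e'" .
  have gf: "K.coalgebra_hom P \<zeta> (g \<bullet> f) R \<omega>"
    by (rule K.coalgebra_hom_Comp[OF bialgebraD(2)[OF b(1)] bialgebraD(2)[OF b(2)] bialgebraD(2)[OF b(3)] f g])
  from \<B>_arrow[OF b(1,3) gf B(1,3) B''(1,3)]
  obtain m where m: "ar (\<B>_functor \<C> \<M> T C) ((P, \<sigma>, \<zeta>), g \<bullet> f, (R, \<rho>, \<omega>)) = ((N, d), m, (N'', d''))"
    "G.coalgebra_hom N d m N'' d''" "e'' \<bullet> m = ar G (g \<bullet> f) \<bullet> e" .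
  note [simp] = G.coalgebra_homD(1-3)[OF k(2)] G.coalgebra_homD(1-3)[OF l(2)]
    G.coalgebra_homD(1-3)[OF m(2)] K.coalgebra_homD(1-3)[OF f] K.coalgebra_homD(1-3)[OF g]
    G.coalgebra_homD(1-3)[OF coinvariantsD(3)[OF B(3)]] G.coalgebra_homD(1-3)[OF coinvariantsD(3)[OF B'(3)]]
    G.coalgebra_homD(1-3)[OF coinvariantsD(3)[OF B''(3)]]
  have "m = l \<bullet> k"
  proof (rule coinvariants_mono[OF B''(3) m(2) G.coalgebra_hom_Comp[OF coinvariantsD(2)[OF B(3)]
      coinvariantsD(2)[OF B'(3)] coinvariantsD(2)[OF B''(3)] k(2) l(2)]])
    show "e'' \<bullet> m = e'' \<bullet> (l \<bullet> k)"
      by (simp add: m(3) Comp_reduce[OF l(3)] Comp_assoc_arr k(3))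
  qed
  then show "ar (\<B>_functor \<C> \<M> T C) ((x', g, z) \<bullet>\<^bsub>HM\<^esub> (x, f, y))
      = ar (\<B>_functor \<C> \<M> T C) (x', g, z) \<bullet>\<^bsub>CM\<^esub> ar (\<B>_functor \<C> \<M> T C) (x, f, y)"
    by (simp add: xy k(1) l(1) m(1))
qed

lemma unit_natural: "natural_transformation CM CM id_functor
    (comp_functor (\<B>_functor \<C> \<M> T C) (\<A>_functor \<M> S C)) (\<A>\<B>_unit \<C> \<M> T S C)"
proof (intro natural_transformation.intro CM.cat_functor_id
    cat_functor_comp[OF \<A>_cat_functor \<B>_cat_functor] natural_transformation_axioms.intro,
    simp_all only: split_paired_all)
  fix P d
  assume "(P, d) \<in> Ob CM"
  then have P: "G.coalgebra P d" by simp
  from \<B>_eq_coinvariants[OF \<A>_ob_bialgebra[OF P], folded \<A>_ob_eq[OF P]] obtain N b e where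
    B: "\<B>_eq \<C> \<M> T C (\<A>_ob \<M> S C (P, d)) = ((N, b), e, (ob G (ob S P), \<delta> (ob S P)))"
      "\<B>_ob \<C> \<M> T C (\<A>_ob \<M> S C (P, d)) = (N, b)"
      "coinvariants (ob S P) (mu S P) (law P \<bullet> ar S (\<iota>C P \<bullet> d)) N b e" .
  from \<A>\<B>_unit_arrow[OF P B(1,3)] obtain k where
    k: "\<A>\<B>_unit \<C> \<M> T S C (P, d) = ((P, d), k, (N, b))" "G.coalgebra_hom P d k N b"
      "e \<bullet> k = ar G (iota S P) \<bullet> d" .
  show "\<A>\<B>_unit \<C> \<M> T S C (P, d) \<in> hom CM (ob id_functor (P, d))
      (ob (comp_functor (\<B>_functor \<C> \<M> T C) (\<A>_functor \<M> S C)) (P, d))"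
    by (simp add: \<A>_functor_simps \<B>_functor_ob B(2) k CM.hom_iff P coinvariantsD(2)[OF B(3)])
next
  fix x f y P d Q b
  assume "(x, f, y) \<in> hom CM (P, d) (Q, b)"
  then obtain xy: "x = (P, d)" "y = (Q, b)" and P: "G.coalgebra P d" and Q: "G.coalgebra Q b"
    and f: "G.coalgebra_hom P d f Q b" by (rule CM_homE) simp
  note Pb = \<A>_ob_bialgebra[OF P] and Qb = \<A>_ob_bialgebra[OF Q]
  from \<B>_eq_coinvariants[OF Pb] obtain N n e where
    B: "\<B>_eq \<C> \<M> T C (ob S P, mu S P, law P \<bullet> ar S (\<iota>C P \<bullet> d)) = ((N, n), e, (ob G (ob S P), \<delta> (ob S P)))"
      "\<B>_ob \<C> \<M> T C (ob S P, mu S P, law P \<bullet> ar S (\<iota>C P \<bullet> d)) = (N, n)"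
      "coinvariants (ob S P) (mu S P) (law P \<bullet> ar S (\<iota>C P \<bullet> d)) N n e" .
  from \<B>_eq_coinvariants[OF Qb] obtain N' n' e' where
    B': "\<B>_eq \<C> \<M> T C (ob S Q, mu S Q, law Q \<bullet> ar S (\<iota>C Q \<bullet> b)) = ((N', n'), e', (ob G (ob S Q), \<delta> (ob S Q)))"
      "\<B>_ob \<C> \<M> T C (ob S Q, mu S Q, law Q \<bullet> ar S (\<iota>C Q \<bullet> b)) = (N', n')"
      "coinvariants (ob S Q) (mu S Q) (law Q \<bullet> ar S (\<iota>C Q \<bullet> b)) N' n' e'" .
  from \<A>\<B>_unit_arrow[OF P B(1)[folded \<A>_ob_eq[OF P]] B(3)] obtain k where
    k: "\<A>\<B>_unit \<C> \<M> T S C (P, d) = ((P, d), k, (N, n))" "G.coalgebra_hom P d k N n"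
      "e \<bullet> k = ar G (iota S P) \<bullet> d" .
  from \<A>\<B>_unit_arrow[OF Q B'(1)[folded \<A>_ob_eq[OF Q]] B'(3)] obtain l where
    l: "\<A>\<B>_unit \<C> \<M> T S C (Q, b) = ((Q, b), l, (N', n'))" "G.coalgebra_hom Q b l N' n'"
      "e' \<bullet> l = ar G (iota S Q) \<bullet> b" .
  from \<B>_arrow[OF Pb Qb free_coalgebra_hom[OF P Q f] B(1,3) B'(1,3)] obtain m where
    m: "ar (\<B>_functor \<C> \<M> T C) ((ob S P, mu S P, law P \<bullet> ar S (\<iota>C P \<bullet> d)), ar S f,
        (ob S Q, mu S Q, law Q \<bullet> ar S (\<iota>C Q \<bullet> b))) = ((N, n), m, (N', n'))"
      "G.coalgebra_hom N n m N' n'" "e' \<bullet> m = ar G (ar S f) \<bullet> e" .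
  note [simp] = G.coalgebra_homD(1-3)[OF k(2)] G.coalgebra_homD(1-3)[OF l(2)]
    G.coalgebra_homD(1-3)[OF m(2)] G.coalgebra_homD(1-3)[OF f] G.coalgebraD(1-4)[OF P] G.coalgebraD(1-4)[OF Q]
    G.coalgebra_homD(1-3)[OF coinvariantsD(3)[OF B(3)]] G.coalgebra_homD(1-3)[OF coinvariantsD(3)[OF B'(3)]]
  have "l \<bullet> f = m \<bullet> k"
  proof (rule coinvariants_mono[OF B'(3)])
    show "G.coalgebra_hom P d (l \<bullet> f) N' n'"
      by (rule G.coalgebra_hom_Comp[OF P Q coinvariantsD(2)[OF B'(3)] f l(2)])
    show "G.coalgebra_hom P d (m \<bullet> k) N' n'"
      by (rule G.coalgebra_hom_Comp[OF P coinvariantsD(2)[OF B(3)] coinvariantsD(2)[OF B'(3)] k(2) m(2)])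
    have "e' \<bullet> (l \<bullet> f) = ar G (iota S Q) \<bullet> (b \<bullet> f)"
      by (simp add: Comp_reduce[OF l(3)] Comp_assoc_arr)
    also have "\<dots> = ar G (iota S Q) \<bullet> (ar G f \<bullet> d)" by (simp add: G.coalgebra_homD(4)[OF f])
    also have "\<dots> = ar G (ar S f) \<bullet> (ar G (iota S P) \<bullet> d)"
      using G.endo.ar_eq[OF iota_natural_arr[of f Q]]
        Comp_reduce[OF G.endo.ar_eq[OF iota_natural_arr[of f Q]], of d] by (simp add: Comp_assoc_arr)
    also have "\<dots> = e' \<bullet> (m \<bullet> k)"
      by (simp add: Comp_reduce[OF m(3)] Comp_assoc_arr k(3))
    finally show "e' \<bullet> (l \<bullet> f) = e' \<bullet> (m \<bullet> k)" .
  qed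
  then show "\<A>\<B>_unit \<C> \<M> T S C (Q, b) \<bullet>\<^bsub>CM\<^esub> ar id_functor (x, f, y)
      = ar (comp_functor (\<B>_functor \<C> \<M> T C) (\<A>_functor \<M> S C)) (x, f, y) \<bullet>\<^bsub>CM\<^esub> \<A>\<B>_unit \<C> \<M> T S C (P, d)"
    by (simp add: xy \<A>_functor_simps \<A>_ob_eq P Q k(1) l(1) m(1))
qed

lemma counit_natural: "natural_transformation HM HM
    (comp_functor (\<A>_functor \<M> S C) (\<B>_functor \<C> \<M> T C)) id_functor (\<A>\<B>_counit \<C> \<M> T S C)"
proof (intro natural_transformation.intro HM.cat_functor_id
    cat_functor_comp[OF \<B>_cat_functor \<A>_cat_functor] natural_transformation_axioms.intro,
    simp_all only: split_paired_all)
  fix P \<sigma> \<zeta>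
  assume "(P, \<sigma>, \<zeta>) \<in> Ob HM"
  then have y: "bialgebra P \<sigma> \<zeta>" by simp
  from \<B>_eq_coinvariants[OF y] obtain N d e where
    B: "\<B>_eq \<C> \<M> T C (P, \<sigma>, \<zeta>) = ((N, d), e, (ob G P, \<delta> P))" "\<B>_ob \<C> \<M> T C (P, \<sigma>, \<zeta>) = (N, d)"
      "coinvariants P \<sigma> \<zeta> N d e" .
  note N = coinvariantsD(2)[OF B(3)]
  show "\<A>\<B>_counit \<C> \<M> T S C (P, \<sigma>, \<zeta>)
      \<in> hom HM (ob (comp_functor (\<A>_functor \<M> S C) (\<B>_functor \<C> \<M> T C)) (P, \<sigma>, \<zeta>)) (ob id_functor (P, \<sigma>, \<zeta>))"
    using evaluation_algebra_hom[OF B(3)] evaluation_coalgebra_hom[OF B(3)] y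
    by (simp add: \<A>\<B>_counit_eq[OF B(1)] \<A>_functor_simps \<B>_functor_ob B(2) HM.hom_iff
      \<A>_ob_eq[OF N] \<A>_ob_bialgebra[OF N])
next
  fix x f y P \<sigma> \<zeta> Q \<tau> \<xi>
  assume "(x, f, y) \<in> hom HM (P, \<sigma>, \<zeta>) (Q, \<tau>, \<xi>)"
  then obtain xy: "x = (P, \<sigma>, \<zeta>)" "y = (Q, \<tau>, \<xi>)" and a: "algebra_hom P \<sigma> f Q \<tau>"
    and f: "bialgebra P \<sigma> \<zeta>" "bialgebra Q \<tau> \<xi>" "K.coalgebra_hom P \<zeta> f Q \<xi>" by (rule HM_homE) simp
  from \<B>_eq_coinvariants[OF f(1)] obtain N d e where
    B: "\<B>_eq \<C> \<M> T C (P, \<sigma>, \<zeta>) = ((N, d), e, (ob G P, \<delta> P))" "\<B>_ob \<C> \<M> T C (P, \<sigma>, \<zeta>) = (N, d)"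
      "coinvariants P \<sigma> \<zeta> N d e" .
  from \<B>_eq_coinvariants[OF f(2)] obtain N' d' e' where
    B': "\<B>_eq \<C> \<M> T C (Q, \<tau>, \<xi>) = ((N', d'), e', (ob G Q, \<delta> Q))" "\<B>_ob \<C> \<M> T C (Q, \<tau>, \<xi>) = (N', d')"
      "coinvariants Q \<tau> \<xi> N' d' e'" .
  from \<B>_arrow[OF f B(1,3) B'(1,3)]
  obtain k where k: "ar (\<B>_functor \<C> \<M> T C) ((P, \<sigma>, \<zeta>), f, (Q, \<tau>, \<xi>)) = ((N, d), k, (N', d'))"
    "G.coalgebra_hom N d k N' d'" "e' \<bullet> k = ar G f \<bullet> e" .
  have "k \<in> hom \<M> N N'" using G.coalgebra_homD[OF k(2)] by (simp add: hom_iff)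
  from evaluation_natural[OF B(3) B'(3) a this k(3)]
  show "\<A>\<B>_counit \<C> \<M> T S C (Q, \<tau>, \<xi>)
        \<bullet>\<^bsub>HM\<^esub> ar (comp_functor (\<A>_functor \<M> S C) (\<B>_functor \<C> \<M> T C)) (x, f, y)
      = ar id_functor (x, f, y) \<bullet>\<^bsub>HM\<^esub> \<A>\<B>_counit \<C> \<M> T S C (P, \<sigma>, \<zeta>)"
    by (simp add: xy \<A>\<B>_counit_eq[OF B(1)] \<A>\<B>_counit_eq[OF B'(1)] k(1) \<A>_functor_simps)
qed

lemma adjunction: "adjunction CM HM (\<A>_functor \<M> S C) (\<B>_functor \<C> \<M> T C)
    (\<A>\<B>_unit \<C> \<M> T S C) (\<A>\<B>_counit \<C> \<M> T S C)"
proof (intro adjunction.intro unit_natural counit_natural \<A>_cat_functor \<B>_cat_functor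
    adjunction_axioms.intro, simp_all only: split_paired_all)
  fix P d
  assume "(P, d) \<in> Ob CM"
  then have P: "G.coalgebra P d" by simp
  from \<B>_eq_coinvariants[OF \<A>_ob_bialgebra[OF P]] obtain N b e where
    B: "\<B>_eq \<C> \<M> T C (ob S P, mu S P, law P \<bullet> ar S (\<iota>C P \<bullet> d)) = ((N, b), e, (ob G (ob S P), \<delta> (ob S P)))"
      "\<B>_ob \<C> \<M> T C (ob S P, mu S P, law P \<bullet> ar S (\<iota>C P \<bullet> d)) = (N, b)"
      "coinvariants (ob S P) (mu S P) (law P \<bullet> ar S (\<iota>C P \<bullet> d)) N b e" .
  from \<A>\<B>_unit_arrow[OF P B(1)[folded \<A>_ob_eq[OF P]] B(3)] obtain k where
    k: "\<A>\<B>_unit \<C> \<M> T S C (P, d) = ((P, d), k, (N, b))" "G.coalgebra_hom P d k N b"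
      "e \<bullet> k = ar G (iota S P) \<bullet> d" .
  have "evaluation (ob S P) (mu S P) e \<bullet> ar S k = Ident \<M> (ob S P)"
    by (rule evaluation_free[OF P _ _ _ k(3)])
      (simp_all add: hom_iff G.coalgebra_homD(1-3)[OF k(2)] G.coalgebra_homD(1-3)[OF coinvariantsD(3)[OF B(3)]])
  then show "\<A>\<B>_counit \<C> \<M> T S C (ob (\<A>_functor \<M> S C) (P, d))
      \<bullet>\<^bsub>HM\<^esub> ar (\<A>_functor \<M> S C) (\<A>\<B>_unit \<C> \<M> T S C (P, d)) = Ident HM (ob (\<A>_functor \<M> S C) (P, d))"
    by (simp add: \<A>_functor_simps k(1) \<A>_ob_eq[OF P] \<A>\<B>_counit_eq[OF B(1)])
next
  fix P \<sigma> \<zeta>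
  assume "(P, \<sigma>, \<zeta>) \<in> Ob HM"
  then have y: "bialgebra P \<sigma> \<zeta>" by simp
  from \<B>_eq_coinvariants[OF y] obtain N d e where
    B: "\<B>_eq \<C> \<M> T C (P, \<sigma>, \<zeta>) = ((N, d), e, (ob G P, \<delta> P))" "\<B>_ob \<C> \<M> T C (P, \<sigma>, \<zeta>) = (N, d)"
      "coinvariants P \<sigma> \<zeta> N d e" .
  note N = coinvariantsD(2)[OF B(3)]
  from \<B>_eq_coinvariants[OF \<A>_ob_bialgebra[OF N]] obtain N' d' e' where
    B': "\<B>_eq \<C> \<M> T C (ob S N, mu S N, law N \<bullet> ar S (\<iota>C N \<bullet> d)) = ((N', d'), e', (ob G (ob S N), \<delta> (ob S N)))"
      "\<B>_ob \<C> \<M> T C (ob S N, mu S N, law N \<bullet> ar S (\<iota>C N \<bullet> d)) = (N', d')"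
      "coinvariants (ob S N) (mu S N) (law N \<bullet> ar S (\<iota>C N \<bullet> d)) N' d' e'" .
  from \<A>\<B>_unit_arrow[OF N B'(1)[folded \<A>_ob_eq[OF N]] B'(3)] obtain k where
    k: "\<A>\<B>_unit \<C> \<M> T S C (N, d) = ((N, d), k, (N', d'))" "G.coalgebra_hom N d k N' d'"
      "e' \<bullet> k = ar G (iota S N) \<bullet> d" .
  from \<B>_arrow[OF \<A>_ob_bialgebra[OF N] y evaluation_coalgebra_hom[OF B(3)] B'(1,3) B(1,3)] obtain l where
    l: "ar (\<B>_functor \<C> \<M> T C) ((ob S N, mu S N, law N \<bullet> ar S (\<iota>C N \<bullet> d)), evaluation P \<sigma> e, (P, \<sigma>, \<zeta>))
        = ((N', d'), l, (N, d))"
      "G.coalgebra_hom N' d' l N d" "e \<bullet> l = ar G (evaluation P \<sigma> e) \<bullet> e'" .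
  note [simp] = G.coalgebra_homD(1-3)[OF k(2)] G.coalgebra_homD(1-3)[OF l(2)] G.coalgebraD(1-4)[OF N]
    G.coalgebra_homD(1-3)[OF coinvariantsD(3)[OF B(3)]] G.coalgebra_homD(1-3)[OF coinvariantsD(3)[OF B'(3)]]
    bialgebraD(1)[OF y]
  have "l \<bullet> k = Ident \<M> N"
  proof (rule coinvariants_mono[OF B(3)])
    show "G.coalgebra_hom N d (l \<bullet> k) N d"
      by (rule G.coalgebra_hom_Comp[OF N coinvariantsD(2)[OF B'(3)] N k(2) l(2)])
    show "G.coalgebra_hom N d (Ident \<M> N) N d" by (rule G.coalgebra_hom_Ident[OF N])
    have "e \<bullet> (l \<bullet> k) = ar G (evaluation P \<sigma> e) \<bullet> (e' \<bullet> k)"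
      by (simp add: Comp_reduce[OF l(3)] Comp_assoc_arr)
    also have "\<dots> = e" unfolding k(3) by (rule evaluation_iota[OF B(3)])
    finally show "e \<bullet> (l \<bullet> k) = e \<bullet> Ident \<M> N" by simp
  qed
  then show "ar (\<B>_functor \<C> \<M> T C) (\<A>\<B>_counit \<C> \<M> T S C (P, \<sigma>, \<zeta>))
      \<bullet>\<^bsub>CM\<^esub> \<A>\<B>_unit \<C> \<M> T S C (ob (\<B>_functor \<C> \<M> T C) (P, \<sigma>, \<zeta>))
      = Ident CM (ob (\<B>_functor \<C> \<M> T C) (P, \<sigma>, \<zeta>))"
    by (simp add: \<B>_functor_ob B(2) \<A>\<B>_counit_eq[OF B(1)] \<A>_ob_eq[OF N] k(1) l(1))
qed

lemma galois_map_eq: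
  assumes "P \<in> Ob \<M>"
  shows "galois_map \<C> \<M> T S (carr C) P = galois (ob S P) (mu S P)"
proof -
  have "galois (ob S P) (mu S P) = ar K (mu S P) \<bullet> (law (ob S P) \<bullet> ar S (\<iota>C (ob S P)))"
    unfolding galois_def using assms by (intro Comp_assoc_arr) (simp_all add: hat_simps)
  also have "law (ob S P) \<bullet> ar S (\<iota>C (ob S P)) = chi S (carr C) (ob S P)"
    using assms by (intro law_iota_eq_chi) simp
  finally show ?thesis by (simp add: galois_map_def hat_simps)
qed

text \<open>Invertibility of the counit is used at the cofree bialgebra over a free algebra.\<close>

lemma galois_iso_of_equivalence:
  assumes equiv: "adjoint_equivalence CM HM (\<A>_functor \<M> S C) (\<B>_functor \<C> \<M> T C)
      (\<A>\<B>_unit \<C> \<M> T S C) (\<A>\<B>_counit \<C> \<M> T S C)"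
    and P: "P \<in> Ob \<M>"
  shows "is_iso \<M> (galois_map \<C> \<M> T S (carr C) P)"
proof -
  let ?\<tau> = "ar K (mu S P) \<bullet> law (ob S P)"
  note alg = free_algebra[OF P]
  note y = cofree_bialgebra[OF alg]
  from \<B>_eq_coinvariants[OF y] obtain N d e where
    B: "\<B>_eq \<C> \<M> T C (ob K (ob S P), ?\<tau>, hat_comult \<M> Z (ob S P))
        = ((N, d), e, (ob G (ob K (ob S P)), \<delta> (ob K (ob S P))))"
      "\<B>_ob \<C> \<M> T C (ob K (ob S P), ?\<tau>, hat_comult \<M> Z (ob S P)) = (N, d)"
      "coinvariants (ob K (ob S P)) ?\<tau> (hat_comult \<M> Z (ob S P)) N d e" .
  have "is_iso HM (\<A>\<B>_counit \<C> \<M> T S C (ob K (ob S P), ?\<tau>, hat_comult \<M> Z (ob S P)))"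
    using y by (intro adjoint_equivalence.counit_iso[OF equiv]) simp
  then have "is_iso \<M> (evaluation (ob K (ob S P)) ?\<tau> e)"
    unfolding \<A>\<B>_counit_eq[OF B(1)] \<A>_ob_eq[OF coinvariantsD(2)[OF B(3)]] by (rule HM_isoD)
  then show "is_iso \<M> (galois_map \<C> \<M> T S (carr C) P)"
    unfolding galois_map_eq[OF P] by (rule galois_iso_of_evaluation_iso[OF alg B(3)])
qed

text \<open>
  The counits are invertible by \<open>evaluation_iso\<close>. By the triangle identity \<open>S k\<close> is then the inverse of a
  counit, for \<open>k\<close> the unit, so that \<open>k\<close> is invertible because \<open>S\<close> is conservative.
\<close>

lemma equivalence_of_galois_iso:
  assumes S_preserves: "preserves_coreflexive_equalizers \<M> \<M> S"
    and S_conservative: "conservative \<M> \<M> S"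
    and galois: "\<forall>P \<in> Ob \<M>. is_iso \<M> (galois_map \<C> \<M> T S (carr C) P)"
  shows "adjoint_equivalence CM HM (\<A>_functor \<M> S C) (\<B>_functor \<C> \<M> T C)
      (\<A>\<B>_unit \<C> \<M> T S C) (\<A>\<B>_counit \<C> \<M> T S C)"
proof -
  have iso: "is_iso \<M> (galois P \<sigma>)" if "is_algebra \<M> S P \<sigma>" for P \<sigma>
    by (rule galois_algebra_iso[OF _ that]) (use galois galois_map_eq in auto)
  have counit_iso: "is_iso \<M> (evaluation P \<sigma> e)" if "coinvariants P \<sigma> \<zeta> N d e" for P \<sigma> \<zeta> N d e
    by (rule evaluation_iso[OF _ S_preserves that]) (rule iso)
  show ?thesis
  proof (intro adjoint_equivalence.intro adjunction adjoint_equivalence_axioms.intro,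
      simp_all only: split_paired_all)
    fix P d
    assume Pd: "(P, d) \<in> Ob CM"
    then have P: "G.coalgebra P d" by simp
    from \<B>_eq_coinvariants[OF \<A>_ob_bialgebra[OF P]] obtain N b e where
      B: "\<B>_eq \<C> \<M> T C (ob S P, mu S P, law P \<bullet> ar S (\<iota>C P \<bullet> d))
          = ((N, b), e, (ob G (ob S P), \<delta> (ob S P)))"
        "\<B>_ob \<C> \<M> T C (ob S P, mu S P, law P \<bullet> ar S (\<iota>C P \<bullet> d)) = (N, b)"
        "coinvariants (ob S P) (mu S P) (law P \<bullet> ar S (\<iota>C P \<bullet> d)) N b e" .
    from \<A>\<B>_unit_arrow[OF P B(1)[folded \<A>_ob_eq[OF P]] B(3)] obtain k where
      k: "\<A>\<B>_unit \<C> \<M> T S C (P, d) = ((P, d), k, (N, b))" "G.coalgebra_hom P d k N b"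
        "e \<bullet> k = ar G (iota S P) \<bullet> d" .
    note [simp] = G.coalgebraD(1-4)[OF P] G.coalgebra_homD(1-3)[OF k(2)]
      G.coalgebra_homD(1-3)[OF coinvariantsD(3)[OF B(3)]]
    have "evaluation (ob S P) (mu S P) e \<bullet> ar S k = Ident \<M> (ob S P)"
      by (rule evaluation_free[OF P _ _ _ k(3)]) (simp_all add: hom_iff)
    then have "is_iso \<M> (evaluation (ob S P) (mu S P) e \<bullet> ar S k)" by (simp add: is_iso_Ident)
    then have "is_iso \<M> (ar S k)"
      by (rule is_iso_cancel_left[OF _ counit_iso[OF B(3)]]) (simp_all add: free_algebra)
    then have "is_iso \<M> k"
      using S_conservative unfolding conservative_def by simp
    then show "is_iso CM (\<A>\<B>_unit \<C> \<M> T S C (P, d))"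
      unfolding k(1) by (intro CM_isoI) (simp_all add: P k(2) coinvariantsD(2)[OF B(3)])
  next
    fix P \<sigma> \<zeta>
    assume "(P, \<sigma>, \<zeta>) \<in> Ob HM"
    then have y: "bialgebra P \<sigma> \<zeta>" by simp
    from \<B>_eq_coinvariants[OF y] obtain N d e where
      B: "\<B>_eq \<C> \<M> T C (P, \<sigma>, \<zeta>) = ((N, d), e, (ob G P, \<delta> P))"
        "\<B>_ob \<C> \<M> T C (P, \<sigma>, \<zeta>) = (N, d)" "coinvariants P \<sigma> \<zeta> N d e" .
    note N = coinvariantsD(2)[OF B(3)]
    show "is_iso HM (\<A>\<B>_counit \<C> \<M> T S C (P, \<sigma>, \<zeta>))"
      unfolding \<A>\<B>_counit_eq[OF B(1)] \<A>_ob_eq[OF N]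
      using evaluation_algebra_hom[OF B(3)] evaluation_coalgebra_hom[OF B(3)]
      by (intro HM_isoI counit_iso[OF B(3)]) (simp_all add: y \<A>_ob_bialgebra[OF N])
  qed
qed

end

theorem theorem5p10:
  fixes \<C> :: "('o, 'a) monoidal_category"
    and \<M> :: "('o, 'a, 'p, 'b) module_category"
    and T :: "('o, 'a) bimonad"
    and S :: "('o, 'p, 'b) comodule_monad"
    and C :: "('o, 'a) comonoid"
  assumes "monoidal_category \<C>"
    and "module_category \<C> \<M>"
    and "bimonad \<C> T"
    and "comodule_monad \<C> \<M> T S"
    and "comonoid \<C> C"
    and "has_coreflexive_equalizers \<M>"
    and "preserves_coreflexive_equalizers \<M> \<M> (hat \<C> \<M> C)"
    and "preserves_coreflexive_equalizers \<M> \<M> S"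
    and "conservative \<M> \<M> S"
  shows "adjoint_equivalence (comodule_category \<C> \<M> C) (free_hopf_category \<C> \<M> T S C)
           (\<A>_functor \<M> S C) (\<B>_functor \<C> \<M> T C) (\<A>\<B>_unit \<C> \<M> T S C) (\<A>\<B>_counit \<C> \<M> T S C)
         \<longleftrightarrow> (\<forall>P \<in> Ob \<M>. is_iso \<M> (galois_map \<C> \<M> T S (carr C) P))"
proof -
  interpret comodule_monad \<C> \<M> T S by fact
  interpret C: comonoid \<C> C by fact
  interpret hopf_equalizer_setting \<C> \<M> T S C
    by unfold_locales fact+
  show ?thesis
    using galois_iso_of_equivalence equivalence_of_galois_iso assms(8,9) by blast
qed

end
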